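(* For any $\epsilon>0$, there is a two-sided adaptive algorithm for $\epsilon$-testing size-$s$ Decision Tree and size-$s$ Branching Program with respect to the uniform distribution that makes $\tilde O(s/\epsilon)$ queries. Moreover, there is a two-sided distribution-free adaptive algorithm for $\epsilon$-testing size-$s$ Decision Tree and size-$s$ Branching Program that makes $\tilde O(s^2/\epsilon)$ queries.
   Context: Boolean functions $f:\{0,1\}^n\to\{0,1\}$ are accessed through a membership-query oracle that returns $f(x)$ for a queried $x$. For a distribution $\mathcal D$ on $\{0,1\}^n$, $f$ is $\epsilon$-far from a class $C$ with respect to $\mathcal D$ if $\Pr_{x\sim\mathcal D}[f(x)\neq g(x)]\ge\epsilon$ for every $g\in C$. A two-sided adaptive algorithm for $\epsilon$-testing $C$ (with respect to the uniform distribution) is a randomized algorithm that, given $\epsilon$ and membership-query access to an arbitrary $f$ (and able to draw uniform random strings), chooses queries possibly adaptively, accepts with probability at least $2/3$ if $f\in C$, and rejects with probability at least $2/3$ if $f$ is $\epsilon$-far from every function in $C$ with respect to the uniform distribution. A distribution-free such algorithm additionally has an oracle returning independent samples from an arbitrary unknown distribution $\mathcal D$, and must satisfy the same guarantees with distances measured with respect to $\mathcal D$, for every $\mathcal D$. Queries count membership queries and samples. $\tilde O(T)$ means $O(T\cdot\mathrm{poly}(\log T))$. A decision tree is a rooted binary tree whose internal nodes are labeled by variables and have two children (taken according to whether the variable is $0$ or $1$), with leaves labeled by outputs in $\{0,1\}$; its size is the number of leaves; size-$s$ Decision Tree is the class of decision trees of size $s$. A branching program is a rooted directed acyclic graph with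 two sinks labeled $0$ and $1$, each internal node labeled by a variable with two outgoing edges labeled $0$ and $1$; its size is its number of nodes; size-$s$ Branching Program is the class of branching programs of size $s$. *)

theory Defs
  imports "HOL-Probability.Probability" "HOL-Library.Landau_Symbols"
begin

type_synonym point = "bool list"
type_synonym bool_fun = "point \<Rightarrow> bool"

definition cube :: "nat \<Rightarrow> point set" where
  "cube n = {x. length x = n}"

text \<open>
  A function on \<open>{0,1}^n\<close> is any \<^typ>\<open>bool_fun\<close>; its values outside \<open>cube n\<close> are never
  consulted. The classes below are accordingly closed under changes outside \<open>cube n\<close>.
\<close>

definition far_from :: "real \<Rightarrow> point pmf \<Rightarrow> bool_fun set \<Rightarrow> bool_fun \<Rightarrow> bool" where
  "far_from \<epsilon> D C f \<longleftrightarrow> (\<forall>g\<in>C. measure_pmf.prob D {x. f x \<noteq> g x} \<ge> \<epsilon>)"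

text \<open>
  The continuation of each step receives the oracle's answer, which makes the algorithm adaptive.
  \<open>Random\<close> is internal randomness: it depends on neither \<open>f\<close> nor \<open>D\<close> and is not charged as a query.
\<close>

datatype 'r algorithm =
    Return 'r
  | Query point "bool \<Rightarrow> 'r algorithm"
  | Sample "point \<Rightarrow> 'r algorithm"
  | Random "nat pmf" "nat \<Rightarrow> 'r algorithm"

primrec run :: "bool_fun \<Rightarrow> point pmf \<Rightarrow> 'r algorithm \<Rightarrow> 'r pmf" where
  "run f D (Return r) = return_pmf r"
| "run f D (Query x k) = run f D (k (f x))"
| "run f D (Sample k) = bind_pmf D (\<lambda>x. run f D (k x))"
| "run f D (Random p k) = bind_pmf p (\<lambda>i. run f D (k i))"

text \<open>
  \<open>queries_le n A q\<close>: on every computation path \<open>A\<close> makes at most \<open>q\<close> membership queries and draws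
  from the sampling oracle altogether, and it only queries points of \<open>{0,1}^n\<close>.
\<close>

primrec queries_le :: "nat \<Rightarrow> 'r algorithm \<Rightarrow> nat \<Rightarrow> bool" where
  "queries_le n (Return r) q \<longleftrightarrow> True"
| "queries_le n (Query x k) q \<longleftrightarrow> x \<in> cube n \<and> q > 0 \<and> (\<forall>b. queries_le n (k b) (q - 1))"
| "queries_le n (Sample k) q \<longleftrightarrow> q > 0 \<and> (\<forall>x\<in>cube n. queries_le n (k x) (q - 1))"
| "queries_le n (Random p k) q \<longleftrightarrow> (\<forall>i\<in>set_pmf p. queries_le n (k i) q)"

text \<open>Output \<^term>\<open>True\<close> means accept, \<^term>\<open>False\<close> means reject.\<close>

definition tests_wrt :: "point pmf \<Rightarrow> bool_fun set \<Rightarrow> real \<Rightarrow> bool algorithm \<Rightarrow> bool" where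
  "tests_wrt D C \<epsilon> A \<longleftrightarrow>
     (\<forall>f. (f \<in> C \<longrightarrow> pmf (run f D A) True \<ge> 2 / 3) \<and>
          (far_from \<epsilon> D C f \<longrightarrow> pmf (run f D A) False \<ge> 2 / 3))"

definition uniform_tester :: "nat \<Rightarrow> bool_fun set \<Rightarrow> real \<Rightarrow> bool algorithm \<Rightarrow> bool" where
  "uniform_tester n C \<epsilon> A \<longleftrightarrow> tests_wrt (pmf_of_set (cube n)) C \<epsilon> A"

definition distribution_free_tester :: "nat \<Rightarrow> bool_fun set \<Rightarrow> real \<Rightarrow> bool algorithm \<Rightarrow> bool" where
  "distribution_free_tester n C \<epsilon> A \<longleftrightarrow>
     (\<forall>D. set_pmf D \<subseteq> cube n \<longrightarrow> tests_wrt D C \<epsilon> A)"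

definition makes_at_most :: "nat \<Rightarrow> bool algorithm \<Rightarrow> real \<Rightarrow> bool" where
  "makes_at_most n A b \<longleftrightarrow> (\<exists>q. queries_le n A q \<and> real q \<le> b)"

text \<open>The functions \<open>B\<close> with \<open>B(T) = O(T \<cdot> poly(log T))\<close>.\<close>

definition soft_O :: "(real \<Rightarrow> real) set" where
  "soft_O = {B. \<exists>k::nat. B \<in> O(\<lambda>T. T * ln T ^ k)}"

text \<open>In \<open>Node i l r\<close>, the subtree \<open>l\<close> is taken if variable \<open>i\<close> is 0 and \<open>r\<close> if it is 1.\<close>

datatype dtree = Leaf bool | Node nat dtree dtree

primrec dt_vars :: "dtree \<Rightarrow> nat set" where
  "dt_vars (Leaf b) = {}"
| "dt_vars (Node i l r) = insert i (dt_vars l \<union> dt_vars r)"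

primrec dt_size :: "dtree \<Rightarrow> nat" where
  "dt_size (Leaf b) = 1"
| "dt_size (Node i l r) = dt_size l + dt_size r"

primrec dt_eval :: "dtree \<Rightarrow> point \<Rightarrow> bool" where
  "dt_eval (Leaf b) x = b"
| "dt_eval (Node i l r) x = (if x ! i then dt_eval r x else dt_eval l x)"

text \<open>
  Size is taken to be exactly \<open>s\<close>. For \<open>n > 0\<close> this yields the same functions as size at most \<open>s\<close>,
  since variables may repeat along a path (and branching programs may have unreachable nodes).
\<close>

definition decision_tree_class :: "nat \<Rightarrow> nat \<Rightarrow> bool_fun set" where
  "decision_tree_class n s =
     {f. \<exists>t. dt_vars t \<subseteq> {..<n} \<and> dt_size t = s \<and> (\<forall>x\<in>cube n. f x = dt_eval t x)}"

text \<open>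
  \<open>bp_sink b\<close> is the sink labeled \<open>b\<close>. Every other node \<open>v\<close> is internal, is labeled by the variable
  \<open>bp_var v\<close>, and its outgoing edge labeled \<open>b\<close> leads to \<open>bp_succ v b\<close>; edges are given by labels,
  so both may lead to the same node. \<open>bp_var\<close> and \<open>bp_succ\<close> are irrelevant on other arguments.
\<close>

record bprog =
  bp_nodes :: "nat set"
  bp_root :: nat
  bp_sink :: "bool \<Rightarrow> nat"
  bp_var :: "nat \<Rightarrow> nat"
  bp_succ :: "nat \<Rightarrow> bool \<Rightarrow> nat"

definition bp_internal :: "bprog \<Rightarrow> nat set" where
  "bp_internal P = bp_nodes P - range (bp_sink P)"

definition bp_edges :: "bprog \<Rightarrow> (nat \<times> nat) set" where
  "bp_edges P = {(v, bp_succ P v b) | v b. v \<in> bp_internal P}"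

definition branching_program :: "nat \<Rightarrow> bprog \<Rightarrow> bool" where
  "branching_program n P \<longleftrightarrow>
     finite (bp_nodes P) \<and> bp_root P \<in> bp_nodes P \<and>
     range (bp_sink P) \<subseteq> bp_nodes P \<and> bp_sink P False \<noteq> bp_sink P True \<and>
     (\<forall>v\<in>bp_internal P. bp_var P v < n \<and> (\<forall>b. bp_succ P v b \<in> bp_nodes P)) \<and>
     acyclic (bp_edges P)"

definition bp_step :: "bprog \<Rightarrow> point \<Rightarrow> (nat \<times> nat) set" where
  "bp_step P x = {(v, bp_succ P v (x ! bp_var P v)) | v. v \<in> bp_internal P}"

text \<open>
  The computation path of \<open>x\<close> from the root ends in the sink labeled \<open>b\<close>; for a branching program
  this holds for exactly one \<open>b\<close>.
\<close>

definition bp_outputs :: "bprog \<Rightarrow> point \<Rightarrow> bool \<Rightarrow> bool" where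
  "bp_outputs P x b \<longleftrightarrow> (bp_root P, bp_sink P b) \<in> (bp_step P x)\<^sup>*"

definition branching_program_class :: "nat \<Rightarrow> nat \<Rightarrow> bool_fun set" where
  "branching_program_class n s =
     {f. \<exists>P. branching_program n P \<and> card (bp_nodes P) = s \<and> (\<forall>x\<in>cube n. bp_outputs P x (f x))}"

end

theory Submission
  imports Defs
begin

text \<open>
  A function in the class depends on at most \<open>s\<close> variables. Split the variables at random into
  \<open>O(s\<^sup>2)\<close> blocks, so that the relevant ones are probably separated, and find the relevant blocks by
  comparing \<open>f\<close> at samples with \<open>f\<close> after zeroing all other blocks, followed by binary search.
  On each block found, \<open>f\<close> must look like a literal. A dictator test (self-correction in the style of
  Blum, Luby and Rubinfeld, plus multiplicativity) commits to one variable per block and makes its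
  value on any given point computable with \<open>O(log(s/\<epsilon>))\<close> queries. Hence \<open>f\<close> can be compared, on
  \<open>O(1/\<epsilon>)\<close> samples, with the function \<open>F\<close> of \<open>s\<close> variables obtained from inputs that are constant
  on blocks; each comparison decodes up to \<open>s\<close> values. Finally \<open>F\<close> is compared with the class on
  \<open>s\<close> variables. That class has only \<open>exp(O(s log s))\<close> members, so consistency of some member with
  \<open>O(s log s/\<epsilon>)\<close> labelled points suffices by a union bound. For the uniform distribution these
  points can be drawn directly at one query each; otherwise they must be decoded from samples, which
  costs another factor \<open>s\<close>. The only error on functions in the class is a bad partition.
\<close>

subsection \<open>Composing algorithms\<close>

text \<open>The query bound must not depend on \<open>n\<close>, whereas locating a relevant
  variable inside its block by binary search would cost about \<open>log n\<close> queries. So the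
  variable \<open>\<tau>\<close> of a block occurs only in the analysis; the tester merely evaluates
  it at given points. Soundness holds for every partition, separating or not, so the dictator test
  cannot presuppose that a block has one relevant variable. Closure under substitution is used in
  both directions: \<open>F\<close> lies in the class on \<open>s\<close> variables if
  \<open>f\<close> lies in the class on \<open>n\<close>, and a member \<open>h\<close> on
  \<open>s\<close> variables composed with decoding is a member on \<open>n\<close> variables, hence
  at distance at least \<open>\<epsilon>\<close> from a far \<open>f\<close>. This distance is split
  into thirds: from \<open>f\<close> to \<open>f\<close> with the missing blocks zeroed, from there
  to \<open>F\<close> of the decoded point, and from \<open>F\<close> to \<open>h\<close>. The
  uniform case saves a factor \<open>s\<close> because different blocks have different variables, so
  the decoded bits of a uniform point are again uniform and need not be decoded. For far functions,
  an error of \<open>1 / 6\<close> goes to the block search and \<open>1 / 6\<close> to the one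
  later stage that has to reject.\<close>

primrec abind :: "'a algorithm \<Rightarrow> ('a \<Rightarrow> 'b algorithm) \<Rightarrow> 'b algorithm" where
  "abind (Return a) k = k a"
| "abind (Query x c) k = Query x (\<lambda>b. abind (c b) k)"
| "abind (Sample c) k = Sample (\<lambda>x. abind (c x) k)"
| "abind (Random p c) k = Random p (\<lambda>i. abind (c i) k)"

text \<open>\<open>Random\<close> draws only natural numbers; a countable encoding makes cube points
  and partitions available.\<close>

definition rand :: "'a::countable pmf \<Rightarrow> ('a \<Rightarrow> 'r algorithm) \<Rightarrow> 'r algorithm" where
  "rand p k = Random (map_pmf to_nat p) (\<lambda>i. k (from_nat i))"

text \<open>The result \<^const>\<open>None\<close> means that the tester rejects.\<close>

definition obind :: "'a option algorithm \<Rightarrow> ('a \<Rightarrow> 'b option algorithm) \<Rightarrow> 'b option algorithm" where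
  "obind A k = abind A (\<lambda>r. case r of None \<Rightarrow> Return None | Some a \<Rightarrow> k a)"

primrec for_list :: "('b \<Rightarrow> 'a option algorithm) \<Rightarrow> 'b list \<Rightarrow> 'a list option algorithm" where
  "for_list A [] = Return (Some [])"
| "for_list A (x # xs) = obind (A x) (\<lambda>a. obind (for_list A xs) (\<lambda>as. Return (Some (a # as))))"

lemma run_abind: "run f D (abind A k) = bind_pmf (run f D A) (\<lambda>a. run f D (k a))"
  by (induction A) (auto simp: bind_return_pmf bind_assoc_pmf)

lemma run_rand: "run f D (rand p k) = bind_pmf p (\<lambda>x. run f D (k x))"
  by (simp add: rand_def bind_map_pmf)

text \<open>Bounds on the queries of a continuation depend on the results passed to it (points must lie in
  the cube, few blocks may be found), hence the postcondition \<open>P\<close>.\<close>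

primrec outputs_le :: "nat \<Rightarrow> 'r algorithm \<Rightarrow> nat \<Rightarrow> ('r \<Rightarrow> bool) \<Rightarrow> bool" where
  "outputs_le n (Return r) q P \<longleftrightarrow> P r"
| "outputs_le n (Query x k) q P \<longleftrightarrow> x \<in> cube n \<and> q > 0 \<and> (\<forall>b. outputs_le n (k b) (q - 1) P)"
| "outputs_le n (Sample k) q P \<longleftrightarrow> q > 0 \<and> (\<forall>x\<in>cube n. outputs_le n (k x) (q - 1) P)"
| "outputs_le n (Random p k) q P \<longleftrightarrow> (\<forall>i\<in>set_pmf p. outputs_le n (k i) q P)"

lemma outputs_le_queries_le: "outputs_le n A q P \<Longrightarrow> queries_le n A q"
  by (induction A arbitrary: q) auto

lemma outputs_le_mono:
  "outputs_le n A p P \<Longrightarrow> p \<le> q \<Longrightarrow> (\<And>r. P r \<Longrightarrow> Q r) \<Longrightarrow> outputs_le n A q Q"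
proof (induction A arbitrary: p q)
  case (Query x k)
  have "p - 1 \<le> q - 1" using Query.prems(2) by simp
  then show ?case using Query by fastforce
next
  case (Sample k)
  have "p - 1 \<le> q - 1" using Sample.prems(2) by simp
  then show ?case using Sample by fastforce
next
  case (Random p' k)
  then show ?case by fastforce
qed auto

lemma outputs_le_abind:
  "outputs_le n A p P \<Longrightarrow> (\<And>a. P a \<Longrightarrow> outputs_le n (k a) q Q) \<Longrightarrow> outputs_le n (abind A k) (p + q) Q"
proof (induction A arbitrary: p)
  case (Return x)
  then have "outputs_le n (k x) q Q" by auto
  then show ?case by (auto elim: outputs_le_mono)
next
  case (Query x c)
  then have "0 < p" by simp
  then have eq: "p - 1 + q = p + q - 1" by linarith
  have "outputs_le n (abind (c b) k) (p - 1 + q) Q" for b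
    by (rule Query.IH) (use Query.prems in auto)
  then show ?case using Query.prems unfolding eq by simp
next
  case (Sample c)
  then have "0 < p" by simp
  then have eq: "p - 1 + q = p + q - 1" by linarith
  have "outputs_le n (abind (c x) k) (p - 1 + q) Q" if "x \<in> cube n" for x
    by (rule Sample.IH) (use Sample.prems that in auto)
  then show ?case using Sample.prems unfolding eq by simp
qed auto

lemma outputs_le_rand:
  "(\<And>x. x \<in> set_pmf p \<Longrightarrow> outputs_le n (k x) q P) \<Longrightarrow> outputs_le n (rand p k) q P"
  by (auto simp: rand_def)

lemma outputs_le_obind:
  assumes "outputs_le n A p (\<lambda>r. \<forall>a. r = Some a \<longrightarrow> P a)"
    "\<And>a. P a \<Longrightarrow> outputs_le n (k a) q (\<lambda>r. \<forall>b. r = Some b \<longrightarrow> Q b)"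
  shows "outputs_le n (obind A k) (p + q) (\<lambda>r. \<forall>b. r = Some b \<longrightarrow> Q b)"
  unfolding obind_def
  by (rule outputs_le_abind[OF assms(1)]) (auto split: option.splits intro: assms(2))

lemma outputs_le_for_list:
  assumes "\<And>x. x \<in> set xs \<Longrightarrow> outputs_le n (A x) c (\<lambda>r. \<forall>a. r = Some a \<longrightarrow> P a)"
  shows "outputs_le n (for_list A xs) (length xs * c)
    (\<lambda>r. \<forall>as. r = Some as \<longrightarrow> length as = length xs \<and> (\<forall>a\<in>set as. P a))"
  using assms
proof (induction xs)
  case (Cons x xs)
  have "outputs_le n (for_list A (x # xs)) (c + (length xs * c + 0))
    (\<lambda>r. \<forall>as. r = Some as \<longrightarrow> length as = length (x # xs) \<and> (\<forall>a\<in>set as. P a))"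
    unfolding for_list.simps
    apply (rule outputs_le_obind[where P = P])
    using Cons.prems apply simp
    apply (rule outputs_le_obind[where P = "\<lambda>as. length as = length xs \<and> (\<forall>a\<in>set as. P a)"])
    using Cons apply simp
    by auto
  then show ?case by simp
qed simp

subsection \<open>Sure outcomes and outcome probabilities\<close>

text \<open>Once the partition separates the relevant variables, no further error is possible for a
  function in the class. Completeness is therefore argued on the support of the output, with no
  probabilities to track.\<close>

definition surely :: "bool_fun \<Rightarrow> point pmf \<Rightarrow> 'r algorithm \<Rightarrow> ('r \<Rightarrow> bool) \<Rightarrow> bool" where
  "surely f D A P \<longleftrightarrow> (\<forall>r\<in>set_pmf (run f D A). P r)"

lemma surely_simps [simp]:
  "surely f D (Return r) P \<longleftrightarrow> P r"
  "surely f D (Query x kq) P \<longleftrightarrow> surely f D (kq (f x)) P"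
  "surely f D (Sample ks) P \<longleftrightarrow> (\<forall>x\<in>set_pmf D. surely f D (ks x) P)"
  "surely f D (rand p kr) P \<longleftrightarrow> (\<forall>x\<in>set_pmf p. surely f D (kr x) P)"
  by (auto simp: surely_def run_rand)

lemma surely_mono: "surely f D A P \<Longrightarrow> (\<And>r. P r \<Longrightarrow> Q r) \<Longrightarrow> surely f D A Q"
  by (auto simp: surely_def)

lemma surely_abind: "surely f D (abind A k) Q \<longleftrightarrow> surely f D A (\<lambda>a. surely f D (k a) Q)"
  by (auto simp: surely_def run_abind)

lemma surely_obind:
  "surely f D A (\<lambda>r. \<exists>a. r = Some a \<and> P a) \<Longrightarrow> (\<And>a. P a \<Longrightarrow> surely f D (k a) Q) \<Longrightarrow>
    surely f D (obind A k) Q"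
  unfolding obind_def surely_abind by (erule surely_mono) auto

lemma surely_for_list:
  assumes "\<And>x. x \<in> set xs \<Longrightarrow> surely f D (A x) (\<lambda>r. \<exists>a. r = Some a \<and> P x a)"
  shows "surely f D (for_list A xs) (\<lambda>r. \<exists>as. r = Some as \<and> list_all2 P xs as)"
  using assms
proof (induction xs)
  case (Cons x xs)
  show ?case
    unfolding for_list.simps
    apply (rule surely_obind[where P = "P x"])
    using Cons.prems apply simp
    apply (rule surely_obind[where P = "list_all2 P xs"])
    using Cons by auto
qed simp

text \<open>Rejecting a far function is always right, so soundness only needs upper bounds on ending
  in \<open>Some\<close>. With \<open>P\<close> constantly true this is the acceptance
  probability.\<close>

definition prob_some :: "bool_fun \<Rightarrow> point pmf \<Rightarrow> 'a option algorithm \<Rightarrow> ('a \<Rightarrow> bool) \<Rightarrow> real" where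
  "prob_some f D A P = measure_pmf.prob (run f D A) {r. \<exists>a. r = Some a \<and> P a}"

lemma prob_some_nonneg [simp]: "0 \<le> prob_some f D A P"
  by (simp add: prob_some_def)

lemma prob_some_le_1 [simp]: "prob_some f D A P \<le> 1"
  by (simp add: prob_some_def)

lemma prob_some_mono: 
  "surely f D A (\<lambda>r. \<forall>a. r = Some a \<longrightarrow> P a \<longrightarrow> Q a) \<Longrightarrow> prob_some f D A P \<le> prob_some f D A Q"
  unfolding prob_some_def surely_def
  by (rule measure_pmf.finite_measure_mono_AE) (auto simp: AE_measure_pmf_iff)

lemma prob_some_union:
  assumes "\<And>a. P a \<Longrightarrow> Q a \<or> R a"
  shows "prob_some f D A P \<le> prob_some f D A Q + prob_some f D A R"
proof -
  have "prob_some f D A P \<le> measure_pmf.prob (run f D A)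
      ({r. \<exists>a. r = Some a \<and> Q a} \<union> {r. \<exists>a. r = Some a \<and> R a})"
    unfolding prob_some_def using assms by (intro measure_pmf.finite_measure_mono) auto
  also have "\<dots> \<le> prob_some f D A Q + prob_some f D A R"
    unfolding prob_some_def by (rule measure_Un_le) auto
  finally show ?thesis .
qed

lemma prob_some_return [simp]: "prob_some f D (Return r) P = of_bool (\<exists>a. r = Some a \<and> P a)"
  by (simp add: prob_some_def measure_return_pmf indicator_def)

lemma prob_some_query [simp]: "prob_some f D (Query x k) P = prob_some f D (k (f x)) P"
  by (simp add: prob_some_def)

lemma prob_bind_pmf:
  "measure_pmf.prob (bind_pmf p k) A = measure_pmf.expectation p (\<lambda>x. measure_pmf.prob (k x) A)"
  by (simp add: measure_pmf_bind measure_pmf.measure_bind[where N = "count_space UNIV"]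
      measure_pmf_in_subprob_algebra)

lemma prob_some_sample:
  "prob_some f D (Sample k) P = measure_pmf.expectation D (\<lambda>x. prob_some f D (k x) P)"
  by (simp add: prob_some_def prob_bind_pmf)

lemma prob_some_rand:
  "prob_some f D (rand p k) P = measure_pmf.expectation p (\<lambda>x. prob_some f D (k x) P)"
  by (simp add: prob_some_def run_rand prob_bind_pmf)

lemma prob_some_abind:
  "prob_some f D (abind A k) P = measure_pmf.expectation (run f D A) (\<lambda>x. prob_some f D (k x) P)"
  by (simp add: prob_some_def run_abind prob_bind_pmf)

lemma integrable_pmf_unit [simp]:
  fixes g :: "'a \<Rightarrow> real"
  assumes "\<And>x. 0 \<le> g x" "\<And>x. g x \<le> 1"
  shows "integrable (measure_pmf p) g"
  by (rule measure_pmf.integrable_const_bound[where B = 1]) (use assms in auto)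

text \<open>The common form of the soundness estimates: the exceptional set \<open>S\<close> is paid
  for in full, and \<open>c\<close> is paid elsewhere.\<close>

lemma expectation_le_prob_add:
  fixes g :: "'a \<Rightarrow> real"
  assumes "\<And>x. 0 \<le> g x" "\<And>x. g x \<le> 1" "\<And>x. x \<in> set_pmf p \<Longrightarrow> x \<notin> S \<Longrightarrow> g x \<le> c" "0 \<le> c"
  shows "measure_pmf.expectation p g \<le> measure_pmf.prob p S + c"
proof -
  have "g x \<le> indicator S x + c" if "x \<in> set_pmf p" for x
    using assms(2)[of x] assms(3)[OF that] assms(4) by (cases "x \<in> S") auto
  then have "measure_pmf.expectation p g \<le> measure_pmf.expectation p (\<lambda>x. indicator S x + c)"
    using assms(1,2) by (intro integral_mono_AE) (auto simp: AE_measure_pmf_iff)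
  also have "\<dots> = measure_pmf.prob p S + c"
    by (subst Bochner_Integration.integral_add) auto
  finally show ?thesis .
qed

lemma prob_some_obind:
  assumes "surely f D A (\<lambda>r. \<forall>a. r = Some a \<longrightarrow> \<not> S a \<longrightarrow> prob_some f D (k a) P \<le> c)" "0 \<le> c"
  shows "prob_some f D (obind A k) P \<le> prob_some f D A S + c"
  unfolding obind_def prob_some_abind prob_some_def[of f D A S]
  by (rule expectation_le_prob_add)
    (use assms in \<open>auto split: option.splits simp: surely_def\<close>)

text \<open>Counterpart of the union bound for two stages that must both go wrong; it turns
  independent repetitions into powers.\<close>

lemma prob_some_obind_mult:
  assumes "\<And>a. S a \<Longrightarrow> prob_some f D (k a) P \<le> c" "\<And>a. \<not> S a \<Longrightarrow> prob_some f D (k a) P = 0"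
  shows "prob_some f D (obind A k) P \<le> prob_some f D A S * c"
proof -
  have "prob_some f D (obind A k) P
      \<le> measure_pmf.expectation (run f D A) (\<lambda>r. indicator {r. \<exists>a. r = Some a \<and> S a} r * c)"
    unfolding obind_def prob_some_abind
    by (rule integral_mono) (use assms in \<open>auto split: option.splits simp: indicator_def\<close>)
  also have "\<dots> = prob_some f D A S * c"
    by (simp add: prob_some_def)
  finally show ?thesis .
qed

lemma prob_some_for_list:
  assumes "\<And>x. x \<in> set xs \<Longrightarrow> prob_some f D (A x) P \<le> c" "0 \<le> c"
  shows "prob_some f D (for_list A xs) (\<lambda>as. \<forall>a\<in>set as. P a) \<le> c ^ length xs"
  using assms(1)
proof (induction xs)
  case (Cons x xs)
  have 1: "prob_some f D (obind (for_list A xs) (\<lambda>as. Return (Some (a # as)))) (\<lambda>as. \<forall>a\<in>set as. P a)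
      \<le> prob_some f D (for_list A xs) (\<lambda>as. \<forall>a\<in>set as. P a) * of_bool (P a)" for a
    by (rule prob_some_obind_mult) auto
  have "prob_some f D (for_list A (x # xs)) (\<lambda>as. \<forall>a\<in>set as. P a)
      \<le> prob_some f D (A x) P * prob_some f D (for_list A xs) (\<lambda>as. \<forall>a\<in>set as. P a)"
    unfolding for_list.simps
  proof (rule prob_some_obind_mult)
    fix a assume "\<not> P a"
    then show "prob_some f D (obind (for_list A xs) (\<lambda>as. Return (Some (a # as)))) (\<lambda>as. \<forall>a\<in>set as. P a) = 0"
      using 1[of a] by (simp add: order_antisym)
  next
    fix a assume "P a"
    then show "prob_some f D (obind (for_list A xs) (\<lambda>as. Return (Some (a # as)))) (\<lambda>as. \<forall>a\<in>set as. P a)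
      \<le> prob_some f D (for_list A xs) (\<lambda>as. \<forall>a\<in>set as. P a)"
      using 1[of a] by simp
  qed
  also have "\<dots> \<le> c * c ^ length xs"
    using Cons assms(2) by (intro mult_mono) auto
  finally show ?case by simp
qed simp

text \<open>One rejecting entry rejects the whole list, so a single bad block decides the dictator
  tests.\<close>

lemma prob_some_for_list_member:
  assumes "x \<in> set xs"
  shows "prob_some f D (for_list A xs) (\<lambda>_. True) \<le> prob_some f D (A x) (\<lambda>_. True)"
  using assms
proof (induction xs)
  case (Cons y xs)
  show ?case
  proof (cases "x = y")
    case True
    have "prob_some f D (for_list A (y # xs)) (\<lambda>_. True) \<le> prob_some f D (A y) (\<lambda>_. True) * 1"
      unfolding for_list.simps by (rule prob_some_obind_mult) auto
    then show ?thesis using True by simp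
  next
    case False
    have "prob_some f D (obind (for_list A xs) (\<lambda>as. Return (Some (a # as)))) (\<lambda>_. True)
      \<le> prob_some f D (for_list A xs) (\<lambda>_. True) * 1" for a
      by (rule prob_some_obind_mult) auto
    then have "prob_some f D (for_list A (y # xs)) (\<lambda>_. True)
        \<le> prob_some f D (A y) (\<lambda>_. True) * prob_some f D (for_list A xs) (\<lambda>_. True)"
      unfolding for_list.simps by (intro prob_some_obind_mult) auto
    also have "\<dots> \<le> 1 * prob_some f D (for_list A xs) (\<lambda>_. True)"
      by (intro mult_right_mono) auto
    finally show ?thesis using Cons False by auto
  qed
qed simp

lemma prob_some_for_list_bad:
  fixes c :: real
  assumes "\<And>x. x \<in> set xs \<Longrightarrow> prob_some f D (A x) (\<lambda>a. \<not> P x a) \<le> c" "0 \<le> c"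
  shows "prob_some f D (for_list A xs) (\<lambda>as. \<not> list_all2 P xs as) \<le> length xs * c"
  using assms(1)
proof (induction xs)
  case (Cons x xs)
  have "prob_some f D (obind (for_list A xs) (\<lambda>as. Return (Some (a # as)))) (\<lambda>as. \<not> list_all2 P (x # xs) as)
      \<le> prob_some f D (for_list A xs) (\<lambda>as. \<not> list_all2 P xs as) + 0" if "P x a" for a
    by (rule prob_some_obind) (use that in \<open>auto simp: surely_def\<close>)
  also have "prob_some f D (for_list A xs) (\<lambda>as. \<not> list_all2 P xs as) + 0 \<le> length xs * c"
    using Cons by simp
  finally have "prob_some f D (for_list A (x # xs)) (\<lambda>as. \<not> list_all2 P (x # xs) as)
      \<le> prob_some f D (A x) (\<lambda>a. \<not> P x a) + length xs * c"
    unfolding for_list.simps using assms(2)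
    by (intro prob_some_obind) (auto simp: surely_def)
  then show ?case
    using Cons.prems[of x] by (simp add: algebra_simps)
qed simp

subsection \<open>Averages over the cube\<close>

abbreviation tab :: "nat \<Rightarrow> (nat \<Rightarrow> bool) \<Rightarrow> point" where
  "tab n \<phi> \<equiv> map \<phi> [0..<n]"

definition xorp :: "nat \<Rightarrow> point \<Rightarrow> point \<Rightarrow> point" where
  "xorp n x y = tab n (\<lambda>j. x ! j \<noteq> y ! j)"

definition andp :: "nat \<Rightarrow> point \<Rightarrow> point \<Rightarrow> point" where
  "andp n x y = tab n (\<lambda>j. x ! j \<and> y ! j)"

lemma tab_in_cube [simp]: "tab n \<phi> \<in> cube n"
  by (simp add: cube_def)

lemma xorp_in_cube [simp]: "xorp n x y \<in> cube n"
  by (simp add: xorp_def)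

lemma andp_in_cube [simp]: "andp n x y \<in> cube n"
  by (simp add: andp_def)

lemma cube_eqI: "x \<in> cube n \<Longrightarrow> y \<in> cube n \<Longrightarrow> (\<And>j. j < n \<Longrightarrow> x ! j = y ! j) \<Longrightarrow> x = y"
  by (auto simp: cube_def intro: nth_equalityI)

lemma nth_xorp [simp]: "j < n \<Longrightarrow> xorp n x y ! j \<longleftrightarrow> x ! j \<noteq> y ! j"
  by (simp add: xorp_def)

lemma nth_andp [simp]: "j < n \<Longrightarrow> andp n x y ! j \<longleftrightarrow> x ! j \<and> y ! j"
  by (simp add: andp_def)

lemma xorp_assoc: "xorp n (xorp n x y) z = xorp n x (xorp n y z)"
  by (rule cube_eqI[where n = n]) auto

lemma xorp_commute: "xorp n x y = xorp n y x"
  by (rule cube_eqI[where n = n]) auto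

lemma xorp_cancel [simp]: "x \<in> cube n \<Longrightarrow> xorp n y (xorp n y x) = x"
  by (rule cube_eqI[where n = n]) auto

lemma cube_eq_lists: "cube n = {xs. set xs \<subseteq> UNIV \<and> length xs = n}"
  by (auto simp: cube_def)

lemma finite_cube [simp]: "finite (cube n)"
  unfolding cube_eq_lists by (rule finite_lists_length_eq) simp

lemma card_cube: "card (cube n) = 2 ^ n"
  unfolding cube_eq_lists by (subst card_lists_length_eq) auto

lemma cube_nonempty [simp]: "cube n \<noteq> {}"
  using tab_in_cube by blast

definition avg :: "nat \<Rightarrow> (point \<Rightarrow> real) \<Rightarrow> real" where
  "avg n \<phi> = (\<Sum>x\<in>cube n. \<phi> x) / 2 ^ n"

lemma expectation_cube: "measure_pmf.expectation (pmf_of_set (cube n)) \<phi> = avg n \<phi>"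
  by (subst integral_pmf_of_set) (auto simp: avg_def card_cube)

lemma avg_mono: "(\<And>x. x \<in> cube n \<Longrightarrow> \<phi> x \<le> \<psi> x) \<Longrightarrow> avg n \<phi> \<le> avg n \<psi>"
  unfolding avg_def by (intro divide_right_mono sum_mono) auto

lemma avg_cong: "(\<And>x. x \<in> cube n \<Longrightarrow> \<phi> x = \<psi> x) \<Longrightarrow> avg n \<phi> = avg n \<psi>"
  unfolding avg_def by simp

lemma avg_add: "avg n (\<lambda>x. \<phi> x + \<psi> x) = avg n \<phi> + avg n \<psi>"
  by (simp add: avg_def sum.distrib add_divide_distrib)

lemma avg_const [simp]: "avg n (\<lambda>x. c) = c"
  by (simp add: avg_def card_cube)

lemma avg_swap: "avg n (\<lambda>x. avg n (\<lambda>y. \<phi> x y)) = avg n (\<lambda>y. avg n (\<lambda>x. \<phi> x y))"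
  unfolding avg_def sum_divide_distrib by (rule sum.swap)

text \<open>Adding a fixed point is an involution of the cube. The changes of variables in the
  linearity argument below come down to this.\<close>

lemma avg_shift:
  assumes "a \<in> cube n"
  shows "avg n (\<lambda>x. \<phi> (xorp n a x)) = avg n \<phi>"
proof -
  have "bij_betw (xorp n a) (cube n) (cube n)"
    by (rule bij_betwI[where g = "xorp n a"]) auto
  then show ?thesis
    unfolding avg_def by (simp add: sum.reindex_bij_betw)
qed

lemma avg_exists:
  assumes "avg n \<phi> < c"
  obtains x where "x \<in> cube n" "\<phi> x < c"
proof (rule ccontr)
  assume "\<not> thesis"
  then have "c \<le> \<phi> x" if "x \<in> cube n" for x
    using that \<open>\<And>x. x \<in> cube n \<Longrightarrow> \<phi> x < c \<Longrightarrow> thesis\<close> not_le by blast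
  then have "avg n (\<lambda>x. c) \<le> avg n \<phi>" by (intro avg_mono)
  then show False using assms by simp
qed

subsection \<open>Testing dictators\<close>

text \<open>For a literal \<open>g\<close> of the variable \<open>\<tau>\<close>, \<open>delta n g w u\<close> is \<open>u\<^sub>\<tau>\<close> whatever \<open>w\<close> is.\<close>

definition delta :: "nat \<Rightarrow> bool_fun \<Rightarrow> point \<Rightarrow> point \<Rightarrow> bool" where
  "delta n g w u \<longleftrightarrow> g (xorp n w u) \<noteq> g w"

text \<open>Dictators are exactly the unital ring homomorphisms from \<open>GF(2)^n\<close> to
  \<open>GF(2)\<close>. The conjuncts test that differences do not depend on the base point (which
  yields additivity), multiplicativity, and the value at the unit, which excludes the zero
  map.\<close>

definition dictator_check :: "nat \<Rightarrow> bool_fun \<Rightarrow> point \<Rightarrow> point \<Rightarrow> point \<Rightarrow> point \<Rightarrow> bool" where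
  "dictator_check n g u v w w' \<longleftrightarrow>
     delta n g w u = delta n g w' u \<and>
     delta n g w (andp n u v) = (delta n g w u \<and> delta n g w v) \<and>
     delta n g w (tab n (\<lambda>_. True))"

text \<open>The all-ones point is the sum of the unit vectors, so additivity puts some
  \<open>e \<tau>\<close> outside the kernel. Multiplying by it does not change the value of
  \<open>G\<close>, and the product of \<open>u\<close> with \<open>e \<tau>\<close> is either
  \<open>e \<tau>\<close> or zero.\<close>

lemma ring_hom_dictator:
  assumes xor: "\<And>u v. u \<in> cube n \<Longrightarrow> v \<in> cube n \<Longrightarrow> G (xorp n u v) \<longleftrightarrow> G u \<noteq> G v"
    and mult: "\<And>u v. u \<in> cube n \<Longrightarrow> v \<in> cube n \<Longrightarrow> G (andp n u v) \<longleftrightarrow> G u \<and> G v"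
    and one: "G (tab n (\<lambda>_. True))"
  obtains \<tau> where "\<tau> < n" "\<And>u. u \<in> cube n \<Longrightarrow> G u \<longleftrightarrow> u ! \<tau>"
proof -
  define z where "z = tab n (\<lambda>_. False)"
  define e where "e \<tau> = tab n (\<lambda>j. j = \<tau>)" for \<tau>
  have "xorp n z z = z" unfolding z_def by (rule cube_eqI[where n = n]) auto
  then have z: "\<not> G z" using xor[of z z] by (auto simp: z_def)
  have "\<exists>\<tau><n. G (e \<tau>)"
  proof (rule ccontr)
    assume no: "\<not> (\<exists>\<tau><n. G (e \<tau>))"
    \<comment> \<open>If all unit vectors were in the kernel, so would be every prefix of ones, up
      to the unit itself.\<close>
    have "k \<le> n \<Longrightarrow> \<not> G (tab n (\<lambda>j. j < k))" for k
    proof (induction k)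
      case 0
      then show ?case using z by (simp add: z_def)
    next
      case (Suc k)
      have "tab n (\<lambda>j. j < Suc k) = xorp n (tab n (\<lambda>j. j < k)) (e k)"
        unfolding e_def by (rule cube_eqI[where n = n]) auto
      then show ?case using Suc no by (auto simp: xor e_def)
    qed
    from this[of n] have "\<not> G (tab n (\<lambda>j. j < n))" by simp
    moreover have "tab n (\<lambda>j. j < n) = tab n (\<lambda>_. True)" by simp
    ultimately show False using one by simp
  qed
  then obtain \<tau> where \<tau>: "\<tau> < n" "G (e \<tau>)" by blast
  have "G u \<longleftrightarrow> u ! \<tau>" if "u \<in> cube n" for u
  proof -
    have "G u \<longleftrightarrow> G (andp n u (e \<tau>))" using that \<tau> by (simp add: mult e_def)
    also have "andp n u (e \<tau>) = (if u ! \<tau> then e \<tau> else z)"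
      unfolding e_def z_def by (rule cube_eqI[where n = n]) auto
    finally show ?thesis using \<tau> z by simp
  qed
  with \<tau> that show ?thesis by blast
qed

lemma of_bool_sum3_less_1:
  "of_bool P + of_bool Q + of_bool R < (1 :: real) \<Longrightarrow> \<not> P \<and> \<not> Q \<and> \<not> R"
  by (cases P; cases Q; cases R) auto

text \<open>The constant is dictated by multiplicativity: the tested defect \<open>1 / 30\<close>
  plus an error of \<open>2 / 30\<close> for each of three self-corrected values gives
  \<open>7 / 30\<close>, below the quarter that a nonzero bilinear form over \<open>GF(2)\<close>
  must reach. The conclusion holds for every \<open>u\<close>, not just for most, as decoding
  samples of an arbitrary distribution requires.\<close>

lemma dictator_test_sound:
  assumes small: "avg n (\<lambda>u. avg n (\<lambda>v. avg n (\<lambda>w. avg n (\<lambda>w'.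
      of_bool (\<not> dictator_check n g u v w w'))))) < 1 / 30"
  obtains \<tau> where "\<tau> < n"
    "\<And>u. u \<in> cube n \<Longrightarrow> avg n (\<lambda>w. of_bool (delta n g w u \<noteq> u ! \<tau>)) \<le> 1 / 3"
proof -
  let ?D = "delta n g"
  let ?b = "of_bool :: bool \<Rightarrow> real"
  define \<delta> where "\<delta> = avg n (\<lambda>u. avg n (\<lambda>w. avg n (\<lambda>w'. ?b (?D w u \<noteq> ?D w' u))))"
  have \<delta>: "\<delta> < 1 / 30"
  proof -
    have "\<delta> = avg n (\<lambda>u. avg n (\<lambda>v. avg n (\<lambda>w. avg n (\<lambda>w'. ?b (?D w u \<noteq> ?D w' u)))))"
      by (simp add: \<delta>_def)
    also have "\<dots> \<le> avg n (\<lambda>u. avg n (\<lambda>v. avg n (\<lambda>w. avg n (\<lambda>w'. ?b (\<not> dictator_check n g u v w w')))))"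
      by (intro avg_mono) (auto simp: dictator_check_def)
    finally show ?thesis using small by simp
  qed
  have fixed: "avg n (\<lambda>w'. avg n (\<lambda>w. ?b (?D w u \<noteq> ?D w' u))) \<le> 2 * \<delta>" if u: "u \<in> cube n" for u
  proof -
    (* The pairs at w + u, w' + u and at w, w' are both compared with a fresh pair at distance w + w'. *)
    let ?E = "\<lambda>w w' y. ?b (?D w (xorp n w w') \<noteq> ?D y (xorp n w w'))"
    have E: "avg n (\<lambda>w. avg n (\<lambda>w'. avg n (?E w w'))) = \<delta>"
    proof -
      have "avg n (\<lambda>w. avg n (\<lambda>w'. avg n (?E w w'))) =
          avg n (\<lambda>w. avg n (\<lambda>w'. avg n (\<lambda>y. ?b (?D w w' \<noteq> ?D y w'))))"
        by (intro avg_cong avg_shift) simp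
      also have "\<dots> = \<delta>" unfolding \<delta>_def by (rule avg_swap)
      finally show ?thesis .
    qed
    have E': "avg n (\<lambda>w. avg n (\<lambda>w'. avg n (?E (xorp n u w) (xorp n u w')))) = \<delta>"
    proof -
      have "avg n (\<lambda>w. avg n (\<lambda>w'. avg n (?E (xorp n u w) (xorp n u w')))) =
          avg n (\<lambda>w. avg n (\<lambda>w'. avg n (?E (xorp n u w) w')))"
        by (intro avg_cong avg_shift[OF u])
      also have "\<dots> = avg n (\<lambda>w. avg n (\<lambda>w'. avg n (?E w w')))"
        by (rule avg_shift[OF u])
      finally show ?thesis using E by simp
    qed
    have "?b (?D w u \<noteq> ?D w' u) \<le> ?E (xorp n u w) (xorp n u w') y + ?E w w' y"
      if "w \<in> cube n" "w' \<in> cube n" "y \<in> cube n" for w w' y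
    proof -
      have eq: "xorp n (xorp n u w) (xorp n u w') = xorp n w w'"
        by (rule cube_eqI[where n = n]) auto
      show ?thesis
        using that u unfolding eq
        by (auto simp: delta_def xorp_assoc) (auto simp: xorp_commute)
    qed
    then have "avg n (\<lambda>w. avg n (\<lambda>w'. avg n (\<lambda>y. ?b (?D w u \<noteq> ?D w' u)))) \<le>
        avg n (\<lambda>w. avg n (\<lambda>w'. avg n (\<lambda>y. ?E (xorp n u w) (xorp n u w') y + ?E w w' y)))"
      by (intro avg_mono)
    also have "\<dots> = \<delta> + \<delta>"
      unfolding avg_add E E' ..
    finally show ?thesis by (subst avg_swap) simp
  qed
  \<comment> \<open>\<open>G u\<close> is the value seen from some base point \<open>w'\<close> that
    does no worse than average; this takes the place of a majority vote.\<close>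
  have "\<forall>u\<in>cube n. \<exists>b. avg n (\<lambda>w. ?b (?D w u \<noteq> b)) < 2 / 30"
  proof
    fix u assume "u \<in> cube n"
    then have "avg n (\<lambda>w'. avg n (\<lambda>w. ?b (?D w u \<noteq> ?D w' u))) < 2 / 30"
      using fixed \<delta> by fastforce
    then show "\<exists>b. avg n (\<lambda>w. ?b (?D w u \<noteq> b)) < 2 / 30"
      by (rule avg_exists) blast
  qed
  then obtain G where G: "\<And>u. u \<in> cube n \<Longrightarrow> avg n (\<lambda>w. ?b (?D w u \<noteq> G u)) < 2 / 30"
    by (metis (no_types))
  have xor: "G (xorp n u v) \<longleftrightarrow> G u \<noteq> G v" if uv: "u \<in> cube n" "v \<in> cube n" for u v
  proof -
    \<comment> \<open>The three errors add up to less than 1, so all three values are right at a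
      common \<open>w\<close>. There additivity is the passage from \<open>w\<close> to
      \<open>w + v\<close> and on to \<open>w + v + u\<close>.\<close>
    have "avg n (\<lambda>w. ?b (?D (xorp n v w) u \<noteq> G u)) = avg n (\<lambda>w. ?b (?D w u \<noteq> G u))"
      by (rule avg_shift[OF uv(2)])
    then have "avg n (\<lambda>w. ?b (?D w (xorp n u v) \<noteq> G (xorp n u v)) + ?b (?D (xorp n v w) u \<noteq> G u)
        + ?b (?D w v \<noteq> G v)) < 1"
      unfolding avg_add using G[of u] G[of v] G[of "xorp n u v"] uv by simp
    then obtain w where w: "w \<in> cube n" "?b (?D w (xorp n u v) \<noteq> G (xorp n u v))
        + ?b (?D (xorp n v w) u \<noteq> G u) + ?b (?D w v \<noteq> G v) < 1"
      by (rule avg_exists)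
    have "xorp n w (xorp n u v) = xorp n (xorp n v w) u" "xorp n v w = xorp n w v"
      by (rule cube_eqI[where n = n]; auto)+
    moreover have "?D w (xorp n u v) = G (xorp n u v)" "?D (xorp n v w) u = G u" "?D w v = G v"
      using w(2) by (auto dest!: of_bool_sum3_less_1)
    ultimately show ?thesis by (auto simp: delta_def)
  qed
  have one: "G (tab n (\<lambda>_. True))"
  proof -
    let ?o = "tab n (\<lambda>_. True)"
    have "avg n (\<lambda>w. ?b (\<not> ?D w ?o))
        = avg n (\<lambda>u. avg n (\<lambda>v. avg n (\<lambda>w. avg n (\<lambda>w'. ?b (\<not> ?D w ?o)))))" by simp
    also have "\<dots> \<le> avg n (\<lambda>u. avg n (\<lambda>v. avg n (\<lambda>w. avg n (\<lambda>w'. ?b (\<not> dictator_check n g u v w w')))))"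
      by (intro avg_mono) (auto simp: dictator_check_def)
    finally have "avg n (\<lambda>w. ?b (\<not> ?D w ?o) + ?b (?D w ?o \<noteq> G ?o)) < 1"
      unfolding avg_add using small G[of ?o] by simp
    \<comment> \<open>The summand \<open>?b False\<close> brings the sum to the three terms of
      \<open>of_bool_sum3_less_1\<close>.\<close>
    then obtain w where "?b (\<not> ?D w ?o) + ?b (?D w ?o \<noteq> G ?o) + ?b False < 1"
      by (rule avg_exists) simp
    from of_bool_sum3_less_1[OF this] show ?thesis by blast
  qed
  have mult: "G (andp n u v) \<longleftrightarrow> G u \<and> G v" if uv: "u \<in> cube n" "v \<in> cube n" for u v
  proof (rule ccontr)
    define B where "B u v \<longleftrightarrow> G (andp n u v) \<noteq> (G u \<and> G v)" for u v
    assume "\<not> (G (andp n u v) \<longleftrightarrow> G u \<and> G v)"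
    then have "B u v" by (auto simp: B_def)
    (* B is a bilinear form over GF(2); if it is nonzero at (u, v), its values at (x, y), (x + u, y),
       (x, y + v), (x + u, y + v) have odd sum, so B is nonzero on a quarter of all pairs. *)
    have l: "B (xorp n u1 u2) v \<longleftrightarrow> B u1 v \<noteq> B u2 v" if "u1 \<in> cube n" "u2 \<in> cube n" for u1 u2 v
    proof -
      have "andp n (xorp n u1 u2) v = xorp n (andp n u1 v) (andp n u2 v)"
        by (rule cube_eqI[where n = n]) auto
      then show ?thesis using that by (auto simp: B_def xor)
    qed
    have r: "B u (xorp n v1 v2) \<longleftrightarrow> B u v1 \<noteq> B u v2" if "v1 \<in> cube n" "v2 \<in> cube n" for u v1 v2
    proof -
      have "andp n u (xorp n v1 v2) = xorp n (andp n u v1) (andp n u v2)"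
        by (rule cube_eqI[where n = n]) auto
      then show ?thesis using that by (auto simp: B_def xor)
    qed
    let ?\<beta> = "avg n (\<lambda>x. avg n (\<lambda>y. ?b (B x y)))"
    have s1: "avg n (\<lambda>x. avg n (\<lambda>y. ?b (B (xorp n u x) y))) = ?\<beta>"
      by (rule avg_shift[OF uv(1)])
    have s2: "avg n (\<lambda>x. avg n (\<lambda>y. ?b (B x (xorp n v y)))) = ?\<beta>"
      by (intro avg_cong avg_shift[OF uv(2)])
    have "avg n (\<lambda>x. avg n (\<lambda>y. ?b (B (xorp n u x) (xorp n v y)))) =
        avg n (\<lambda>x. avg n (\<lambda>y. ?b (B (xorp n u x) y)))"
      by (intro avg_cong avg_shift[OF uv(2)])
    then have s3: "avg n (\<lambda>x. avg n (\<lambda>y. ?b (B (xorp n u x) (xorp n v y)))) = ?\<beta>"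
      using s1 by simp
    have "1 = avg n (\<lambda>x. avg n (\<lambda>y. 1))" by simp
    also have "\<dots> \<le> avg n (\<lambda>x. avg n (\<lambda>y. ?b (B x y) + ?b (B (xorp n u x) y)
        + ?b (B x (xorp n v y)) + ?b (B (xorp n u x) (xorp n v y))))"
      using \<open>B u v\<close> uv by (intro avg_mono) (auto simp: l r)
    also have "\<dots> = 4 * ?\<beta>"
      unfolding avg_add s1 s2 s3 by simp
    finally have "?\<beta> \<ge> 1 / 4" by simp
    define M where "M = avg n (\<lambda>u. avg n (\<lambda>v. avg n (\<lambda>w. ?b (?D w (andp n u v) \<noteq> (?D w u \<and> ?D w v)))))"
    have M: "M < 1 / 30"
    proof -
      have "M = avg n (\<lambda>u. avg n (\<lambda>v. avg n (\<lambda>w. avg n (\<lambda>w'. ?b (?D w (andp n u v) \<noteq> (?D w u \<and> ?D w v))))))"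
        by (simp add: M_def)
      also have "\<dots> \<le> avg n (\<lambda>u. avg n (\<lambda>v. avg n (\<lambda>w. avg n (\<lambda>w'. ?b (\<not> dictator_check n g u v w w')))))"
        by (intro avg_mono) (auto simp: dictator_check_def)
      finally show ?thesis using small by simp
    qed
    \<comment> \<open>For a fixed pair, a defect of \<open>G\<close> is visible in the test at
      \<open>w\<close> unless one of three self-corrected values is wrong at
      \<open>w\<close>.\<close>
    have "?\<beta> \<le> avg n (\<lambda>x. avg n (\<lambda>y. avg n (\<lambda>w. ?b (?D w (andp n x y) \<noteq> (?D w x \<and> ?D w y))) + 6 / 30))"
    proof (intro avg_mono)
      fix x y assume xy: "x \<in> cube n" "y \<in> cube n"
      have "?b (B x y) = avg n (\<lambda>w. ?b (B x y))" by simp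
      also have "\<dots> \<le> avg n (\<lambda>w. ?b (?D w (andp n x y) \<noteq> (?D w x \<and> ?D w y))
        + (?b (?D w (andp n x y) \<noteq> G (andp n x y)) + ?b (?D w x \<noteq> G x) + ?b (?D w y \<noteq> G y)))"
        by (intro avg_mono) (auto simp: B_def)
      also have "\<dots> \<le> avg n (\<lambda>w. ?b (?D w (andp n x y) \<noteq> (?D w x \<and> ?D w y))) + 6 / 30"
        unfolding avg_add using G[of x] G[of y] G[of "andp n x y"] xy by simp
      finally show "?b (B x y) \<le> avg n (\<lambda>w. ?b (?D w (andp n x y) \<noteq> (?D w x \<and> ?D w y))) + 6 / 30" .
    qed
    also have "\<dots> = M + 6 / 30"
      unfolding avg_add M_def by simp
    finally show False using M \<open>?\<beta> \<ge> 1 / 4\<close> by simp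
  qed
  obtain \<tau> where \<tau>: "\<tau> < n" "\<And>u. u \<in> cube n \<Longrightarrow> G u \<longleftrightarrow> u ! \<tau>"
    using ring_hom_dictator[of n G, OF xor mult one] by blast
  have "avg n (\<lambda>w. ?b (?D w u \<noteq> u ! \<tau>)) \<le> 1 / 3" if "u \<in> cube n" for u
    using G[OF that] \<tau>(2)[OF that] by simp
  then show ?thesis by (rule that[OF \<tau>(1)])
qed

subsection \<open>Concise classes\<close>

text \<open>Pullback along a partial map from \<open>n\<close> variables to those of
  \<open>z\<close>, with unmapped variables fixed to 0. It describes both \<open>F\<close>, where
  the variables of a block share one bit, and decoding, where each bit is a coordinate of the
  sample.\<close>

definition subst :: "nat \<Rightarrow> (nat \<Rightarrow> nat option) \<Rightarrow> point \<Rightarrow> point" where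
  "subst n \<sigma> z = tab n (\<lambda>j. case \<sigma> j of None \<Rightarrow> False | Some l \<Rightarrow> z ! l)"

lemma subst_in_cube [simp]: "subst n \<sigma> z \<in> cube n"
  by (simp add: subst_def)

lemma nth_subst: "j < n \<Longrightarrow> subst n \<sigma> z ! j = (case \<sigma> j of None \<Rightarrow> False | Some l \<Rightarrow> z ! l)"
  by (simp add: subst_def)

text \<open>All that the tester uses about a class: \<open>junta\<close> limits the blocks that can
  be found, \<open>subst_closed\<close> passes between \<open>n\<close> and \<open>s\<close>
  variables, \<open>count\<close> feeds the union bound, and \<open>cong\<close> serves the case
  \<open>n = 0\<close>. The premise \<open>0 < m\<close> is due to exact sizes: padding a tree, or
  labelling a node whose variable was fixed, takes some variable. The exponent \<open>6 * s\<close>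
  leaves room for the \<open>3 + 3 * s\<close> of branching programs.\<close>

locale concise_class =
  fixes C :: "nat \<Rightarrow> nat \<Rightarrow> bool_fun set"
  assumes cong: "f \<in> C n s \<Longrightarrow> (\<And>x. x \<in> cube n \<Longrightarrow> f x = g x) \<Longrightarrow> g \<in> C n s"
    and junta: "f \<in> C n s \<Longrightarrow> \<exists>V\<subseteq>{..<n}. card V \<le> s \<and>
      (\<forall>x\<in>cube n. \<forall>y\<in>cube n. (\<forall>j\<in>V. x ! j = y ! j) \<longrightarrow> f x = f y)"
    and subst_closed: "f \<in> C n s \<Longrightarrow> 0 < m \<Longrightarrow> (\<And>j l. j < n \<Longrightarrow> \<sigma> j = Some l \<Longrightarrow> l < m) \<Longrightarrow>
      (\<lambda>z. f (subst n \<sigma> z)) \<in> C m s"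
    and count: "1 \<le> s \<Longrightarrow> card ((\<lambda>f. restrict f (cube s)) ` C s s) \<le> (s + 2) ^ (6 * s)"

section \<open>Decision trees form a concise class\<close>

primrec dt_subst :: "(nat \<Rightarrow> nat option) \<Rightarrow> dtree \<Rightarrow> dtree" where
  "dt_subst \<sigma> (Leaf b) = Leaf b"
| "dt_subst \<sigma> (Node j l r) =
    (case \<sigma> j of None \<Rightarrow> dt_subst \<sigma> l | Some i \<Rightarrow> Node i (dt_subst \<sigma> l) (dt_subst \<sigma> r))"

lemma dt_eval_subst:
  "dt_vars t \<subseteq> {..<n} \<Longrightarrow> dt_eval (dt_subst \<sigma> t) z = dt_eval t (subst n \<sigma> z)"
  by (induction t) (auto simp: nth_subst split: option.splits)

lemma dt_size_subst: "dt_size (dt_subst \<sigma> t) \<le> dt_size t"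
  by (induction t) (auto split: option.splits)

lemma dt_vars_subst:
  "dt_vars t \<subseteq> {..<n} \<Longrightarrow> (\<And>j l. j < n \<Longrightarrow> \<sigma> j = Some l \<Longrightarrow> l < m) \<Longrightarrow> dt_vars (dt_subst \<sigma> t) \<subseteq> {..<m}"
  by (induction t) (auto split: option.splits)

text \<open>Fixing variables shrinks a tree, but membership asks for exact size. Splitting a leaf on
  variable 0 into two copies of itself adds one leaf and changes no value.\<close>

lemma dt_pad:
  assumes "dt_vars t \<subseteq> {..<m}" "0 < m" "dt_size t \<le> s"
  shows "\<exists>t'. dt_vars t' \<subseteq> {..<m} \<and> dt_size t' = s \<and> dt_eval t' = dt_eval t"
  using assms(3)
proof (induction s rule: dec_induct)
  case base
  then show ?case using assms(1) by blast
next
  case (step s)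
  then obtain t' where t': "dt_vars t' \<subseteq> {..<m}" "dt_size t' = s" "dt_eval t' = dt_eval t" by blast
  have "\<exists>t''. dt_vars t'' \<subseteq> {..<m} \<and> dt_size t'' = Suc (dt_size t') \<and> dt_eval t'' = dt_eval t'"
    using t'(1)
  proof (induction t')
    case (Leaf b)
    show ?case by (rule exI[of _ "Node 0 (Leaf b) (Leaf b)"]) (use assms(2) in auto)
  next
    case (Node i l r)
    then obtain l' where "dt_vars l' \<subseteq> {..<m} \<and> dt_size l' = Suc (dt_size l) \<and> dt_eval l' = dt_eval l"
      by auto
    then show ?case using Node.prems by (intro exI[of _ "Node i l' r"]) auto
  qed
  then show ?case using t' by simp
qed

lemma finite_dt_vars [simp]: "finite (dt_vars t)"
  by (induction t) auto

lemma card_dt_vars: "card (dt_vars t) < dt_size t"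
proof (induction t)
  case (Node i l r)
  have "card (dt_vars (Node i l r)) \<le> Suc (card (dt_vars l) + card (dt_vars r))"
    by simp (metis card_Un_le card_insert_le_m1 card_insert_if finite_UnI finite_dt_vars le_SucI Suc_le_mono)
  then show ?case using Node by simp
qed simp

lemma dt_eval_cong: "(\<And>j. j \<in> dt_vars t \<Longrightarrow> x ! j = y ! j) \<Longrightarrow> dt_eval t x = dt_eval t y"
  by (induction t) auto

text \<open>Postfix code for a stack machine. The right subtree is written first, so that the left
  one ends on top of the stack.\<close>

primrec dt_encode :: "dtree \<Rightarrow> (nat + bool) list" where
  "dt_encode (Leaf b) = [Inr b]"
| "dt_encode (Node i l r) = dt_encode r @ dt_encode l @ [Inl i]"

text \<open>The last clause makes decoding total; on the code of a tree, an \<open>Inl\<close>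
  always finds two trees on the stack.\<close>

fun dt_stack :: "nat + bool \<Rightarrow> dtree list \<Rightarrow> dtree list" where
  "dt_stack (Inr b) ts = Leaf b # ts"
| "dt_stack (Inl i) (l # r # ts) = Node i l r # ts"
| "dt_stack (Inl i) ts = ts"

lemma fold_dt_stack: "fold dt_stack (dt_encode t) ts = t # ts"
  by (induction t arbitrary: ts) auto

lemma length_dt_encode: "Suc (length (dt_encode t)) = 2 * dt_size t"
  by (induction t) auto

lemma set_dt_encode: "dt_vars t \<subseteq> {..<m} \<Longrightarrow> set (dt_encode t) \<subseteq> Inl ` {..<m} \<union> range Inr"
  by (induction t) auto

lemma concise_decision_tree: "concise_class decision_tree_class"
proof
  fix f g n s
  assume "f \<in> decision_tree_class n s" and fg: "\<And>x. x \<in> cube n \<Longrightarrow> f x = g x"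
  then obtain t where "dt_vars t \<subseteq> {..<n}" "dt_size t = s" "\<forall>x\<in>cube n. f x = dt_eval t x"
    unfolding decision_tree_class_def by blast
  with fg show "g \<in> decision_tree_class n s"
    unfolding decision_tree_class_def by (intro CollectI exI[of _ t]) simp
next
  fix f n s
  assume "f \<in> decision_tree_class n s"
  then obtain t where t: "dt_vars t \<subseteq> {..<n}" "dt_size t = s" "\<forall>x\<in>cube n. f x = dt_eval t x"
    by (auto simp: decision_tree_class_def)
  have "f x = f y" if "x \<in> cube n" "y \<in> cube n" "\<forall>j\<in>dt_vars t. x ! j = y ! j" for x y
    using dt_eval_cong[of t x y] t(3) that by simp
  moreover have "card (dt_vars t) \<le> s"
    using card_dt_vars[of t] t(2) by simp
  ultimately show "\<exists>V\<subseteq>{..<n}. card V \<le> s \<and>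
      (\<forall>x\<in>cube n. \<forall>y\<in>cube n. (\<forall>j\<in>V. x ! j = y ! j) \<longrightarrow> f x = f y)"
    using t(1) by blast
next
  fix f n s m and \<sigma> :: "nat \<Rightarrow> nat option"
  assume f: "f \<in> decision_tree_class n s" and m: "0 < m"
    and \<sigma>: "\<And>j l. j < n \<Longrightarrow> \<sigma> j = Some l \<Longrightarrow> l < m"
  from f obtain t where t: "dt_vars t \<subseteq> {..<n}" "dt_size t = s" "\<forall>x\<in>cube n. f x = dt_eval t x"
    by (auto simp: decision_tree_class_def)
  have "dt_vars (dt_subst \<sigma> t) \<subseteq> {..<m}"
    using dt_vars_subst t(1) \<sigma> by blast
  then obtain t' where "dt_vars t' \<subseteq> {..<m}" "dt_size t' = s" "dt_eval t' = dt_eval (dt_subst \<sigma> t)"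
    using dt_pad[OF _ m] dt_size_subst[of \<sigma> t] t(2) by blast
  then show "(\<lambda>z. f (subst n \<sigma> z)) \<in> decision_tree_class m s"
    unfolding decision_tree_class_def using t
    by (intro CollectI exI[of _ t']) (simp add: dt_eval_subst)
next
  fix s :: nat
  assume s: "1 \<le> s"
  let ?A = "Inl ` {..<s} \<union> range Inr :: (nat + bool) set"
  let ?L = "{l. set l \<subseteq> ?A \<and> length l = 2 * s - 1}"
  let ?dec = "\<lambda>l. restrict (dt_eval (hd (fold dt_stack l []))) (cube s)"
  have A: "finite ?A" by simp
  have "card ?A = card (Inl ` {..<s} :: (nat + bool) set) + card (range Inr :: (nat + bool) set)"
    by (intro card_Un_disjoint) auto
  also have "\<dots> = s + 2"
    by (simp add: card_image)
  finally have card_A: "card ?A = s + 2" .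
  \<comment> \<open>Counting all strings over the \<open>s\<close> variables and two leaf labels is
    enough: malformed strings only enlarge the bound.\<close>
  have "(\<lambda>f. restrict f (cube s)) ` decision_tree_class s s \<subseteq> ?dec ` ?L"
  proof
    fix h assume "h \<in> (\<lambda>f. restrict f (cube s)) ` decision_tree_class s s"
    then obtain f t where t: "h = restrict f (cube s)" "dt_vars t \<subseteq> {..<s}" "dt_size t = s"
        "\<forall>x\<in>cube s. f x = dt_eval t x"
      by (auto simp: decision_tree_class_def)
    then have "h = ?dec (dt_encode t)" by (auto simp: fold_dt_stack restrict_def)
    moreover have "dt_encode t \<in> ?L"
      using set_dt_encode[OF t(2)] length_dt_encode[of t] t(3) by auto
    ultimately show "h \<in> ?dec ` ?L" by blast
  qed
  then have "card ((\<lambda>f. restrict f (cube s)) ` decision_tree_class s s) \<le> card ?L"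
    using A by (intro surj_card_le finite_lists_length_eq)
  also have "\<dots> = (s + 2) ^ (2 * s - 1)"
    using card_lists_length_eq[OF A] card_A by simp
  also have "\<dots> \<le> (s + 2) ^ (6 * s)"
    by (rule power_increasing) auto
  finally show "card ((\<lambda>f. restrict f (cube s)) ` decision_tree_class s s) \<le> (s + 2) ^ (6 * s)" .
qed

section \<open>Branching programs form a concise class\<close>

lemma single_valued_sinks_unique:
  assumes "single_valued R" "(a, b) \<in> R\<^sup>*" "(a, c) \<in> R\<^sup>*" "b \<notin> Domain R" "c \<notin> Domain R"
  shows "b = c"
proof -
  have "(b, c) \<in> R\<^sup>* \<or> (c, b) \<in> R\<^sup>*"
    using assms(1-3) by (rule single_valued_confluent)
  then show ?thesis using assms(4,5) by (metis DomainI converse_rtranclE)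
qed

lemma bp_outputs_unique:
  assumes "branching_program n P" "bp_outputs P x b" "bp_outputs P x c"
  shows "b = c"
proof -
  have "single_valued (bp_step P x)"
    by (auto simp: bp_step_def single_valued_def)
  then have "bp_sink P b = bp_sink P c"
    using assms(2,3) unfolding bp_outputs_def
    by (rule single_valued_sinks_unique) (auto simp: bp_step_def bp_internal_def)
  then show ?thesis
    using assms(1) unfolding branching_program_def by (metis (full_types))
qed

text \<open>A node whose variable is fixed to 0 keeps its place; both its edges go to the old 0-successor.\<close>

definition bp_subst :: "(nat \<Rightarrow> nat option) \<Rightarrow> bprog \<Rightarrow> bprog" where
  "bp_subst \<sigma> P = P\<lparr>
     bp_var := \<lambda>v. case \<sigma> (bp_var P v) of None \<Rightarrow> 0 | Some l \<Rightarrow> l,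
     bp_succ := \<lambda>v b. bp_succ P v (\<sigma> (bp_var P v) \<noteq> None \<and> b)\<rparr>"

lemma branching_program_bp_subst:
  assumes "branching_program n P" "0 < m" "\<And>j l. j < n \<Longrightarrow> \<sigma> j = Some l \<Longrightarrow> l < m"
  shows "branching_program m (bp_subst \<sigma> P)"
proof -
  have int: "bp_internal (bp_subst \<sigma> P) = bp_internal P"
    by (simp add: bp_internal_def bp_subst_def)
  \<comment> \<open>Redirecting an edge to the other successor of the same node creates no new pair,
    so acyclicity is inherited.\<close>
  have "bp_edges (bp_subst \<sigma> P) \<subseteq> bp_edges P"
    unfolding bp_edges_def int by (auto simp: bp_subst_def)
  then have "acyclic (bp_edges (bp_subst \<sigma> P))"
    using assms(1) acyclic_subset unfolding branching_program_def by blast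
  then show ?thesis
    using assms unfolding branching_program_def int by (auto simp: bp_subst_def split: option.splits)
qed

lemma bp_outputs_bp_subst:
  assumes "branching_program n P"
  shows "bp_outputs (bp_subst \<sigma> P) z b \<longleftrightarrow> bp_outputs P (subst n \<sigma> z) b"
proof -
  have int: "bp_internal (bp_subst \<sigma> P) = bp_internal P"
    by (simp add: bp_internal_def bp_subst_def)
  have "bp_succ (bp_subst \<sigma> P) v (z ! bp_var (bp_subst \<sigma> P) v) = bp_succ P v (subst n \<sigma> z ! bp_var P v)"
    if "v \<in> bp_internal P" for v
    using assms that by (auto simp: bp_subst_def nth_subst branching_program_def split: option.splits)
  then have "bp_step (bp_subst \<sigma> P) z = bp_step P (subst n \<sigma> z)"
    unfolding bp_step_def int by force
  then show ?thesis
    by (simp add: bp_outputs_def bp_subst_def)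
qed

definition code_step ::
    "nat \<Rightarrow> nat \<times> nat \<times> nat \<times> (nat \<Rightarrow> nat) \<times> (nat \<times> bool \<Rightarrow> nat) \<Rightarrow> point \<Rightarrow> (nat \<times> nat) set" where
  "code_step s c x = (case c of (r, s0, s1, var, succ) \<Rightarrow>
     {(v, succ (v, x ! var v)) | v. v < s \<and> v \<noteq> s0 \<and> v \<noteq> s1})"

text \<open>Reachability of the 1-sink gives a value to every code, even to one with cycles or equal
  sinks, so the codes can be counted without checking that they are branching programs.\<close>

definition code_eval ::
    "nat \<Rightarrow> nat \<times> nat \<times> nat \<times> (nat \<Rightarrow> nat) \<times> (nat \<times> bool \<Rightarrow> nat) \<Rightarrow> bool_fun" where
  "code_eval s c x = (case c of (r, s0, s1, var, succ) \<Rightarrow> (r, s1) \<in> (code_step s c x)\<^sup>*)"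

text \<open>Numbering the nodes carries computation paths over to the code. Conversely, the code is
  deterministic and its sinks have no successors, so a path to the 0-sink excludes one to the
  1-sink.\<close>

lemma bp_code:
  assumes P: "branching_program s P" "card (bp_nodes P) = s" and out: "\<forall>x\<in>cube s. bp_outputs P x (f x)"
  obtains c where "c \<in> {..<s} \<times> {..<s} \<times> {..<s} \<times> ({..<s} \<rightarrow>\<^sub>E {..<s}) \<times> ({..<s} \<times> UNIV \<rightarrow>\<^sub>E {..<s})"
    "\<And>x. x \<in> cube s \<Longrightarrow> code_eval s c x = f x"
proof -
  have fin: "finite (bp_nodes P)" and root: "bp_root P \<in> bp_nodes P"
    and sink: "\<And>b. bp_sink P b \<in> bp_nodes P" and ne: "bp_sink P False \<noteq> bp_sink P True"
    and int: "\<And>v. v \<in> bp_internal P \<Longrightarrow> bp_var P v < s"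
      "\<And>v b. v \<in> bp_internal P \<Longrightarrow> bp_succ P v b \<in> bp_nodes P"
    using P(1) by (auto simp: branching_program_def)
  obtain e where e: "bij_betw e (bp_nodes P) {..<s}"
    using fin P(2) by (metis finite_lessThan card_lessThan finite_same_card_bij)
  define d where "d = inv_into (bp_nodes P) e"
  have de: "d (e v) = v" if "v \<in> bp_nodes P" for v
    using that e unfolding d_def by (simp add: bij_betw_def inv_into_f_f)
  have e_lt: "e v < s" if "v \<in> bp_nodes P" for v
    using that e by (auto simp: bij_betw_def)
  \<comment> \<open>The entries at sinks are arbitrary; the value \<open>i\<close> keeps them in
    \<open>{..<s}\<close>. At internal nodes the labels are below \<open>s\<close> because here the
    program is over \<open>s\<close> variables.\<close>
  define var where "var = (\<lambda>i\<in>{..<s}. if d i \<in> bp_internal P then bp_var P (d i) else i)"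
  define succ where "succ = (\<lambda>(i, b)\<in>{..<s} \<times> UNIV.
    if d i \<in> bp_internal P then e (bp_succ P (d i) b) else i)"
  define c where "c = (e (bp_root P), e (bp_sink P False), e (bp_sink P True), var, succ)"
  have "c \<in> {..<s} \<times> {..<s} \<times> {..<s} \<times> ({..<s} \<rightarrow>\<^sub>E {..<s}) \<times> ({..<s} \<times> UNIV \<rightarrow>\<^sub>E {..<s})"
  proof -
    have "var \<in> {..<s} \<rightarrow>\<^sub>E {..<s}"
      unfolding var_def by (intro restrict_PiE_iff[THEN iffD2]) (simp add: int)
    moreover have "succ \<in> {..<s} \<times> UNIV \<rightarrow>\<^sub>E {..<s}"
      unfolding succ_def by (intro restrict_PiE_iff[THEN iffD2]) (simp add: int e_lt split: prod.split)
    ultimately show ?thesis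
      unfolding c_def using e_lt[OF root] e_lt[OF sink] by simp
  qed
  moreover have "code_eval s c x = f x" if "x \<in> cube s" for x
  proof -
    have code_edge: "(e v, e w) \<in> code_step s c x" if "(v, w) \<in> bp_step P x" for v w
    proof -
      have v: "v \<in> bp_internal P" "w = bp_succ P v (x ! bp_var P v)"
        using that by (auto simp: bp_step_def)
      then have "v \<in> bp_nodes P" "\<And>b. v \<noteq> bp_sink P b" by (auto simp: bp_internal_def)
      then have ev: "e v < s" using e_lt by simp
      have ne_sink: "e v \<noteq> e (bp_sink P b)" for b
      proof
        assume "e v = e (bp_sink P b)"
        then have "d (e v) = d (e (bp_sink P b))" by simp
        then show False using de \<open>v \<in> bp_nodes P\<close> sink \<open>\<And>b. v \<noteq> bp_sink P b\<close> by simp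
      qed
      have "var (e v) = bp_var P v" "\<And>b. succ (e v, b) = e (bp_succ P v b)"
        using ev de[OF \<open>v \<in> bp_nodes P\<close>] v(1) by (simp_all add: var_def succ_def)
      then have "e w = succ (e v, x ! var (e v))"
        using v(2) by simp
      then show ?thesis
        using ev ne_sink unfolding code_step_def c_def by auto
    qed
    have "(e (bp_root P), e w) \<in> (code_step s c x)\<^sup>*" if "(bp_root P, w) \<in> (bp_step P x)\<^sup>*" for w
      using that
    proof (induction rule: rtrancl_induct)
      case (step v w)
      show ?case by (rule rtrancl_into_rtrancl[OF step.IH code_edge[OF step.hyps(2)]])
    qed simp
    then have reach: "(e (bp_root P), e (bp_sink P (f x))) \<in> (code_step s c x)\<^sup>*"
      using out that by (auto simp: bp_outputs_def)
    have eval: "code_eval s c x \<longleftrightarrow> (e (bp_root P), e (bp_sink P True)) \<in> (code_step s c x)\<^sup>*"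
      unfolding code_eval_def by (simp add: c_def)
    have sv: "single_valued (code_step s c x)"
      unfolding code_step_def c_def single_valued_def by auto
    have dom: "e (bp_sink P b) \<notin> Domain (code_step s c x)" for b
      unfolding code_step_def c_def by (cases b) auto
    have "f x" if "code_eval s c x"
    proof (rule ccontr)
      assume "\<not> f x"
      then have "(e (bp_root P), e (bp_sink P False)) \<in> (code_step s c x)\<^sup>*"
        using reach by simp
      then have "e (bp_sink P False) = e (bp_sink P True)"
        using that dom unfolding eval by (intro single_valued_sinks_unique[OF sv])
      then have "d (e (bp_sink P False)) = d (e (bp_sink P True))" by (rule arg_cong)
      then show False using ne unfolding de[OF sink] by blast
    qed
    moreover have "code_eval s c x" if "f x"
      using reach that unfolding eval by simp
    ultimately show ?thesis by blast
  qed
  ultimately show ?thesis by (rule that)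
qed

lemma concise_branching_program: "concise_class branching_program_class"
proof
  fix f g n s
  assume "f \<in> branching_program_class n s" and fg: "\<And>x. x \<in> cube n \<Longrightarrow> f x = g x"
  then obtain P where "branching_program n P" "card (bp_nodes P) = s" "\<forall>x\<in>cube n. bp_outputs P x (f x)"
    unfolding branching_program_class_def by blast
  with fg show "g \<in> branching_program_class n s"
    unfolding branching_program_class_def by (intro CollectI exI[of _ P]) simp
next
  fix f n s
  assume "f \<in> branching_program_class n s"
  then obtain P where P: "branching_program n P" "card (bp_nodes P) = s" "\<forall>x\<in>cube n. bp_outputs P x (f x)"
    by (auto simp: branching_program_class_def)
  let ?V = "bp_var P ` bp_internal P"
  have fin: "finite (bp_nodes P)" using P(1) by (simp add: branching_program_def)
  have "card ?V \<le> card (bp_internal P)"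
    using fin by (intro card_image_le) (auto simp: bp_internal_def)
  also have "\<dots> \<le> s"
    using fin P(2) card_mono[of "bp_nodes P" "bp_internal P"] by (auto simp: bp_internal_def)
  finally have "card ?V \<le> s" .
  moreover have "?V \<subseteq> {..<n}" using P(1) by (auto simp: branching_program_def)
  moreover have "f x = f y" if "x \<in> cube n" "y \<in> cube n" "\<forall>j\<in>?V. x ! j = y ! j" for x y
  proof -
    have "bp_step P x = bp_step P y" using that(3) unfolding bp_step_def by force
    then have "bp_outputs P x (f y)" using P(3) that(2) by (auto simp: bp_outputs_def)
    then show ?thesis using bp_outputs_unique P(1,3) that(1) by blast
  qed
  ultimately show "\<exists>V\<subseteq>{..<n}. card V \<le> s \<and>
      (\<forall>x\<in>cube n. \<forall>y\<in>cube n. (\<forall>j\<in>V. x ! j = y ! j) \<longrightarrow> f x = f y)"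
    by blast
next
  fix f n s m and \<sigma> :: "nat \<Rightarrow> nat option"
  assume f: "f \<in> branching_program_class n s" and m: "0 < m"
    and \<sigma>: "\<And>j l. j < n \<Longrightarrow> \<sigma> j = Some l \<Longrightarrow> l < m"
  from f obtain P where P: "branching_program n P" "card (bp_nodes P) = s" "\<forall>x\<in>cube n. bp_outputs P x (f x)"
    by (auto simp: branching_program_class_def)
  moreover have "branching_program m (bp_subst \<sigma> P)"
    using branching_program_bp_subst P(1) m \<sigma> by blast
  moreover have "bp_nodes (bp_subst \<sigma> P) = bp_nodes P" by (simp add: bp_subst_def)
  ultimately show "(\<lambda>z. f (subst n \<sigma> z)) \<in> branching_program_class m s"
    unfolding branching_program_class_def
    by (intro CollectI exI[of _ "bp_subst \<sigma> P"]) (simp add: bp_outputs_bp_subst)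
next
  fix s :: nat
  assume s: "1 \<le> s"
  let ?K = "{..<s} \<times> {..<s} \<times> {..<s} \<times> ({..<s} \<rightarrow>\<^sub>E {..<s}) \<times> ({..<s} \<times> (UNIV :: bool set) \<rightarrow>\<^sub>E {..<s})"
  have "(\<lambda>f. restrict f (cube s)) ` branching_program_class s s
      \<subseteq> (\<lambda>c. restrict (code_eval s c) (cube s)) ` ?K"
  proof
    fix h assume "h \<in> (\<lambda>f. restrict f (cube s)) ` branching_program_class s s"
    then obtain f P where h: "h = restrict f (cube s)" "branching_program s P" "card (bp_nodes P) = s"
        "\<forall>x\<in>cube s. bp_outputs P x (f x)"
      by (auto simp: branching_program_class_def)
    obtain c where c: "c \<in> ?K" "\<And>x. x \<in> cube s \<Longrightarrow> code_eval s c x = f x"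
      using bp_code[OF h(2-4)] by metis
    have "h = restrict (code_eval s c) (cube s)"
      using h(1) c(2) by (simp add: restrict_def fun_eq_iff)
    then show "h \<in> (\<lambda>c. restrict (code_eval s c) (cube s)) ` ?K" using c(1) by blast
  qed
  then have "card ((\<lambda>f. restrict f (cube s)) ` branching_program_class s s) \<le> card ?K"
    by (intro surj_card_le) (auto intro!: finite_PiE finite_cartesian_product)
  \<comment> \<open>Three distinguished nodes, one label per node, two successors per node.\<close>
  also have "\<dots> = s ^ (3 + s + 2 * s)"
    by (simp add: card_cartesian_product card_PiE power_add power_mult power2_eq_square
        power_mult_distrib numeral_3_eq_3 flip: mult.assoc)
  also have "\<dots> \<le> (s + 2) ^ (3 + s + 2 * s)"
    by (rule power_mono) auto
  \<comment> \<open>\<open>3 + 3 * s \<le> 6 * s\<close> because \<open>1 \<le> s\<close>.\<close>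
  also have "\<dots> \<le> (s + 2) ^ (6 * s)"
    using s by (intro power_increasing) auto
  finally show "card ((\<lambda>f. restrict f (cube s)) ` branching_program_class s s) \<le> (s + 2) ^ (6 * s)" .
qed

subsection \<open>The tester\<close>

text \<open>A partition is a list of block numbers: \<open>\<pi> ! j\<close> is the block of
  variable \<open>j\<close>.\<close>

definition keep :: "nat \<Rightarrow> nat list \<Rightarrow> nat set \<Rightarrow> point \<Rightarrow> point" where
  "keep n \<pi> I x = tab n (\<lambda>j. \<pi> ! j \<in> I \<and> x ! j)"

text \<open>The variables outside the block \<open>fst p\<close> are frozen at the witness
  \<open>snd p\<close>. The argument remains a point of \<open>cube n\<close> with its other
  coordinates ignored, so the dictator test runs on the whole cube and blocks need no
  renumbering.\<close>

definition plug :: "nat \<Rightarrow> nat list \<Rightarrow> nat \<times> point \<Rightarrow> point \<Rightarrow> point" where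
  "plug n \<pi> p u = tab n (\<lambda>j. if \<pi> ! j = fst p then u ! j else snd p ! j)"

text \<open>Invariant: \<open>f (pts lo) = b\<close> and
  \<open>f (pts (lo + 2 ^ d)) \<noteq> b\<close>. The end values are known from the probe, so
  \<open>d\<close> queries suffice for \<open>2 ^ d\<close> blocks.\<close>

primrec bsearch :: "(nat \<Rightarrow> point) \<Rightarrow> nat \<Rightarrow> nat \<Rightarrow> bool \<Rightarrow> nat option algorithm" where
  "bsearch pts 0 lo b = Return (Some lo)"
| "bsearch pts (Suc d) lo b = Query (pts (lo + 2 ^ d))
    (\<lambda>c. if c = b then bsearch pts d (lo + 2 ^ d) b else bsearch pts d lo b)"

definition probe :: "nat \<Rightarrow> nat list \<Rightarrow> nat set \<Rightarrow> (point \<times> bool \<times> bool) option algorithm" where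
  "probe n \<pi> I = Sample (\<lambda>x. Query x (\<lambda>b. Query (keep n \<pi> I x) (\<lambda>c. Return (Some (x, b, c)))))"

abbreviation blocks :: "(nat \<times> point) list \<Rightarrow> nat set" where
  "blocks L \<equiv> fst ` set L"

text \<open>The state is a list of relevant blocks, each with a point at which zeroing the block changes \<open>f\<close>.\<close>

primrec find_blocks ::
    "nat \<Rightarrow> nat \<Rightarrow> nat \<Rightarrow> nat list \<Rightarrow> nat \<Rightarrow> (nat \<times> point) list \<Rightarrow> (nat \<times> point) list option algorithm" where
  "find_blocks n m d \<pi> 0 L = Return None"
| "find_blocks n m d \<pi> (Suc k) L =
    obind (for_list (\<lambda>_. probe n \<pi> (blocks L)) [0..<m]) (\<lambda>ps.
      case find (\<lambda>(x, b, c). b \<noteq> c) ps of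
        None \<Rightarrow> Return (Some L)
      | Some (x, b, c) \<Rightarrow>
          obind (bsearch (\<lambda>t. keep n \<pi> (blocks L \<union> {t..}) x) d 0 b) (\<lambda>t.
            find_blocks n m d \<pi> k ((t, keep n \<pi> (blocks L \<union> {t..}) x) # L)))"

text \<open>The three conjuncts of \<open>dictator_check\<close> share the value at
  \<open>w\<close>, which leaves seven queries.\<close>

definition dict_round :: "nat \<Rightarrow> nat list \<Rightarrow> nat \<times> point \<Rightarrow> unit option algorithm" where
  "dict_round n \<pi> p = (let q = plug n \<pi> p in
    rand (pmf_of_set (cube n)) (\<lambda>u. rand (pmf_of_set (cube n)) (\<lambda>v.
    rand (pmf_of_set (cube n)) (\<lambda>w. rand (pmf_of_set (cube n)) (\<lambda>w'.
      Query (q w) (\<lambda>b. Query (q (xorp n w u)) (\<lambda>b1.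
      Query (q w') (\<lambda>b2. Query (q (xorp n w' u)) (\<lambda>b3.
      Query (q (xorp n w (andp n u v))) (\<lambda>b4. Query (q (xorp n w v)) (\<lambda>b5.
      Query (q (xorp n w (tab n (\<lambda>_. True)))) (\<lambda>b6.
        Return (if (b1 \<noteq> b) = (b3 \<noteq> b2) \<and> (b4 \<noteq> b) = ((b1 \<noteq> b) \<and> (b5 \<noteq> b)) \<and> b6 \<noteq> b
          then Some () else None)))))))))))))"

definition dict_tests :: "nat \<Rightarrow> nat \<Rightarrow> nat list \<Rightarrow> (nat \<times> point) list \<Rightarrow> unit list list option algorithm" where
  "dict_tests n K \<pi> L = for_list (\<lambda>p. for_list (\<lambda>_. dict_round n \<pi> p) [0..<K]) L"

text \<open>Disagreement leads to rejection, so a wrong value requires all \<open>t\<close> answers to be wrong.\<close>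

definition val :: "nat \<Rightarrow> nat \<Rightarrow> nat list \<Rightarrow> nat \<times> point \<Rightarrow> point \<Rightarrow> bool option algorithm" where
  "val n t \<pi> p x = obind
    (for_list (\<lambda>_. rand (pmf_of_set (cube n)) (\<lambda>w. Query (plug n \<pi> p (xorp n w x)) (\<lambda>b.
      Query (plug n \<pi> p w) (\<lambda>c. Return (Some (b \<noteq> c)))))) [0..<t])
    (\<lambda>bs. Return (if \<forall>b\<in>set bs. b = hd bs then Some (hd bs) else None))"

definition vals :: "nat \<Rightarrow> nat \<Rightarrow> nat \<Rightarrow> nat list \<Rightarrow> (nat \<times> point) list \<Rightarrow> point \<Rightarrow> point option algorithm" where
  "vals n s t \<pi> L x = obind (for_list (\<lambda>p. val n t \<pi> p x) L)
    (\<lambda>ys. Return (Some (tab s (\<lambda>l. l < length ys \<and> ys ! l))))"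

text \<open>A point \<open>z\<close> of \<open>cube s\<close> prescribes constant values on the first \<open>length L\<close> blocks found.\<close>

definition block_of :: "nat list \<Rightarrow> (nat \<times> point) list \<Rightarrow> nat \<Rightarrow> nat option" where
  "block_of \<pi> L j = map_of (zip (map fst L) [0..<length L]) (\<pi> ! j)"

text \<open>The comparison is with \<open>f\<close> at \<open>keep n \<pi> (blocks L) x\<close>, not
  at \<open>x\<close>: blocks of small influence may have been missed, and then a function in the
  class could differ from \<open>F\<close> at \<open>x\<close> itself. Against the kept blocks it
  agrees with certainty.\<close>

definition agree_round ::
    "nat \<Rightarrow> nat \<Rightarrow> nat \<Rightarrow> nat list \<Rightarrow> (nat \<times> point) list \<Rightarrow> unit option algorithm" where
  "agree_round n s t \<pi> L = Sample (\<lambda>x. obind (vals n s t \<pi> L x) (\<lambda>z.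
    Query (keep n \<pi> (blocks L) x) (\<lambda>b. Query (subst n (block_of \<pi> L) z) (\<lambda>c.
      Return (if b = c then Some () else None)))))"

definition labelled_samples ::
    "nat \<Rightarrow> nat \<Rightarrow> nat list \<Rightarrow> (nat \<times> point) list \<Rightarrow> point option algorithm \<Rightarrow> (point \<times> bool) list option algorithm" where
  "labelled_samples n m \<pi> L Z = for_list (\<lambda>_. obind Z (\<lambda>z. Query (subst n (block_of \<pi> L) z)
    (\<lambda>c. Return (Some (z, c))))) [0..<m]"

text \<open>Searching all of \<open>H\<close> is free, since only queries and samples are
  charged.\<close>

definition consistency ::
    "bool_fun set \<Rightarrow> nat \<Rightarrow> nat \<Rightarrow> nat list \<Rightarrow> (nat \<times> point) list \<Rightarrow> point option algorithm \<Rightarrow> unit option algorithm" where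
  "consistency H n m \<pi> L Z = obind (labelled_samples n m \<pi> L Z)
    (\<lambda>zs. Return (if \<exists>h\<in>H. \<forall>(z, c)\<in>set zs. h z = c then Some () else None))"

definition partitions :: "nat \<Rightarrow> nat \<Rightarrow> nat list set" where
  "partitions n r = {\<pi>. set \<pi> \<subseteq> {..<r} \<and> length \<pi> = n}"

text \<open>\<open>Z \<pi> L\<close> generates the points at which the class is fitted: uniform points of \<open>cube s\<close> for the
  uniform distribution, the decoded values of a sample in the distribution-free case.\<close>

definition test_core ::
    "bool_fun set \<Rightarrow> nat \<Rightarrow> nat \<Rightarrow> (nat list \<Rightarrow> (nat \<times> point) list \<Rightarrow> point option algorithm) \<Rightarrow>
     nat \<Rightarrow> nat \<Rightarrow> nat \<Rightarrow> nat \<Rightarrow> nat \<Rightarrow> nat list \<Rightarrow> unit option algorithm" where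
  "test_core H n s Z m d t mA mB \<pi> =
    obind (find_blocks n m d \<pi> (Suc s) []) (\<lambda>L.
    obind (dict_tests n 75 \<pi> L) (\<lambda>_.
    obind (for_list (\<lambda>_. agree_round n s t \<pi> L) [0..<mA]) (\<lambda>_.
    consistency H n mB \<pi> L (Z \<pi> L))))"

definition uniform_points :: "nat \<Rightarrow> nat list \<Rightarrow> (nat \<times> point) list \<Rightarrow> point option algorithm" where
  "uniform_points s \<pi> L = rand (pmf_of_set (cube s)) (\<lambda>z. Return (Some (tab s (\<lambda>l. l < length L \<and> z ! l))))"

definition sampled_points :: "nat \<Rightarrow> nat \<Rightarrow> nat \<Rightarrow> nat list \<Rightarrow> (nat \<times> point) list \<Rightarrow> point option algorithm" where
  "sampled_points n s t \<pi> L = Sample (vals n s t \<pi> L)"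

lemma keep_in_cube [simp]: "keep n \<pi> I x \<in> cube n"
  by (simp add: keep_def)

lemma nth_keep [simp]: "j < n \<Longrightarrow> keep n \<pi> I x ! j \<longleftrightarrow> \<pi> ! j \<in> I \<and> x ! j"
  by (simp add: keep_def)

lemma keep_keep: "keep n \<pi> I (keep n \<pi> J x) = keep n \<pi> (I \<inter> J) x"
  by (rule cube_eqI[where n = n]) auto

lemma plug_in_cube [simp]: "plug n \<pi> p u \<in> cube n"
  by (simp add: plug_def)

lemma nth_plug [simp]: "j < n \<Longrightarrow> plug n \<pi> p u ! j = (if \<pi> ! j = fst p then u ! j else snd p ! j)"
  by (simp add: plug_def)

lemma finite_partitions [simp]: "finite (partitions n r)"
  unfolding partitions_def by (rule finite_lists_length_eq) simp

lemma partitions_nonempty: "0 < r \<Longrightarrow> partitions n r \<noteq> {}"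
  unfolding partitions_def by (auto intro!: exI[of _ "replicate n 0"])

subsection \<open>Query complexity\<close>

lemma outputs_bsearch:
  "(\<And>t. pts t \<in> cube n) \<Longrightarrow> outputs_le n (bsearch pts d lo b) d (\<lambda>r. \<forall>t. r = Some t \<longrightarrow> True)"
  by (induction d arbitrary: lo) auto

text \<open>The inequality on lengths is strict because a successful search ends with a round that
  finds nothing. Hence \<open>Suc s\<close> rounds are run for up to \<open>s\<close>
  blocks.\<close>

lemma outputs_find_blocks:
  "outputs_le n (find_blocks n m d \<pi> k L) (k * (m * 3 + d))
    (\<lambda>r. \<forall>L'. r = Some L' \<longrightarrow> length L' < length L + k)"
proof (induction k arbitrary: L)
  case (Suc k)
  have probe: "outputs_le n (probe n \<pi> I) 3 (\<lambda>r. \<forall>a. r = Some a \<longrightarrow> True)" for I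
    by (simp add: probe_def)
  have rest: "outputs_le n (case find (\<lambda>(x, b, c). b \<noteq> c) ps of
        None \<Rightarrow> Return (Some L)
      | Some (x, b, c) \<Rightarrow>
          obind (bsearch (\<lambda>t. keep n \<pi> (blocks L \<union> {t..}) x) d 0 b) (\<lambda>t.
            find_blocks n m d \<pi> k ((t, keep n \<pi> (blocks L \<union> {t..}) x) # L)))
      (d + k * (m * 3 + d)) (\<lambda>r. \<forall>L'. r = Some L' \<longrightarrow> length L' < length L + Suc k)" for ps
  proof (cases "find (\<lambda>(x, b, c). b \<noteq> c) ps")
    case None
    show ?thesis unfolding None by simp
  next
    case (Some p)
    obtain x b c where p: "p = (x, b, c)" by (cases p) auto
    have "outputs_le n (obind (bsearch (\<lambda>t. keep n \<pi> (blocks L \<union> {t..}) x) d 0 b) (\<lambda>t.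
            find_blocks n m d \<pi> k ((t, keep n \<pi> (blocks L \<union> {t..}) x) # L)))
      (d + k * (m * 3 + d)) (\<lambda>r. \<forall>L'. r = Some L' \<longrightarrow> length L' < length L + Suc k)"
    proof (rule outputs_le_obind[OF outputs_bsearch])
      fix t
      show "outputs_le n (find_blocks n m d \<pi> k ((t, keep n \<pi> (blocks L \<union> {t..}) x) # L)) (k * (m * 3 + d))
        (\<lambda>r. \<forall>L'. r = Some L' \<longrightarrow> length L' < length L + Suc k)"
        by (rule outputs_le_mono[OF Suc.IH]) auto
    qed simp
    then show ?thesis unfolding Some p by simp
  qed
  have "outputs_le n (find_blocks n m d \<pi> (Suc k) L) (length [0..<m] * 3 + (d + k * (m * 3 + d)))
    (\<lambda>r. \<forall>L'. r = Some L' \<longrightarrow> length L' < length L + Suc k)"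
    unfolding find_blocks.simps
    by (rule outputs_le_obind[OF outputs_le_for_list[OF probe] rest])
  then show ?case by (simp add: add.assoc)
qed simp

lemma outputs_dict_tests:
  "outputs_le n (dict_tests n K \<pi> L) (length L * (K * 7)) (\<lambda>r. \<forall>a. r = Some a \<longrightarrow> True)"
proof -
  have round: "outputs_le n (dict_round n \<pi> p) 7 (\<lambda>r. \<forall>a. r = Some a \<longrightarrow> True)" for p
    unfolding dict_round_def Let_def by (intro outputs_le_rand) simp
  have rounds: "outputs_le n (for_list (\<lambda>_. dict_round n \<pi> p) [0..<K]) (K * 7)
      (\<lambda>r. \<forall>a. r = Some a \<longrightarrow> True)" for p
    by (rule outputs_le_mono[OF outputs_le_for_list[OF round]]) auto
  show ?thesis
    unfolding dict_tests_def by (rule outputs_le_mono[OF outputs_le_for_list[OF rounds]]) auto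
qed

lemma outputs_vals:
  "outputs_le n (vals n s t \<pi> L x) (length L * (t * 2)) (\<lambda>r. \<forall>z. r = Some z \<longrightarrow> z \<in> cube s)"
proof -
  have round: "outputs_le n (rand (pmf_of_set (cube n)) (\<lambda>w. Query (plug n \<pi> p (xorp n w x)) (\<lambda>b.
      Query (plug n \<pi> p w) (\<lambda>c. Return (Some (b \<noteq> c)))))) 2 (\<lambda>r. \<forall>a. r = Some a \<longrightarrow> True)" for p
    by (intro outputs_le_rand) simp
  have "outputs_le n (val n t \<pi> p x) (length [0..<t] * 2 + 0) (\<lambda>r. \<forall>a. r = Some a \<longrightarrow> True)" for p
    unfolding val_def by (rule outputs_le_obind[OF outputs_le_for_list[OF round]]) simp
  then have val: "outputs_le n (val n t \<pi> p x) (t * 2) (\<lambda>r. \<forall>a. r = Some a \<longrightarrow> True)" for p by simp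
  have "outputs_le n (vals n s t \<pi> L x) (length L * (t * 2) + 0) (\<lambda>r. \<forall>z. r = Some z \<longrightarrow> z \<in> cube s)"
    unfolding vals_def by (rule outputs_le_obind[OF outputs_le_for_list[OF val]]) simp
  then show ?thesis by simp
qed

lemma outputs_agree_round:
  "outputs_le n (agree_round n s t \<pi> L) (3 + length L * (t * 2)) (\<lambda>r. \<forall>a. r = Some a \<longrightarrow> True)"
proof -
  have "outputs_le n (obind (vals n s t \<pi> L x) (\<lambda>z.
    Query (keep n \<pi> (blocks L) x) (\<lambda>b. Query (subst n (block_of \<pi> L) z) (\<lambda>c.
      Return (if b = c then Some () else None))))) (length L * (t * 2) + 2) (\<lambda>r. \<forall>a. r = Some a \<longrightarrow> True)" for x
    by (rule outputs_le_obind[OF outputs_vals]) simp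
  then show ?thesis unfolding agree_round_def by (simp add: numeral_3_eq_3)
qed

lemma outputs_consistency:
  assumes "outputs_le n Z q (\<lambda>r. \<forall>z. r = Some z \<longrightarrow> z \<in> cube s)"
  shows "outputs_le n (consistency H n m \<pi> L Z) (m * (q + 1)) (\<lambda>r. \<forall>a. r = Some a \<longrightarrow> True)"
proof -
  have round: "outputs_le n (obind Z (\<lambda>z. Query (subst n (block_of \<pi> L) z) (\<lambda>c. Return (Some (z, c)))))
      (q + 1) (\<lambda>r. \<forall>a. r = Some a \<longrightarrow> True)"
    by (rule outputs_le_obind[OF assms]) simp
  have "outputs_le n (consistency H n m \<pi> L Z) (length [0..<m] * (q + 1) + 0) (\<lambda>r. \<forall>a. r = Some a \<longrightarrow> True)"
    unfolding consistency_def labelled_samples_def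
    by (rule outputs_le_obind[OF outputs_le_for_list[OF round]]) simp
  then show ?thesis by simp
qed

lemma outputs_test_core:
  assumes Z: "\<And>L. length L \<le> s \<Longrightarrow> outputs_le n (Z \<pi> L) q (\<lambda>r. \<forall>z. r = Some z \<longrightarrow> z \<in> cube s)"
  shows "outputs_le n (test_core H n s Z m d t mA mB \<pi>)
    (Suc s * (m * 3 + d) + (s * (75 * 7) + (mA * (3 + s * (t * 2)) + mB * (q + 1))))
    (\<lambda>r. \<forall>a. r = Some a \<longrightarrow> True)"
  unfolding test_core_def
proof (rule outputs_le_obind[OF outputs_find_blocks])
  fix L :: "(nat \<times> point) list"
  assume "length L < length ([] :: (nat \<times> point) list) + Suc s"
  then have L: "length L \<le> s" by simp
  have dict: "outputs_le n (dict_tests n 75 \<pi> L) (s * (75 * 7)) (\<lambda>r. \<forall>a. r = Some a \<longrightarrow> True)"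
    by (rule outputs_le_mono[OF outputs_dict_tests]) (use L in auto)
  have "outputs_le n (agree_round n s t \<pi> L) (3 + s * (t * 2)) (\<lambda>r. \<forall>a. r = Some a \<longrightarrow> True)"
    by (rule outputs_le_mono[OF outputs_agree_round]) (use L in auto)
  note agree = outputs_le_for_list[OF this, of "[0..<mA]", simplified length_upt minus_nat.diff_0]
  show "outputs_le n (obind (dict_tests n 75 \<pi> L) (\<lambda>_.
    obind (for_list (\<lambda>_. agree_round n s t \<pi> L) [0..<mA]) (\<lambda>_. consistency H n mB \<pi> L (Z \<pi> L))))
    (s * (75 * 7) + (mA * (3 + s * (t * 2)) + mB * (q + 1))) (\<lambda>r. \<forall>a. r = Some a \<longrightarrow> True)"
    by (rule outputs_le_obind[OF dict outputs_le_obind[OF agree outputs_consistency[OF Z[OF L]]]])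
qed

subsection \<open>Finding the relevant blocks\<close>

lemma surely_bsearch:
  assumes "f (pts lo) = b" "f (pts (lo + 2 ^ d)) \<noteq> b"
  shows "surely f D (bsearch pts d lo b) (\<lambda>r. \<exists>t. r = Some t \<and> f (pts t) \<noteq> f (pts (Suc t)))"
  using assms
proof (induction d arbitrary: lo)
  case (Suc d)
  have "lo + 2 ^ Suc d = lo + 2 ^ d + 2 ^ d" by simp
  with Suc.prems(2) have "f (pts (lo + 2 ^ d + 2 ^ d)) \<noteq> b" by metis
  then show ?case using Suc.IH[of lo] Suc.IH[of "lo + 2 ^ d"] Suc.prems(1) by simp
qed simp

definition witnessed :: "bool_fun \<Rightarrow> nat \<Rightarrow> nat list \<Rightarrow> (nat \<times> point) list \<Rightarrow> bool" where
  "witnessed f n \<pi> L \<longleftrightarrow> distinct (map fst L) \<and>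
     (\<forall>p\<in>set L. snd p \<in> cube n \<and> f (snd p) \<noteq> f (keep n \<pi> (- {fst p}) (snd p)))"

lemma surely_probe:
  assumes "set_pmf D \<subseteq> cube n"
  shows "surely f D (probe n \<pi> I)
    (\<lambda>r. \<exists>p. r = Some p \<and> fst p \<in> cube n \<and> fst (snd p) = f (fst p) \<and> snd (snd p) = f (keep n \<pi> I (fst p)))"
  using assms by (auto simp: probe_def)

lemma list_all2_const: "list_all2 (\<lambda>_. Q) xs ys \<Longrightarrow> \<forall>y\<in>set ys. Q y"
  by (induction rule: list_all2_induct) auto

lemma surely_probes:
  assumes "set_pmf D \<subseteq> cube n"
  shows "surely f D (for_list (\<lambda>_. probe n \<pi> I) [0..<m])
    (\<lambda>r. \<exists>ps. r = Some ps \<and> (\<forall>p\<in>set ps. fst p \<in> cube n \<and> fst (snd p) = f (fst p) \<and>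
      snd (snd p) = f (keep n \<pi> I (fst p))))"
proof (rule surely_mono[OF surely_for_list[OF surely_probe[OF assms]]])
  fix r :: "(point \<times> bool \<times> bool) list option"
  assume "\<exists>ps. r = Some ps \<and> list_all2 (\<lambda>_ p. fst p \<in> cube n \<and> fst (snd p) = f (fst p) \<and>
      snd (snd p) = f (keep n \<pi> I (fst p))) [0..<m] ps"
  then show "\<exists>ps. r = Some ps \<and> (\<forall>p\<in>set ps. fst p \<in> cube n \<and> fst (snd p) = f (fst p) \<and>
      snd (snd p) = f (keep n \<pi> I (fst p)))"
    using list_all2_const by blast
qed

text \<open>A hybrid argument: as \<open>t\<close> grows from 0 to \<open>2 ^ d\<close>, the points
  lead from \<open>x\<close> to \<open>keep n \<pi> (blocks L) x\<close>, and \<open>f\<close>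
  differs at the two ends. Where \<open>f\<close> changes, a single block is zeroed, and the hybrid
  just before is its witness.\<close>

lemma witnessed_step:
  assumes \<pi>: "\<pi> \<in> partitions n (2 ^ d)" and L: "witnessed f n \<pi> L" and x: "x \<in> cube n"
    and differ: "f x \<noteq> f (keep n \<pi> (blocks L) x)"
  shows "surely f D (bsearch (\<lambda>t. keep n \<pi> (blocks L \<union> {t..}) x) d 0 (f x))
    (\<lambda>r. \<exists>t. r = Some t \<and> witnessed f n \<pi> ((t, keep n \<pi> (blocks L \<union> {t..}) x) # L))"
proof -
  have "keep n \<pi> (blocks L \<union> {0..}) x = x"
    by (rule cube_eqI[where n = n]) (use x in auto)
  moreover have "keep n \<pi> (blocks L \<union> {2 ^ d..}) x = keep n \<pi> (blocks L) x"
  proof (rule cube_eqI[where n = n])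
    fix j assume "j < n"
    moreover have "\<pi> ! j < 2 ^ d"
    proof -
      have "\<pi> ! j \<in> set \<pi>" using \<pi> \<open>j < n\<close> by (simp add: partitions_def)
      then show ?thesis using \<pi> by (auto simp: partitions_def)
    qed
    ultimately show "keep n \<pi> (blocks L \<union> {2 ^ d..}) x ! j = keep n \<pi> (blocks L) x ! j" by auto
  qed auto
  ultimately have "surely f D (bsearch (\<lambda>t. keep n \<pi> (blocks L \<union> {t..}) x) d 0 (f x))
    (\<lambda>r. \<exists>t. r = Some t \<and> f (keep n \<pi> (blocks L \<union> {t..}) x) \<noteq> f (keep n \<pi> (blocks L \<union> {Suc t..}) x))"
    using differ by (intro surely_bsearch) auto
  then show ?thesis
  proof (rule surely_mono)
    fix r assume "\<exists>t. r = Some t \<and> f (keep n \<pi> (blocks L \<union> {t..}) x) \<noteq> f (keep n \<pi> (blocks L \<union> {Suc t..}) x)"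
    then obtain t where t: "r = Some t"
        "f (keep n \<pi> (blocks L \<union> {t..}) x) \<noteq> f (keep n \<pi> (blocks L \<union> {Suc t..}) x)" by blast
    \<comment> \<open>For a block already found the two hybrids coincide, so the block at which
      \<open>f\<close> changes is new.\<close>
    have "t \<notin> blocks L"
    proof
      assume "t \<in> blocks L"
      moreover have "{t..} = insert t {Suc t..}" by auto
      ultimately have "blocks L \<union> {t..} = blocks L \<union> {Suc t..}" by auto
      then show False using t(2) by simp
    qed
    moreover have "- {t} \<inter> (blocks L \<union> {t..}) = blocks L \<union> {Suc t..}"
    proof -
      have "{t..} = insert t {Suc t..}" by auto
      then show ?thesis using \<open>t \<notin> blocks L\<close> by auto
    qed
    ultimately have "witnessed f n \<pi> ((t, keep n \<pi> (blocks L \<union> {t..}) x) # L)"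
      using L t(2) unfolding witnessed_def by (simp add: keep_keep)
    with t(1) show "\<exists>t. r = Some t \<and> witnessed f n \<pi> ((t, keep n \<pi> (blocks L \<union> {t..}) x) # L)"
      by blast
  qed
qed

text \<open>Only as many blocks can be witnessed as there are relevant variables, so for functions in the class
  the search does not run out of rounds.\<close>

lemma surely_find_blocks:
  assumes D: "set_pmf D \<subseteq> cube n" and \<pi>: "\<pi> \<in> partitions n (2 ^ d)" and L: "witnessed f n \<pi> L"
  shows "surely f D (find_blocks n m d \<pi> k L) (\<lambda>r. (\<forall>L'. r = Some L' \<longrightarrow> witnessed f n \<pi> L') \<and>
    ((\<forall>L'. witnessed f n \<pi> L' \<longrightarrow> length L' < length L + k) \<longrightarrow> r \<noteq> None))"
  using L
proof (induction k arbitrary: L)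
  case 0
  then show ?case by auto
next
  case (Suc k)
  show ?case
    unfolding find_blocks.simps
  proof (rule surely_obind[OF surely_probes[OF D]])
    fix ps :: "(point \<times> bool \<times> bool) list"
    assume ps: "\<forall>p\<in>set ps. fst p \<in> cube n \<and> fst (snd p) = f (fst p) \<and>
      snd (snd p) = f (keep n \<pi> (blocks L) (fst p))"
    let ?Q = "\<lambda>r. (\<forall>L'. r = Some L' \<longrightarrow> witnessed f n \<pi> L') \<and>
      ((\<forall>L'. witnessed f n \<pi> L' \<longrightarrow> length L' < length L + Suc k) \<longrightarrow> r \<noteq> None)"
    show "surely f D (case find (\<lambda>(x, b, c). b \<noteq> c) ps of
        None \<Rightarrow> Return (Some L)
      | Some (x, b, c) \<Rightarrow>
          obind (bsearch (\<lambda>t. keep n \<pi> (blocks L \<union> {t..}) x) d 0 b) (\<lambda>t.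
            find_blocks n m d \<pi> k ((t, keep n \<pi> (blocks L \<union> {t..}) x) # L))) ?Q"
    proof (cases "find (\<lambda>(x, b, c). b \<noteq> c) ps")
      case None
      show ?thesis unfolding None using Suc.prems by simp
    next
      case (Some p)
      obtain x b c where p: "p = (x, b, c)" by (cases p) auto
      have "p \<in> set ps" "case p of (x, b, c) \<Rightarrow> b \<noteq> c"
        using Some unfolding find_Some_iff by (metis nth_mem)+
      then have x: "x \<in> cube n" "b = f x" "c = f (keep n \<pi> (blocks L) x)"
        using ps unfolding p by fastforce+
      from \<open>case p of (x, b, c) \<Rightarrow> b \<noteq> c\<close> p have "b \<noteq> c" by simp
      have "surely f D (obind (bsearch (\<lambda>t. keep n \<pi> (blocks L \<union> {t..}) x) d 0 (f x)) (\<lambda>t.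
            find_blocks n m d \<pi> k ((t, keep n \<pi> (blocks L \<union> {t..}) x) # L))) ?Q"
      proof (rule surely_obind[OF witnessed_step[OF \<pi> Suc.prems x(1)]])
        show "f x \<noteq> f (keep n \<pi> (blocks L) x)" using x \<open>b \<noteq> c\<close> by simp
        fix t assume "witnessed f n \<pi> ((t, keep n \<pi> (blocks L \<union> {t..}) x) # L)"
        from Suc.IH[OF this] show "surely f D (find_blocks n m d \<pi> k ((t, keep n \<pi> (blocks L \<union> {t..}) x) # L)) ?Q"
          by (rule surely_mono) simp
      qed
      then show ?thesis unfolding Some p x by simp
    qed
  qed
qed

subsection \<open>Functions in the class are accepted\<close>

text \<open>The good event of the random partition. The tester's steps are shown below to succeed
  with certainty in this setting.\<close>

locale separated_junta =
  fixes n d :: nat and f :: bool_fun and \<pi> :: "nat list" and V :: "nat set" and D :: "point pmf"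
  assumes \<pi>: "\<pi> \<in> partitions n (2 ^ d)"
    and V: "V \<subseteq> {..<n}"
    and junta: "x \<in> cube n \<Longrightarrow> y \<in> cube n \<Longrightarrow> (\<And>j. j \<in> V \<Longrightarrow> x ! j = y ! j) \<Longrightarrow> f x = f y"
    and separated: "inj_on ((!) \<pi>) V"
    and D: "set_pmf D \<subseteq> cube n"
begin

definition var :: "nat \<Rightarrow> nat" where
  "var i = the_inv_into V ((!) \<pi>) i"

lemma var_nth: "j \<in> V \<Longrightarrow> var (\<pi> ! j) = j"
  unfolding var_def by (rule the_inv_into_f_f[OF separated])

lemma finite_V: "finite V"
  using V finite_subset by blast

lemma witnessed_block:
  assumes "witnessed f n \<pi> L" "p \<in> set L"
  shows "fst p \<in> (!) \<pi> ` V"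
proof (rule ccontr)
  assume no: "fst p \<notin> (!) \<pi> ` V"
  have p: "snd p \<in> cube n" "f (snd p) \<noteq> f (keep n \<pi> (- {fst p}) (snd p))"
    using assms by (auto simp: witnessed_def)
  have "f (snd p) = f (keep n \<pi> (- {fst p}) (snd p))"
  proof (rule junta[OF p(1)])
    fix j assume "j \<in> V"
    then have "\<pi> ! j \<in> (!) \<pi> ` V" by (rule imageI)
    with no have "\<pi> ! j \<noteq> fst p" by metis
    moreover have "j < n" using V \<open>j \<in> V\<close> by blast
    ultimately show "snd p ! j = keep n \<pi> (- {fst p}) (snd p) ! j" by simp
  qed simp
  with p(2) show False by contradiction
qed

lemma var_block:
  assumes "witnessed f n \<pi> L" "p \<in> set L"
  shows "var (fst p) \<in> V" "var (fst p) < n" "\<pi> ! var (fst p) = fst p"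
proof -
  obtain j where "j \<in> V" "fst p = \<pi> ! j"
    using witnessed_block[OF assms] by blast
  then show "var (fst p) \<in> V" "var (fst p) < n" "\<pi> ! var (fst p) = fst p"
    using var_nth V by auto
qed

lemma length_witnessed:
  assumes "witnessed f n \<pi> L"
  shows "length L \<le> card V"
proof -
  have "length L = card (blocks L)"
    using assms distinct_card[of "map fst L"] by (simp add: witnessed_def)
  also have "\<dots> \<le> card ((!) \<pi> ` V)"
    using witnessed_block[OF assms] finite_V by (intro card_mono) auto
  also have "\<dots> \<le> card V"
    by (rule card_image_le[OF finite_V])
  finally show ?thesis .
qed

text \<open>By separation the plugged function depends on at most one coordinate of the block. It
  takes different values at the witness and at the zero point, so it is a literal of that
  coordinate.\<close>

lemma block_literal:
  assumes L: "witnessed f n \<pi> L" "p \<in> set L" and u: "u \<in> cube n" "u' \<in> cube n"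
  shows "f (plug n \<pi> p u) \<noteq> f (plug n \<pi> p u') \<longleftrightarrow> u ! var (fst p) \<noteq> u' ! var (fst p)"
proof -
  let ?g = "\<lambda>u. f (plug n \<pi> p u)"
  have same: "?g u = ?g u'" if "u \<in> cube n" "u' \<in> cube n" "u ! var (fst p) = u' ! var (fst p)" for u u'
  proof (rule junta)
    fix j assume "j \<in> V"
    then have "j < n" using V by blast
    moreover have "var (fst p) = j" if "\<pi> ! j = fst p"
      using var_nth[OF \<open>j \<in> V\<close>] that by simp
    ultimately show "plug n \<pi> p u ! j = plug n \<pi> p u' ! j"
      using that(3) by (cases "\<pi> ! j = fst p") simp_all
  qed auto
  have p: "snd p \<in> cube n" "f (snd p) \<noteq> f (keep n \<pi> (- {fst p}) (snd p))"
    using L by (auto simp: witnessed_def)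
  let ?z = "tab n (\<lambda>_. False)"
  have "plug n \<pi> p (snd p) = snd p"
    by (rule cube_eqI[where n = n]) (use p in auto)
  moreover have "plug n \<pi> p ?z = keep n \<pi> (- {fst p}) (snd p)"
    by (rule cube_eqI[where n = n]) auto
  ultimately have differ: "?g (snd p) \<noteq> ?g ?z" using p by simp
  then have "snd p ! var (fst p) \<noteq> ?z ! var (fst p)"
    using same[OF p(1), of ?z] by auto
  then have "?g u = ?g (snd p) \<longleftrightarrow> u ! var (fst p)" if "u \<in> cube n" for u
    using same[OF that p(1)] same[OF that, of ?z] differ var_block(2)[OF L] by (cases "u ! var (fst p)") auto
  from this[OF u(1)] this[OF u(2)] show ?thesis by (auto simp del: nth_plug)
qed

lemma delta_literal:
  assumes "witnessed f n \<pi> L" "p \<in> set L" "w \<in> cube n" "u \<in> cube n"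
  shows "f (plug n \<pi> p (xorp n w u)) = (\<not> f (plug n \<pi> p w)) \<longleftrightarrow> u ! var (fst p)"
  using block_literal[OF assms(1,2), of "xorp n w u" w] assms var_block(2)[OF assms(1,2)] by auto

lemma surely_dict_tests:
  assumes L: "witnessed f n \<pi> L"
  shows "surely f D (dict_tests n K \<pi> L) (\<lambda>r. \<exists>a. r = Some a \<and> True)"
proof -
  have round: "surely f D (dict_round n \<pi> p) (\<lambda>r. \<exists>a. r = Some a \<and> True)" if "p \<in> set L" for p
    using var_block(2)[OF L \<open>p \<in> set L\<close>]
    by (simp add: dict_round_def Let_def delta_literal[OF L \<open>p \<in> set L\<close>])
  have rounds: "surely f D (for_list (\<lambda>_. dict_round n \<pi> p) [0..<K]) (\<lambda>r. \<exists>a. r = Some a \<and> True)"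
    if "p \<in> set L" for p
    by (rule surely_mono[OF surely_for_list[OF round[OF \<open>p \<in> set L\<close>]]]) auto
  show ?thesis
    unfolding dict_tests_def by (rule surely_mono[OF surely_for_list[OF rounds]]) auto
qed

lemma surely_val:
  assumes L: "witnessed f n \<pi> L" "p \<in> set L" and x: "x \<in> cube n" and t: "0 < t"
  shows "surely f D (val n t \<pi> p x) (\<lambda>r. \<exists>b. r = Some b \<and> b = x ! var (fst p))"
  unfolding val_def
proof (rule surely_obind[OF surely_for_list[where P = "\<lambda>_ b. b = x ! var (fst p)"]])
  show "surely f D (rand (pmf_of_set (cube n)) (\<lambda>w. Query (plug n \<pi> p (xorp n w x)) (\<lambda>b.
      Query (plug n \<pi> p w) (\<lambda>c. Return (Some (b \<noteq> c)))))) (\<lambda>r. \<exists>a. r = Some a \<and> a = x ! var (fst p))"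
    by (simp add: delta_literal[OF L _ x])
  fix bs assume *: "list_all2 (\<lambda>_ b. b = x ! var (fst p)) [0..<t] bs"
  then have "\<forall>b\<in>set bs. b = x ! var (fst p)" by (rule list_all2_const)
  moreover have "bs \<noteq> []" using * t by auto
  ultimately have "hd bs = x ! var (fst p)" by simp
  with \<open>\<forall>b\<in>set bs. b = x ! var (fst p)\<close>
  show "surely f D (Return (if \<forall>b\<in>set bs. b = hd bs then Some (hd bs) else None))
      (\<lambda>r. \<exists>b. r = Some b \<and> b = x ! var (fst p))"
    by (simp only: surely_simps) simp
qed

lemma surely_vals:
  assumes L: "witnessed f n \<pi> L" and x: "x \<in> cube n" and t: "0 < t"
  shows "surely f D (vals n s t \<pi> L x) (\<lambda>r. \<exists>z. r = Some z \<and> z \<in> cube s \<and>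
    (\<forall>l<s. l < length L \<longrightarrow> z ! l = x ! var (fst (L ! l))))"
  unfolding vals_def
proof (rule surely_obind[OF surely_for_list[where P = "\<lambda>p b. b = x ! var (fst p)"]])
  show "surely f D (val n t \<pi> p x) (\<lambda>r. \<exists>b. r = Some b \<and> b = x ! var (fst p))" if "p \<in> set L" for p
    by (rule surely_val[OF L that x t])
qed (auto simp: list_all2_conv_all_nth)

lemma surely_uniform_points:
  "surely f D (uniform_points s \<pi> L) (\<lambda>r. \<exists>z. r = Some z \<and> z \<in> cube s)"
  by (simp add: uniform_points_def)

lemma surely_sampled_points:
  assumes "witnessed f n \<pi> L" "0 < t"
  shows "surely f D (sampled_points n s t \<pi> L) (\<lambda>r. \<exists>z. r = Some z \<and> z \<in> cube s)"
proof -
  have "surely f D (vals n s t \<pi> L x) (\<lambda>r. \<exists>z. r = Some z \<and> z \<in> cube s)" if "x \<in> cube n" for x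
    by (rule surely_mono[OF surely_vals[OF assms(1) that assms(2)]]) blast
  then show ?thesis using D by (auto simp: sampled_points_def)
qed

text \<open>The two points may differ at many coordinates, but not at relevant ones: the only
  variable of \<open>V\<close> in the \<open>l\<close>-th block is the decoded one, and outside the
  blocks found both points are zero.\<close>

lemma keep_eq_subst:
  assumes L: "witnessed f n \<pi> L" "length L \<le> s"
    and z: "\<And>l. l < length L \<Longrightarrow> z ! l = x ! var (fst (L ! l))"
  shows "f (keep n \<pi> (blocks L) x) = f (subst n (block_of \<pi> L) z)"
proof (rule junta)
  fix j assume "j \<in> V"
  then have "j < n" using V by blast
  show "keep n \<pi> (blocks L) x ! j = subst n (block_of \<pi> L) z ! j"
  proof (cases "\<pi> ! j \<in> blocks L")
    case True
    then obtain l where l: "l < length L" "\<pi> ! j = fst (L ! l)"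
      by (metis imageE in_set_conv_nth)
    have "map_of (zip (map fst L) [0..<length L]) (map fst L ! l) = Some ([0..<length L] ! l)"
      using L l by (intro map_of_zip_nth) (auto simp: witnessed_def)
    then have "block_of \<pi> L j = Some l" using l by (simp add: block_of_def)
    then show ?thesis
      using \<open>j < n\<close> True z[OF l(1)] var_nth[OF \<open>j \<in> V\<close>] l by (simp add: nth_subst)
  next
    case False
    then have "block_of \<pi> L j = None"
      by (simp add: block_of_def map_of_zip_is_None)
    then show ?thesis using \<open>j < n\<close> False by (simp add: nth_subst)
  qed
qed auto

lemma surely_agree_round:
  assumes L: "witnessed f n \<pi> L" "length L \<le> s" and t: "0 < t"
  shows "surely f D (agree_round n s t \<pi> L) (\<lambda>r. \<exists>a. r = Some a \<and> True)"
proof -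
  have "surely f D (obind (vals n s t \<pi> L x) (\<lambda>z.
    Query (keep n \<pi> (blocks L) x) (\<lambda>b. Query (subst n (block_of \<pi> L) z) (\<lambda>c.
      Return (if b = c then Some () else None))))) (\<lambda>r. \<exists>a. r = Some a \<and> True)" if "x \<in> cube n" for x
  proof (rule surely_obind[OF surely_vals[OF L(1) that t]])
    fix z assume "z \<in> cube s \<and> (\<forall>l<s. l < length L \<longrightarrow> z ! l = x ! var (fst (L ! l)))"
    then have "f (keep n \<pi> (blocks L) x) = f (subst n (block_of \<pi> L) z)"
      using L(2) by (intro keep_eq_subst[OF L]) auto
    then show "surely f D (Query (keep n \<pi> (blocks L) x) (\<lambda>b. Query (subst n (block_of \<pi> L) z) (\<lambda>c.
      Return (if b = c then Some () else None)))) (\<lambda>r. \<exists>a. r = Some a \<and> True)" by simp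
  qed
  then show ?thesis unfolding agree_round_def surely_simps using D by blast
qed

lemma surely_consistency:
  assumes H: "h \<in> H" "\<And>z. z \<in> cube s \<Longrightarrow> h z = f (subst n (block_of \<pi> L) z)"
    and Z: "surely f D Z (\<lambda>r. \<exists>z. r = Some z \<and> z \<in> cube s)"
  shows "surely f D (consistency H n m \<pi> L Z) (\<lambda>r. \<exists>a. r = Some a)"
  unfolding consistency_def labelled_samples_def
proof (rule surely_obind[OF surely_for_list[where P = "\<lambda>_ (z, c). h z = c"]])
  show "surely f D (obind Z (\<lambda>z. Query (subst n (block_of \<pi> L) z) (\<lambda>c. Return (Some (z, c)))))
      (\<lambda>r. \<exists>a. r = Some a \<and> (case a of (z, c) \<Rightarrow> h z = c))"
    by (rule surely_obind[OF Z]) (simp add: H(2))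
  fix zs assume "list_all2 (\<lambda>_ (z, c). h z = c) [0..<m] zs"
  then have "\<forall>(z, c)\<in>set zs. h z = c" by (rule list_all2_const)
  then have "\<exists>h\<in>H. \<forall>(z, c)\<in>set zs. h z = c" using H(1) by blast
  then show "surely f D (Return (if \<exists>h\<in>H. \<forall>(z, c)\<in>set zs. h z = c then Some () else None))
      (\<lambda>r. \<exists>a. r = Some a)" by simp
qed

lemma surely_test_core:
  assumes s: "card V \<le> s" and t: "0 < t"
    and H: "\<And>L. length L \<le> s \<Longrightarrow> (\<lambda>z. f (subst n (block_of \<pi> L) z)) \<in> H"
    and Z: "\<And>L. witnessed f n \<pi> L \<Longrightarrow> surely f D (Z \<pi> L) (\<lambda>r. \<exists>z. r = Some z \<and> z \<in> cube s)"
  shows "surely f D (test_core H n s Z m d t mA mB \<pi>) (\<lambda>r. \<exists>a. r = Some a)"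
proof -
  have "witnessed f n \<pi> []" by (simp add: witnessed_def)
  have found: "surely f D (find_blocks n m d \<pi> (Suc s) []) (\<lambda>r. \<exists>L. r = Some L \<and> witnessed f n \<pi> L)"
  proof (rule surely_mono[OF surely_find_blocks[OF D \<pi> \<open>witnessed f n \<pi> []\<close>]])
    fix r :: "(nat \<times> point) list option"
    assume r: "(\<forall>L'. r = Some L' \<longrightarrow> witnessed f n \<pi> L') \<and>
      ((\<forall>L'. witnessed f n \<pi> L' \<longrightarrow> length L' < length ([] :: (nat \<times> point) list) + Suc s) \<longrightarrow> r \<noteq> None)"
    have "\<forall>L'. witnessed f n \<pi> L' \<longrightarrow> length L' < length ([] :: (nat \<times> point) list) + Suc s"
      using length_witnessed s by fastforce
    with r show "\<exists>L. r = Some L \<and> witnessed f n \<pi> L" by blast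
  qed
  show ?thesis
    unfolding test_core_def
  proof (rule surely_obind[OF found])
    fix L assume L: "witnessed f n \<pi> L"
    then have len: "length L \<le> s" using length_witnessed s by fastforce
    have agree: "surely f D (for_list (\<lambda>_. agree_round n s t \<pi> L) [0..<mA]) (\<lambda>r. \<exists>a. r = Some a \<and> True)"
      by (rule surely_mono[OF surely_for_list[OF surely_agree_round[OF L len t]]]) auto
    show "surely f D (obind (dict_tests n 75 \<pi> L) (\<lambda>_.
      obind (for_list (\<lambda>_. agree_round n s t \<pi> L) [0..<mA]) (\<lambda>_. consistency H n mB \<pi> L (Z \<pi> L))))
      (\<lambda>r. \<exists>a. r = Some a)"
      by (rule surely_obind[OF surely_dict_tests[OF L]], rule surely_obind[OF agree],
          rule surely_consistency[OF H[OF len] _ Z[OF L]]) simp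
  qed
qed

end

section \<open>Random partitions separate the relevant variables\<close>

lemma collision_card:
  assumes "i < n" "j < n" "i \<noteq> j"
  shows "r * card {\<pi> \<in> partitions n r. \<pi> ! i = \<pi> ! j} \<le> card (partitions n r)"
proof -
  let ?E = "{\<pi> \<in> partitions n r. \<pi> ! i = \<pi> ! j}"
  \<comment> \<open>Overwriting entry \<open>i\<close> of a colliding partition loses nothing, since
    the old entry can be read off at \<open>j\<close>. So each colliding partition accounts for
    \<open>r\<close> partitions of its own.\<close>
  have "inj_on (\<lambda>(\<pi>, c). \<pi>[i := c]) (?E \<times> {..<r})"
  proof (rule inj_onI, clarify)
    fix \<pi> c \<pi>' c'
    assume *: "\<pi> \<in> partitions n r" "\<pi>' \<in> partitions n r" "\<pi> ! i = \<pi> ! j" "\<pi>' ! i = \<pi>' ! j"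
      "\<pi>[i := c] = \<pi>'[i := c']"
    then have len: "length \<pi> = n" "length \<pi>' = n" by (auto simp: partitions_def)
    have eq: "\<pi>[i := c] ! k = \<pi>'[i := c'] ! k" for k using *(5) by simp
    have off: "\<pi> ! k = \<pi>' ! k" if "k \<noteq> i" for k using eq[of k] that by simp
    have "\<pi> ! k = \<pi>' ! k" for k
      using off[of k] off[of j] *(3,4) assms(3) by (cases "k = i") auto
    then have "\<pi> = \<pi>'" using len by (intro nth_equalityI) auto
    moreover have "c = c'" using eq[of i] assms(1) len by simp
    ultimately show "\<pi> = \<pi>' \<and> c = c'" by simp
  qed
  moreover have "(\<lambda>(\<pi>, c). \<pi>[i := c]) ` (?E \<times> {..<r}) \<subseteq> partitions n r"
    using set_update_subset_insert by (fastforce simp: partitions_def)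
  ultimately have "card (?E \<times> {..<r}) \<le> card (partitions n r)"
    by (rule card_inj_on_le) simp
  then show ?thesis by (simp add: card_cartesian_product mult.commute)
qed

text \<open>Union bound over at most \<open>s ^ 2\<close> ordered pairs, each colliding with
  probability at most \<open>1 / r\<close>.\<close>

lemma separation:
  assumes V: "V \<subseteq> {..<n}" "card V \<le> s" and r: "3 * s ^ 2 \<le> r" "0 < r"
  shows "measure_pmf.prob (pmf_of_set (partitions n r)) {\<pi>. \<not> inj_on ((!) \<pi>) V} \<le> 1 / 3"
proof -
  let ?P = "partitions n r"
  define S where "S = {(i, j). i \<in> V \<and> j \<in> V \<and> i \<noteq> j}"
  have "finite V" using V finite_subset by blast
  have "S \<subseteq> V \<times> V" by (auto simp: S_def)
  then have "finite S" using \<open>finite V\<close> finite_subset by blast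
  have "card S \<le> card (V \<times> V)" using \<open>S \<subseteq> V \<times> V\<close> \<open>finite V\<close> by (intro card_mono) auto
  also have "\<dots> \<le> s ^ 2" using V(2) by (simp add: card_cartesian_product power2_eq_square mult_mono)
  finally have "card S \<le> s ^ 2" .
  let ?E = "\<lambda>(i, j). {\<pi> \<in> ?P. \<pi> ! i = \<pi> ! j}"
  have "?P \<inter> {\<pi>. \<not> inj_on ((!) \<pi>) V} \<subseteq> (\<Union>e\<in>S. ?E e)"
    by (auto simp: inj_on_def S_def)
  then have "card (?P \<inter> {\<pi>. \<not> inj_on ((!) \<pi>) V}) \<le> card (\<Union>e\<in>S. ?E e)"
    using \<open>finite S\<close> by (intro card_mono) auto
  also have "\<dots> \<le> (\<Sum>e\<in>S. card (?E e))"
    by (rule card_UN_le[OF \<open>finite S\<close>])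
  finally have "r * card (?P \<inter> {\<pi>. \<not> inj_on ((!) \<pi>) V}) \<le> r * (\<Sum>e\<in>S. card (?E e))"
    by simp
  also have "\<dots> = (\<Sum>e\<in>S. r * card (?E e))" by (simp add: sum_distrib_left)
  also have "\<dots> \<le> (\<Sum>e\<in>S. card ?P)"
    using V(1) by (intro sum_mono) (auto simp: S_def intro!: collision_card)
  also have "\<dots> \<le> s ^ 2 * card ?P" using \<open>card S \<le> s ^ 2\<close> by simp
  finally have "3 * (r * card (?P \<inter> {\<pi>. \<not> inj_on ((!) \<pi>) V})) \<le> 3 * s ^ 2 * card ?P" by simp
  also have "\<dots> \<le> r * card ?P" using r by simp
  finally have "r * (3 * card (?P \<inter> {\<pi>. \<not> inj_on ((!) \<pi>) V})) \<le> r * card ?P"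
    by (simp add: mult.left_commute)
  then have "3 * card (?P \<inter> {\<pi>. \<not> inj_on ((!) \<pi>) V}) \<le> card ?P" using r(2) by simp
  then have "3 * real (card (?P \<inter> {\<pi>. \<not> inj_on ((!) \<pi>) V})) \<le> real (card ?P)" by linarith
  moreover have "0 < card ?P" using partitions_nonempty[OF r(2)] by (simp add: card_gt_0_iff)
  ultimately show ?thesis
    by (subst measure_pmf_of_set) (auto simp: partitions_nonempty[OF r(2)] field_simps)
qed

subsection \<open>Far functions are rejected\<close>

lemma expectation_of_bool:
  "measure_pmf.expectation D (\<lambda>x. of_bool (Q x)) = measure_pmf.prob D {x. Q x}"
proof -
  have "(\<lambda>x. of_bool (Q x) :: real) = indicator {x. Q x}"
    by (auto simp: indicator_def)
  then show ?thesis by simp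
qed

lemma prob_not: "measure_pmf.prob D {x. \<not> Q x} = 1 - measure_pmf.prob D {x. Q x}"
  using measure_pmf.prob_compl[of "{x. Q x}" D] by (simp add: Compl_eq_Diff_UNIV[symmetric] Collect_neg_eq)

lemma prob_some_False [simp]: "prob_some f D A (\<lambda>_. False) = 0"
  by (simp add: prob_some_def)

lemma prob_some_obind_first: "prob_some f D (obind A k) P \<le> prob_some f D A (\<lambda>_. True)"
  using prob_some_obind[of f D A "\<lambda>_. True" k P 0] by (simp add: surely_def)

lemma prob_some_obind_second:
  assumes "surely f D A (\<lambda>r. \<forall>a. r = Some a \<longrightarrow> prob_some f D (k a) P \<le> c)" "0 \<le> c"
  shows "prob_some f D (obind A k) P \<le> c"
  using prob_some_obind[of f D A "\<lambda>_. False" k P c] assms by simp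

lemma prob_some_Union:
  assumes "finite R"
  shows "prob_some f D A (\<lambda>a. \<exists>r\<in>R. P r a) \<le> (\<Sum>r\<in>R. prob_some f D A (P r))"
  using assms
proof (induction R rule: finite_induct)
  case (insert r R)
  have "prob_some f D A (\<lambda>a. \<exists>r\<in>insert r R. P r a)
      \<le> prob_some f D A (P r) + prob_some f D A (\<lambda>a. \<exists>r\<in>R. P r a)"
    by (rule prob_some_union) simp
  also have "\<dots> \<le> prob_some f D A (P r) + (\<Sum>r\<in>R. prob_some f D A (P r))"
    using insert.IH by simp
  finally show ?case using insert.hyps by simp
qed simp

text \<open>Postconditions of the query analysis hold on every path, hence on the support of every
  run. This supplies \<open>length L \<le> s\<close> for functions outside the class, where no junta
  argument is available.\<close>

lemma outputs_le_surely:
  assumes "set_pmf D \<subseteq> cube n"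
  shows "outputs_le n A q P \<Longrightarrow> surely f D A P"
proof (induction A arbitrary: q)
  case (Random p k)
  then show ?case by (fastforce simp: surely_def)
next
  case (Sample k)
  then show ?case using assms by fastforce
qed auto

text \<open>The search stops at a list only after \<open>m\<close> fresh probes have seen no
  difference, which for a bad list happens with probability at most \<open>(1 - \<eta>) ^ m\<close>.
  There are at most \<open>k\<close> occasions to stop.\<close>

lemma find_blocks_sound:
  assumes "0 \<le> \<eta>" "\<eta> \<le> 1"
  shows "prob_some f D (find_blocks n m d \<pi> k L)
    (\<lambda>L'. \<eta> \<le> measure_pmf.prob D {x. f x \<noteq> f (keep n \<pi> (blocks L') x)}) \<le> k * (1 - \<eta>) ^ m"
proof (induction k arbitrary: L)
  case (Suc k)
  let ?bad = "\<lambda>L'. \<eta> \<le> measure_pmf.prob D {x. f x \<noteq> f (keep n \<pi> (blocks L') x)}"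
  let ?same = "\<lambda>(x :: point, b :: bool, c). b = c"
  have nonneg: "0 \<le> real k * (1 - \<eta>) ^ m" using assms by simp
  \<comment> \<open>With \<open>?bad L\<close> inside the event, a good \<open>L\<close> makes it
    impossible, and one bound serves both kinds of lists.\<close>
  have first: "prob_some f D (for_list (\<lambda>_. probe n \<pi> (blocks L)) [0..<m])
      (\<lambda>ps. ?bad L \<and> (\<forall>p\<in>set ps. ?same p)) \<le> (1 - \<eta>) ^ m"
  proof (cases "?bad L")
    case True
    have "prob_some f D (probe n \<pi> (blocks L)) ?same = measure_pmf.prob D {x. f x = f (keep n \<pi> (blocks L) x)}"
      by (simp add: probe_def prob_some_sample flip: expectation_of_bool)
    also have "\<dots> = 1 - measure_pmf.prob D {x. f x \<noteq> f (keep n \<pi> (blocks L) x)}"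
      using prob_not[of D "\<lambda>x. f x \<noteq> f (keep n \<pi> (blocks L) x)"] by simp
    also have "\<dots> \<le> 1 - \<eta>" using True by simp
    finally have "prob_some f D (for_list (\<lambda>_. probe n \<pi> (blocks L)) [0..<m])
      (\<lambda>ps. \<forall>p\<in>set ps. ?same p) \<le> (1 - \<eta>) ^ length [0..<m]"
      using assms by (intro prob_some_for_list) auto
    then show ?thesis using True by simp
  next
    case False
    then show ?thesis using assms by simp
  qed
  have rest: "prob_some f D (case find (\<lambda>(x, b, c). b \<noteq> c) ps of
        None \<Rightarrow> Return (Some L)
      | Some (x, b, c) \<Rightarrow>
          obind (bsearch (\<lambda>t. keep n \<pi> (blocks L \<union> {t..}) x) d 0 b) (\<lambda>t.
            find_blocks n m d \<pi> k ((t, keep n \<pi> (blocks L \<union> {t..}) x) # L))) ?bad \<le> k * (1 - \<eta>) ^ m"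
    if ps: "\<not> (?bad L \<and> (\<forall>p\<in>set ps. ?same p))" for ps
  proof (cases "find (\<lambda>(x, b, c). b \<noteq> c) ps")
    case None
    have "\<forall>p\<in>set ps. ?same p"
    proof
      fix p assume "p \<in> set ps"
      then have "\<not> (case p of (x, b, c) \<Rightarrow> b \<noteq> c)" using None unfolding find_None_iff by blast
      then show "?same p" by (cases p) simp
    qed
    then have "\<not> ?bad L" using ps by blast
    then show ?thesis unfolding None using nonneg by simp
  next
    case (Some p)
    obtain x b c where p: "p = (x, b, c)" by (cases p) auto
    have "prob_some f D (obind (bsearch (\<lambda>t. keep n \<pi> (blocks L \<union> {t..}) x) d 0 b) (\<lambda>t.
            find_blocks n m d \<pi> k ((t, keep n \<pi> (blocks L \<union> {t..}) x) # L))) ?bad \<le> k * (1 - \<eta>) ^ m"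
      by (rule prob_some_obind_second[OF _ nonneg]) (unfold surely_def, intro ballI allI impI Suc.IH)
    then show ?thesis unfolding Some p by simp
  qed
  have "prob_some f D (find_blocks n m d \<pi> (Suc k) L) ?bad
      \<le> prob_some f D (for_list (\<lambda>_. probe n \<pi> (blocks L)) [0..<m])
          (\<lambda>ps. ?bad L \<and> (\<forall>p\<in>set ps. ?same p)) + k * (1 - \<eta>) ^ m"
    unfolding find_blocks.simps
    by (rule prob_some_obind[OF _ nonneg], unfold surely_def, intro ballI allI impI, rule rest)
  with first show ?case by (simp add: algebra_simps)
qed simp

text \<open>For a far \<open>f\<close> the coordinate \<open>\<tau>\<close> is whatever the dictator
  test commits to. The clause \<open>\<pi> ! \<tau> = fst p\<close> gives different blocks different
  coordinates, on which the uniform case rests.\<close>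

definition literal_like :: "bool_fun \<Rightarrow> nat \<Rightarrow> nat list \<Rightarrow> nat \<times> point \<Rightarrow> nat \<Rightarrow> bool" where
  "literal_like f n \<pi> p \<tau> \<longleftrightarrow> \<tau> < n \<and> \<pi> ! \<tau> = fst p \<and>
     (\<forall>u\<in>cube n. avg n (\<lambda>w. of_bool (delta n (\<lambda>v. f (plug n \<pi> p v)) w u \<noteq> u ! \<tau>)) \<le> 1 / 3)"

lemma avg_compl: "avg n (\<lambda>x. 1 - \<phi> x) = 1 - avg n \<phi>"
  using avg_add[of n "\<lambda>x. 1 - \<phi> x" \<phi>] by simp

lemma avg_avg:
  "avg s (\<lambda>z. avg n (\<lambda>x. \<phi> z x)) = (\<Sum>zx\<in>cube s \<times> cube n. \<phi> (fst zx) (snd zx)) / (2 ^ s * 2 ^ n)"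
  by (simp add: avg_def sum.cartesian_product case_prod_beta mult.commute flip: sum_divide_distrib)

lemma prob_some_dict_round:
  "prob_some f D (dict_round n \<pi> p) (\<lambda>_. True) =
    avg n (\<lambda>u. avg n (\<lambda>v. avg n (\<lambda>w. avg n (\<lambda>w'.
      of_bool (dictator_check n (\<lambda>v. f (plug n \<pi> p v)) u v w w')))))"
  unfolding dict_round_def Let_def prob_some_rand expectation_cube prob_some_query prob_some_return
  by (intro avg_cong arg_cong[of _ _ of_bool]) (simp add: dictator_check_def delta_def)

lemma dict_round_sound:
  assumes "29 / 30 < prob_some f D (dict_round n \<pi> p) (\<lambda>_. True)"
  shows "\<exists>\<tau>. literal_like f n \<pi> p \<tau>"
proof -
  let ?g = "\<lambda>v. f (plug n \<pi> p v)"
  have "avg n (\<lambda>u. avg n (\<lambda>v. avg n (\<lambda>w. avg n (\<lambda>w'.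
      of_bool (\<not> dictator_check n ?g u v w w'))))) < 1 / 30"
    using assms unfolding prob_some_dict_round of_bool_not_iff avg_compl by simp
  then obtain \<tau> where \<tau>: "\<tau> < n"
      "\<And>u. u \<in> cube n \<Longrightarrow> avg n (\<lambda>w. of_bool (delta n ?g w u \<noteq> u ! \<tau>)) \<le> 1 / 3"
    by (rule dictator_test_sound) (rule that)
  \<comment> \<open>Flipping a coordinate outside the block leaves the plugged function unchanged,
    yet \<open>delta\<close> at the unit vector of \<open>\<tau>\<close> should mostly be
    true.\<close>
  have "\<pi> ! \<tau> = fst p"
  proof (rule ccontr)
    assume "\<pi> ! \<tau> \<noteq> fst p"
    let ?e = "tab n (\<lambda>j. j = \<tau>)"
    have "plug n \<pi> p (xorp n w ?e) = plug n \<pi> p w" for w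
      by (rule cube_eqI[where n = n]) (use \<open>\<pi> ! \<tau> \<noteq> fst p\<close> in auto)
    then have "avg n (\<lambda>w. of_bool (delta n ?g w ?e \<noteq> ?e ! \<tau>)) = 1"
      using \<tau>(1) by (simp add: delta_def)
    with \<tau>(2)[of ?e] show False by simp
  qed
  with \<tau> show ?thesis unfolding literal_like_def by blast
qed

lemma dict_tests_sound:
  assumes "p \<in> set L" "\<nexists>\<tau>. literal_like f n \<pi> p \<tau>"
  shows "prob_some f D (dict_tests n K \<pi> L) (\<lambda>_. True) \<le> (29 / 30) ^ K"
proof -
  have round: "prob_some f D (dict_round n \<pi> p) (\<lambda>_. True) \<le> 29 / 30"
    using dict_round_sound assms(2) not_le by blast
  have "prob_some f D (for_list (\<lambda>_. dict_round n \<pi> p) [0..<K]) (\<lambda>as. \<forall>a\<in>set as. True) \<le> (29 / 30) ^ length [0..<K]"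
    by (rule prob_some_for_list[OF round]) simp
  with prob_some_for_list_member[OF assms(1), of f D "\<lambda>p. for_list (\<lambda>_. dict_round n \<pi> p) [0..<K]"]
  show ?thesis unfolding dict_tests_def by simp
qed

lemma val_sound:
  assumes \<tau>: "literal_like f n \<pi> p \<tau>" and x: "x \<in> cube n"
  shows "prob_some f D (val n t \<pi> p x) (\<lambda>b. b \<noteq> x ! \<tau>) \<le> (1 / 3) ^ t"
proof -
  let ?A = "rand (pmf_of_set (cube n)) (\<lambda>w. Query (plug n \<pi> p (xorp n w x)) (\<lambda>b.
      Query (plug n \<pi> p w) (\<lambda>c. Return (Some (b \<noteq> c)))))"
  have "prob_some f D ?A (\<lambda>b. b \<noteq> x ! \<tau>) =
      avg n (\<lambda>w. of_bool (delta n (\<lambda>v. f (plug n \<pi> p v)) w x \<noteq> x ! \<tau>))"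
    unfolding prob_some_rand expectation_cube prob_some_query prob_some_return delta_def
    by (intro avg_cong arg_cong[of _ _ of_bool]) simp
  also have "\<dots> \<le> 1 / 3" using \<tau> x by (simp add: literal_like_def)
  finally have "prob_some f D (for_list (\<lambda>_. ?A) [0..<t]) (\<lambda>bs. \<forall>b\<in>set bs. b \<noteq> x ! \<tau>) \<le> (1 / 3) ^ length [0..<t]"
    by (intro prob_some_for_list) auto
  moreover have "prob_some f D (val n t \<pi> p x) (\<lambda>b. b \<noteq> x ! \<tau>)
      \<le> prob_some f D (for_list (\<lambda>_. ?A) [0..<t]) (\<lambda>bs. \<forall>b\<in>set bs. b \<noteq> x ! \<tau>) + 0"
    unfolding val_def
  proof (rule prob_some_obind)
    have "prob_some f D (Return (if \<forall>b\<in>set bs. b = hd bs then Some (hd bs) else None)) (\<lambda>b. b \<noteq> x ! \<tau>) \<le> 0"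
      if "\<not> (\<forall>b\<in>set bs. b \<noteq> x ! \<tau>)" for bs
    proof (cases "\<forall>b\<in>set bs. b = hd bs")
      case True
      from that obtain b where "b \<in> set bs" "b = x ! \<tau>" by blast
      with True have "hd bs = x ! \<tau>" by blast
      then show ?thesis unfolding if_P[OF True] by simp
    next
      case False
      then show ?thesis unfolding if_not_P[OF False] by simp
    qed
    then show "surely f D (for_list (\<lambda>_. ?A) [0..<t]) (\<lambda>r. \<forall>bs. r = Some bs \<longrightarrow>
        \<not> (\<forall>b\<in>set bs. b \<noteq> x ! \<tau>) \<longrightarrow> prob_some f D
          (Return (if \<forall>b\<in>set bs. b = hd bs then Some (hd bs) else None)) (\<lambda>b. b \<noteq> x ! \<tau>) \<le> 0)"
      unfolding surely_def by blast
  qed simp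
  ultimately show ?thesis by simp
qed

text \<open>The point that \<open>vals\<close> returns when no value is wrong. As a substitution, it
  makes \<open>h\<close> composed with it a member of \<open>C n s\<close> by
  \<open>subst_closed\<close>.\<close>

definition decode :: "nat \<Rightarrow> (nat \<times> point \<Rightarrow> nat) \<Rightarrow> (nat \<times> point) list \<Rightarrow> point \<Rightarrow> point" where
  "decode s \<tau> L = subst s (\<lambda>l. if l < length L then Some (\<tau> (L ! l)) else None)"

lemma decode_in_cube [simp]: "decode s \<tau> L x \<in> cube s"
  by (simp add: decode_def)

locale decodable =
  fixes n s :: nat and f :: bool_fun and \<pi> :: "nat list" and L :: "(nat \<times> point) list"
    and \<tau> :: "nat \<times> point \<Rightarrow> nat" and D :: "point pmf"
  assumes lit: "p \<in> set L \<Longrightarrow> literal_like f n \<pi> p (\<tau> p)"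
    and len: "length L \<le> s"
    and D: "set_pmf D \<subseteq> cube n"
begin

lemma vals_sound:
  assumes x: "x \<in> cube n"
  shows "prob_some f D (vals n s t \<pi> L x) (\<lambda>z. z \<noteq> decode s \<tau> L x) \<le> s * (1 / 3) ^ t"
proof -
  have "prob_some f D (vals n s t \<pi> L x) (\<lambda>z. z \<noteq> decode s \<tau> L x)
      \<le> prob_some f D (for_list (\<lambda>p. val n t \<pi> p x) L) (\<lambda>ys. \<not> list_all2 (\<lambda>p b. b = x ! \<tau> p) L ys) + 0"
    unfolding vals_def
  proof (rule prob_some_obind)
    have "tab s (\<lambda>l. l < length ys \<and> ys ! l) = decode s \<tau> L x" if "list_all2 (\<lambda>p b. b = x ! \<tau> p) L ys" for ys
      using that by (intro cube_eqI[where n = s]) (auto simp: list_all2_conv_all_nth decode_def nth_subst)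
    then show "surely f D (for_list (\<lambda>p. val n t \<pi> p x) L) (\<lambda>r. \<forall>ys. r = Some ys \<longrightarrow>
        \<not> \<not> list_all2 (\<lambda>p b. b = x ! \<tau> p) L ys \<longrightarrow>
        prob_some f D (Return (Some (tab s (\<lambda>l. l < length ys \<and> ys ! l)))) (\<lambda>z. z \<noteq> decode s \<tau> L x) \<le> 0)"
      by (simp add: surely_def)
  qed simp
  also have "\<dots> \<le> length L * (1 / 3) ^ t + 0"
  proof (rule add_right_mono, rule prob_some_for_list_bad)
    show "prob_some f D (val n t \<pi> p x) (\<lambda>b. b \<noteq> x ! \<tau> p) \<le> (1 / 3) ^ t" if "p \<in> set L" for p
      by (rule val_sound[OF lit[OF that] x])
  qed simp
  also have "\<dots> \<le> s * (1 / 3) ^ t" using len by (simp add: divide_right_mono power_one_over)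
  finally show ?thesis .
qed

lemma agree_round_sound:
  "prob_some f D (agree_round n s t \<pi> L) (\<lambda>_. True)
    \<le> measure_pmf.prob D {x. f (keep n \<pi> (blocks L) x) = f (subst n (block_of \<pi> L) (decode s \<tau> L x))}
      + s * (1 / 3) ^ t"
  unfolding agree_round_def prob_some_sample
proof (rule expectation_le_prob_add)
  fix x assume "x \<in> set_pmf D"
    "x \<notin> {x. f (keep n \<pi> (blocks L) x) = f (subst n (block_of \<pi> L) (decode s \<tau> L x))}"
  then have x: "x \<in> cube n" "f (keep n \<pi> (blocks L) x) \<noteq> f (subst n (block_of \<pi> L) (decode s \<tau> L x))"
    using D by auto
  have "prob_some f D (obind (vals n s t \<pi> L x) (\<lambda>z. Query (keep n \<pi> (blocks L) x)
      (\<lambda>b. Query (subst n (block_of \<pi> L) z) (\<lambda>c. Return (if b = c then Some () else None))))) (\<lambda>_. True)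
    \<le> prob_some f D (vals n s t \<pi> L x) (\<lambda>z. z \<noteq> decode s \<tau> L x) + 0"
    by (rule prob_some_obind) (use x(2) in \<open>simp_all add: surely_def\<close>)
  also have "\<dots> \<le> s * (1 / 3) ^ t + 0"
    by (intro add_right_mono vals_sound x)
  finally show "prob_some f D (obind (vals n s t \<pi> L x) (\<lambda>z. Query (keep n \<pi> (blocks L) x)
      (\<lambda>b. Query (subst n (block_of \<pi> L) z) (\<lambda>c. Return (if b = c then Some () else None))))) (\<lambda>_. True)
    \<le> s * (1 / 3) ^ t" by simp
qed auto

lemma sampled_points_sound:
  "prob_some f D (sampled_points n s t \<pi> L) E \<le> measure_pmf.prob D {x. E (decode s \<tau> L x)} + s * (1 / 3) ^ t"
  unfolding sampled_points_def prob_some_sample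
proof (rule expectation_le_prob_add)
  fix x assume "x \<in> set_pmf D" "x \<notin> {x. E (decode s \<tau> L x)}"
  then have x: "x \<in> cube n" "\<not> E (decode s \<tau> L x)" using D by auto
  have "prob_some f D (vals n s t \<pi> L x) E \<le> prob_some f D (vals n s t \<pi> L x) (\<lambda>z. z \<noteq> decode s \<tau> L x)"
    by (rule prob_some_mono) (use x(2) in \<open>auto simp: surely_def\<close>)
  also have "\<dots> \<le> s * (1 / 3) ^ t" by (rule vals_sound[OF x(1)])
  finally show "prob_some f D (vals n s t \<pi> L x) E \<le> s * (1 / 3) ^ t" .
qed auto

text \<open>Exchanging the first \<open>length L\<close> bits of \<open>z\<close> with the bits \<open>\<tau> (L ! l)\<close> of \<open>x\<close> preserves the
  uniform distribution of \<open>(z, x)\<close> and turns the padded \<open>z\<close> into the decoding of \<open>x\<close>.\<close>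

lemma uniform_points_sound:
  assumes "distinct (map fst L)"
  shows "prob_some f D' (uniform_points s \<pi> L) E =
    measure_pmf.prob (pmf_of_set (cube n)) {x. E (decode s \<tau> L x)}"
proof -
  let ?q = "length L"
  define T where "T l = \<tau> (L ! l)" for l
  have T: "T l < n" "\<pi> ! T l = fst (L ! l)" if "l < ?q" for l
    using lit[of "L ! l"] that by (auto simp: T_def literal_like_def)
  have T_inj: "l = l'" if "l < ?q" "l' < ?q" "T l = T l'" for l l'
    using T(2)[of l] T(2)[of l'] that assms by (auto simp: distinct_conv_nth)
  define R where "R j = (THE l. l < ?q \<and> T l = j)" for j
  have R: "R (T l) = l" if "l < ?q" for l
    unfolding R_def using that T_inj by (intro the_equality) auto
  define pad where "pad z = tab s (\<lambda>l. l < ?q \<and> z ! l)" for z :: point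
  define sw where "sw zx = (tab s (\<lambda>l. if l < ?q then snd zx ! T l else fst zx ! l),
    tab n (\<lambda>j. if \<exists>l<?q. T l = j then fst zx ! R j else snd zx ! j))" for zx :: "point \<times> point"
  have sw_in: "fst (sw zx) \<in> cube s" "snd (sw zx) \<in> cube n" for zx
    by (simp_all add: sw_def)
  have sw_fst: "fst (sw zx) ! l = (if l < ?q then snd zx ! T l else fst zx ! l)" if "l < s" for zx l
    using that by (simp add: sw_def)
  have sw_snd: "snd (sw zx) ! j = (if \<exists>l<?q. T l = j then fst zx ! R j else snd zx ! j)" if "j < n" for zx j
    unfolding sw_def using that by (simp only: snd_conv nth_map_upt add_0_left diff_zero)
  have sw_sw: "sw (sw zx) = zx" if "zx \<in> cube s \<times> cube n" for zx
  proof (rule prod_eqI)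
    show "fst (sw (sw zx)) = fst zx"
    proof (rule cube_eqI[OF sw_in(1)])
      show "fst zx \<in> cube s" using that by auto
      fix l assume "l < s"
      show "fst (sw (sw zx)) ! l = fst zx ! l"
      proof (cases "l < ?q")
        case True
        then have "\<exists>l'<?q. T l' = T l" by blast
        then have "snd (sw zx) ! T l = fst zx ! R (T l)"
          unfolding sw_snd[OF T(1)[OF True]] by (rule if_P)
        then show ?thesis unfolding sw_fst[OF \<open>l < s\<close>] R[OF True] using True by simp
      qed (simp add: sw_fst[OF \<open>l < s\<close>])
    qed
    show "snd (sw (sw zx)) = snd zx"
    proof (rule cube_eqI[OF sw_in(2)])
      show "snd zx \<in> cube n" using that by auto
      fix j assume j: "j < n"
      show "snd (sw (sw zx)) ! j = snd zx ! j"
      proof (cases "\<exists>l<?q. T l = j")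
        case True
        then obtain l where l: "l < ?q" "T l = j" by blast
        have "snd (sw (sw zx)) ! j = fst (sw zx) ! R j"
          unfolding sw_snd[OF j] by (rule if_P[OF True])
        also have "R j = l" using R[OF l(1)] l(2) by simp
        \<comment> \<open>\<open>length L \<le> s\<close> ensures that every coordinate
          \<open>T l\<close> of \<open>x\<close> has a partner among the \<open>s\<close> bits of
          \<open>z\<close>.\<close>
        also have "fst (sw zx) ! l = snd zx ! j"
          using sw_fst[of l zx] l len by simp
        finally show ?thesis .
      next
        case False
        show ?thesis unfolding sw_snd[OF j] if_not_P[OF False] ..
      qed
    qed
  qed
  have bij: "bij_betw sw (cube s \<times> cube n) (cube s \<times> cube n)"
    by (rule bij_betwI[where g = sw]) (auto simp: sw_sw mem_Times_iff sw_in)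
  have pad_sw: "pad (fst (sw (z, x))) = decode s \<tau> L x" for z x
    by (rule cube_eqI[where n = s]) (auto simp: pad_def sw_def decode_def nth_subst T_def)
  have "prob_some f D' (uniform_points s \<pi> L) E = avg s (\<lambda>z. of_bool (E (pad z)))"
    unfolding uniform_points_def prob_some_rand expectation_cube by (simp add: pad_def)
  \<comment> \<open>A dummy average over \<open>x\<close> provides the pair on which the exchange
    acts; after it, \<open>z\<close> is the dummy.\<close>
  also have "\<dots> = avg s (\<lambda>z. avg n (\<lambda>x. of_bool (E (pad z))))" by simp
  also have "\<dots> = (\<Sum>zx\<in>cube s \<times> cube n. of_bool (E (pad (fst zx)))) / (2 ^ s * 2 ^ n)"
    by (rule avg_avg)
  also have "(\<Sum>zx\<in>cube s \<times> cube n. of_bool (E (pad (fst zx)))) =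
      (\<Sum>zx\<in>cube s \<times> cube n. of_bool (E (pad (fst (sw zx)))) :: real)"
    by (rule sum.reindex_bij_betw[OF bij, symmetric])
  also have "\<dots> = (\<Sum>zx\<in>cube s \<times> cube n. of_bool (E (decode s \<tau> L (snd zx))))"
    by (intro sum.cong refl arg_cong[of _ _ of_bool]) (metis pad_sw prod.collapse)
  also have "\<dots> / (2 ^ s * 2 ^ n) = avg s (\<lambda>z. avg n (\<lambda>x. of_bool (E (decode s \<tau> L x))))"
    by (rule avg_avg[symmetric])
  also have "\<dots> = avg n (\<lambda>x. of_bool (E (decode s \<tau> L x)))" by simp
  finally show ?thesis by (simp add: expectation_of_bool flip: expectation_cube)
qed

text \<open>\<open>H\<close> may be infinite, since its members are arbitrary outside the cube. The
  union bound therefore runs over their restrictions, which loses nothing because all points drawn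
  lie in \<open>cube s\<close>.\<close>

lemma consistency_sound:
  assumes Z: "\<And>E. prob_some f D Z E \<le> measure_pmf.prob D {x. E (decode s \<tau> L x)} + \<gamma>"
    and Zs: "surely f D Z (\<lambda>r. \<forall>z. r = Some z \<longrightarrow> z \<in> cube s)"
    and far: "\<And>h. h \<in> H \<Longrightarrow> measure_pmf.prob D
      {x. h (decode s \<tau> L x) = f (subst n (block_of \<pi> L) (decode s \<tau> L x))} + \<gamma> \<le> \<beta>"
    and N: "finite ((\<lambda>h. restrict h (cube s)) ` H)" "card ((\<lambda>h. restrict h (cube s)) ` H) \<le> N"
    and \<beta>: "0 \<le> \<beta>"
  shows "prob_some f D (consistency H n m \<pi> L Z) (\<lambda>_. True) \<le> N * \<beta> ^ m"
proof -
  let ?F = "\<lambda>z. f (subst n (block_of \<pi> L) z)"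
  let ?S = "labelled_samples n m \<pi> L Z"
  let ?A = "obind Z (\<lambda>z. Query (subst n (block_of \<pi> L) z) (\<lambda>c. Return (Some (z, c))))"
  let ?R = "(\<lambda>h. restrict h (cube s)) ` H"
  have each: "prob_some f D ?S (\<lambda>zs. \<forall>zc\<in>set zs. r (fst zc) = snd zc) \<le> \<beta> ^ m" if r: "r \<in> ?R" for r
  proof -
    from r obtain h where h: "h \<in> H" "r = restrict h (cube s)" by blast
    have "prob_some f D ?A (\<lambda>zc. r (fst zc) = snd zc) \<le> prob_some f D Z (\<lambda>z. r z = ?F z) + 0"
      by (rule prob_some_obind) (simp_all add: surely_def)
    also have "\<dots> \<le> measure_pmf.prob D {x. r (decode s \<tau> L x) = ?F (decode s \<tau> L x)} + \<gamma>"
      using Z[of "\<lambda>z. r z = ?F z"] by simp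
    also have "\<dots> = measure_pmf.prob D {x. h (decode s \<tau> L x) = ?F (decode s \<tau> L x)} + \<gamma>"
      by (simp add: h(2))
    also have "\<dots> \<le> \<beta>" by (rule far[OF h(1)])
    finally have "prob_some f D ?S (\<lambda>zs. \<forall>zc\<in>set zs. r (fst zc) = snd zc) \<le> \<beta> ^ length [0..<m]"
      unfolding labelled_samples_def by (intro prob_some_for_list \<beta>)
    then show ?thesis by simp
  qed
  have in_cube: "surely f D ?S (\<lambda>r. \<forall>zs. r = Some zs \<longrightarrow> (\<forall>zc\<in>set zs. fst zc \<in> cube s))"
  proof -
    have A: "surely f D ?A (\<lambda>r. \<forall>zc. r = Some zc \<longrightarrow> fst zc \<in> cube s)"
      unfolding obind_def surely_abind
      by (rule surely_mono[OF Zs]) (auto split: option.splits)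
    have "surely f D (for_list (\<lambda>_. ?A) xs) (\<lambda>r. \<forall>zs. r = Some zs \<longrightarrow> (\<forall>zc\<in>set zs. fst zc \<in> cube s))"
      for xs :: "nat list"
    proof (induction xs)
      case (Cons y xs)
      show ?case
        unfolding for_list.simps unfolding obind_def[of ?A] surely_abind
      proof (rule surely_mono[OF A])
        fix r :: "(point \<times> bool) option"
        assume r: "\<forall>zc. r = Some zc \<longrightarrow> fst zc \<in> cube s"
        show "surely f D (case r of None \<Rightarrow> Return None
            | Some a \<Rightarrow> obind (for_list (\<lambda>_. ?A) xs) (\<lambda>as. Return (Some (a # as))))
          (\<lambda>r. \<forall>zs. r = Some zs \<longrightarrow> (\<forall>zc\<in>set zs. fst zc \<in> cube s))"
        proof (cases r)
          case (Some a)
          then have a: "fst a \<in> cube s" using r by blast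
          show ?thesis unfolding Some option.case unfolding obind_def[of "for_list (\<lambda>_. ?A) xs"] surely_abind
            by (rule surely_mono[OF Cons.IH]) (use a in \<open>auto split: option.splits\<close>)
        qed simp
      qed
    qed simp
    then show ?thesis unfolding labelled_samples_def .
  qed
  have "prob_some f D (consistency H n m \<pi> L Z) (\<lambda>_. True)
      \<le> prob_some f D ?S (\<lambda>zs. \<exists>h\<in>H. \<forall>(z, c)\<in>set zs. h z = c) + 0"
    unfolding consistency_def
  proof (rule prob_some_obind, unfold surely_def, intro ballI allI impI)
    fix r and zs :: "(point \<times> bool) list"
    assume no: "\<not> (\<exists>h\<in>H. \<forall>(z, c)\<in>set zs. h z = c)"
    show "prob_some f D (Return (if \<exists>h\<in>H. \<forall>(z, c)\<in>set zs. h z = c then Some () else None)) (\<lambda>_. True) \<le> 0"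
      unfolding if_not_P[OF no] by simp
  qed simp
  also have "\<dots> \<le> prob_some f D ?S (\<lambda>zs. \<exists>r\<in>?R. \<forall>zc\<in>set zs. r (fst zc) = snd zc) + 0"
  proof (intro add_right_mono prob_some_mono, rule surely_mono[OF in_cube], intro allI impI)
    fix r zs
    assume *: "\<forall>zs. r = Some zs \<longrightarrow> (\<forall>zc\<in>set zs. fst zc \<in> cube s)" "r = Some zs"
      "\<exists>h\<in>H. \<forall>(z, c)\<in>set zs. h z = c"
    then obtain h where h: "h \<in> H" "\<forall>zc\<in>set zs. h (fst zc) = snd zc" by (auto simp: case_prod_beta)
    have "\<forall>zc\<in>set zs. restrict h (cube s) (fst zc) = snd zc"
      using *(1,2) h(2) by simp
    with h(1) show "\<exists>r\<in>?R. \<forall>zc\<in>set zs. r (fst zc) = snd zc" by blast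
  qed
  also have "\<dots> \<le> (\<Sum>r\<in>?R. prob_some f D ?S (\<lambda>zs. \<forall>zc\<in>set zs. r (fst zc) = snd zc))"
    unfolding add_0_right by (rule prob_some_Union[OF N(1)])
  also have "\<dots> \<le> (\<Sum>r\<in>?R. \<beta> ^ m)"
    by (intro sum_mono each)
  also have "\<dots> \<le> N * \<beta> ^ m"
    using N(2) \<beta> by (simp add: mult_right_mono)
  finally show ?thesis .
qed

end

text \<open>After a block search that ended well, one stage is responsible for rejection: the
  dictator tests if some block is not literal-like, the agreement rounds if decoding changes
  \<open>f\<close> on the kept blocks too often, and otherwise the fit. Decoding errors take at most
  half of a margin of \<open>\<epsilon> / 3\<close>.\<close>

lemma test_core_sound:
  assumes C: "concise_class C" and D: "set_pmf D \<subseteq> cube n" and \<pi>: "\<pi> \<in> partitions n (2 ^ d)"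
    and pos: "0 < n" "1 \<le> s" and \<epsilon>: "0 < \<epsilon>" "\<epsilon> \<le> 1"
    and far: "far_from \<epsilon> D (C n s) f"
    and Z: "\<And>L \<tau> E. decodable n s f \<pi> L \<tau> D \<Longrightarrow> distinct (map fst L) \<Longrightarrow>
      prob_some f D (Z \<pi> L) E \<le> measure_pmf.prob D {x. E (decode s \<tau> L x)} + s * (1 / 3) ^ t"
    and Zs: "\<And>L. length L \<le> s \<Longrightarrow> outputs_le n (Z \<pi> L) q (\<lambda>r. \<forall>z. r = Some z \<longrightarrow> z \<in> cube s)"
    and m: "real (Suc s) * (1 - \<epsilon> / 3) ^ m \<le> 1 / 6"
    and t: "real s * (1 / 3) ^ t \<le> \<epsilon> / 6"
    and mA: "(1 - \<epsilon> / 6) ^ mA \<le> 1 / 6"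
    and mB: "real ((s + 2) ^ (6 * s)) * (1 - \<epsilon> / 6) ^ mB \<le> 1 / 6"
  shows "prob_some f D (test_core (C s s) n s Z m d t mA mB \<pi>) (\<lambda>_. True) \<le> 1 / 3"
proof -
  interpret concise_class C by (rule C)
  let ?\<gamma> = "real s * (1 / 3) ^ t"
  let ?keep = "\<lambda>L x. f (keep n \<pi> (blocks L) x)"
  let ?rest = "\<lambda>L. obind (dict_tests n 75 \<pi> L) (\<lambda>_.
    obind (for_list (\<lambda>_. agree_round n s t \<pi> L) [0..<mA]) (\<lambda>_. consistency (C s s) n mB \<pi> L (Z \<pi> L)))"
  have rest: "prob_some f D (?rest L) (\<lambda>_. True) \<le> 1 / 6"
    if L: "witnessed f n \<pi> L" "length L \<le> s" "measure_pmf.prob D {x. f x \<noteq> ?keep L x} < \<epsilon> / 3" for L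
  proof (cases "\<exists>p\<in>set L. \<nexists>\<tau>. literal_like f n \<pi> p \<tau>")
    case True
    then obtain p where p: "p \<in> set L" "\<nexists>\<tau>. literal_like f n \<pi> p \<tau>" by blast
    have "prob_some f D (?rest L) (\<lambda>_. True) \<le> prob_some f D (dict_tests n 75 \<pi> L) (\<lambda>_. True)"
      by (rule prob_some_obind_first)
    also have "\<dots> \<le> (29 / 30) ^ 75" by (rule dict_tests_sound[OF p])
    \<comment> \<open>The number 75 does not grow with \<open>s\<close>: a single bad block has to
      be caught, without a union bound over blocks.\<close>
    also have "\<dots> \<le> 1 / 6" by (simp add: power_divide)
    finally show ?thesis .
  next
    case False
    then have "\<forall>p. \<exists>\<tau>. p \<in> set L \<longrightarrow> literal_like f n \<pi> p \<tau>" by blast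
    then obtain \<tau> where \<tau>: "\<forall>p. p \<in> set L \<longrightarrow> literal_like f n \<pi> p (\<tau> p)" by metis
    interpret decodable n s f \<pi> L \<tau> D
      by unfold_locales (use \<tau> L(2) D in auto)
    let ?F = "\<lambda>x. f (subst n (block_of \<pi> L) (decode s \<tau> L x))"
    show ?thesis
    proof (rule prob_some_obind_second)
      show "surely f D (dict_tests n 75 \<pi> L) (\<lambda>r. \<forall>a. r = Some a \<longrightarrow>
        prob_some f D (obind (for_list (\<lambda>_. agree_round n s t \<pi> L) [0..<mA])
          (\<lambda>_. consistency (C s s) n mB \<pi> L (Z \<pi> L))) (\<lambda>_. True) \<le> 1 / 6)"
      proof (cases "\<epsilon> / 3 \<le> measure_pmf.prob D {x. ?keep L x \<noteq> ?F x}")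
        case True
        have "prob_some f D (agree_round n s t \<pi> L) (\<lambda>_. True) \<le> measure_pmf.prob D {x. ?keep L x = ?F x} + ?\<gamma>"
          by (rule agree_round_sound)
        also have "\<dots> \<le> 1 - \<epsilon> / 6"
          using True t prob_not[of D "\<lambda>x. ?keep L x = ?F x"] by simp
        finally have "prob_some f D (for_list (\<lambda>_. agree_round n s t \<pi> L) [0..<mA]) (\<lambda>as. \<forall>a\<in>set as. True)
            \<le> (1 - \<epsilon> / 6) ^ length [0..<mA]"
          using \<epsilon> by (intro prob_some_for_list) auto
        then have "prob_some f D (for_list (\<lambda>_. agree_round n s t \<pi> L) [0..<mA]) (\<lambda>_. True) \<le> 1 / 6"
          using mA by simp
        with prob_some_obind_first show ?thesis
          unfolding surely_def by (blast intro: order_trans)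
      next
        case False
        have "measure_pmf.prob D {x. h (decode s \<tau> L x) = ?F x} + ?\<gamma> \<le> 1 - \<epsilon> / 6" if h: "h \<in> C s s" for h
        proof -
          \<comment> \<open>Closure from \<open>s\<close> to \<open>n\<close> variables asks for
            \<open>0 < n\<close>; hence the separate tester for \<open>n = 0\<close>.\<close>
          have "(\<lambda>x. h (decode s \<tau> L x)) \<in> C n s"
            unfolding decode_def
          proof (rule subst_closed[OF h pos(1)])
            fix l j assume "(if l < length L then Some (\<tau> (L ! l)) else None) = Some j"
            then have "l < length L" "j = \<tau> (L ! l)" by (auto split: if_splits)
            then show "j < n" using lit[of "L ! l"] by (simp add: literal_like_def)
          qed
          from bspec[OF far[unfolded far_from_def] this]
          have "\<epsilon> \<le> measure_pmf.prob D {x. f x \<noteq> h (decode s \<tau> L x)}" .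
          \<comment> \<open>Triangle inequality: the first two distances are below
            \<open>\<epsilon> / 3\<close>, so \<open>h\<close> and \<open>F\<close> differ with
            probability above \<open>\<epsilon> / 3\<close>, half of which absorbs the decoding
            error.\<close>
          also have "\<dots> \<le> measure_pmf.prob D ({x. f x \<noteq> ?keep L x} \<union> {x. ?keep L x \<noteq> ?F x}
              \<union> {x. \<not> h (decode s \<tau> L x) = ?F x})"
            by (rule measure_pmf.finite_measure_mono) auto
          also have "\<dots> \<le> measure_pmf.prob D {x. f x \<noteq> ?keep L x} + measure_pmf.prob D {x. ?keep L x \<noteq> ?F x}
              + measure_pmf.prob D {x. \<not> h (decode s \<tau> L x) = ?F x}"
            by (intro order_trans[OF measure_Un_le] add_right_mono measure_Un_le) auto
          finally have "\<epsilon> \<le> \<dots>" .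
          then show ?thesis
            using L(3) False t unfolding prob_not[of D "\<lambda>x. h (decode s \<tau> L x) = ?F x"] by linarith
        qed
        note far' = this
        have "prob_some f D (consistency (C s s) n mB \<pi> L (Z \<pi> L)) (\<lambda>_. True)
            \<le> real ((s + 2) ^ (6 * s)) * (1 - \<epsilon> / 6) ^ mB"
        proof (rule consistency_sound[OF Z _ far'])
          show "decodable n s f \<pi> L \<tau> D" by unfold_locales
          show "distinct (map fst L)" using L(1) by (simp add: witnessed_def)
          show "surely f D (Z \<pi> L) (\<lambda>r. \<forall>z. r = Some z \<longrightarrow> z \<in> cube s)"
            by (rule outputs_le_surely[OF D Zs[OF L(2)]])
          have "(\<lambda>h. restrict h (cube s)) ` C s s \<subseteq> cube s \<rightarrow>\<^sub>E UNIV" by auto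
          then show "finite ((\<lambda>h. restrict h (cube s)) ` C s s)"
            by (rule finite_subset) (simp add: finite_PiE)
          show "card ((\<lambda>h. restrict h (cube s)) ` C s s) \<le> (s + 2) ^ (6 * s)"
            by (rule count[OF pos(2)])
          show "0 \<le> 1 - \<epsilon> / 6" using \<epsilon> by simp
        qed
        also have "\<dots> \<le> 1 / 6" by (rule mB)
        finally have c: "prob_some f D (consistency (C s s) n mB \<pi> L (Z \<pi> L)) (\<lambda>_. True) \<le> 1 / 6" .
        have "prob_some f D (obind (for_list (\<lambda>_. agree_round n s t \<pi> L) [0..<mA])
            (\<lambda>_. consistency (C s s) n mB \<pi> L (Z \<pi> L))) (\<lambda>_. True) \<le> 1 / 6"
          by (rule prob_some_obind_second, unfold surely_def, intro ballI allI impI c) simp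
        then show ?thesis unfolding surely_def by blast
      qed
    qed simp
  qed
  let ?bad = "\<lambda>L. \<epsilon> / 3 \<le> measure_pmf.prob D {x. f x \<noteq> ?keep L x}"
  let ?find = "find_blocks n m d \<pi> (Suc s) []"
  have "witnessed f n \<pi> []" by (simp add: witnessed_def)
  then have w: "surely f D ?find (\<lambda>r. (\<forall>L. r = Some L \<longrightarrow> witnessed f n \<pi> L) \<and>
      ((\<forall>L. witnessed f n \<pi> L \<longrightarrow> length L < length ([] :: (nat \<times> point) list) + Suc s) \<longrightarrow> r \<noteq> None))"
    by (rule surely_find_blocks[OF D \<pi>])
  have len: "surely f D ?find (\<lambda>r. \<forall>L. r = Some L \<longrightarrow> length L < length ([] :: (nat \<times> point) list) + Suc s)"
    by (rule outputs_le_surely[OF D outputs_find_blocks])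
  have "prob_some f D (test_core (C s s) n s Z m d t mA mB \<pi>) (\<lambda>_. True)
      \<le> prob_some f D ?find ?bad + 1 / 6"
    unfolding test_core_def
  proof (rule prob_some_obind, unfold surely_def, intro ballI allI impI)
    fix r L assume r: "r \<in> set_pmf (run f D ?find)" "r = Some L" and "\<not> ?bad L"
    then have "witnessed f n \<pi> L" "length L \<le> s"
      using w len unfolding surely_def by auto
    then show "prob_some f D (?rest L) (\<lambda>_. True) \<le> 1 / 6"
      using \<open>\<not> ?bad L\<close> by (intro rest) auto
  qed simp
  also have "\<dots> \<le> real (Suc s) * (1 - \<epsilon> / 3) ^ m + 1 / 6"
    using \<epsilon> by (intro add_right_mono find_blocks_sound) auto
  also have "\<dots> \<le> 1 / 3" using m by simp
  finally show ?thesis .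
qed

subsection \<open>Parameters\<close>

text \<open>By \<open>1 - \<eta> \<le> exp (- \<eta>)\<close>, this many repetitions bring a miss
  probability of \<open>1 - \<eta>\<close> down to \<open>1 / y\<close>. With
  \<open>\<eta> = 1 / 2\<close> it also serves as an upper estimate of the binary logarithm of
  \<open>y\<close>, which fixes the number of blocks.\<close>

definition rounds :: "real \<Rightarrow> real \<Rightarrow> nat" where
  "rounds \<eta> y = nat \<lceil>ln y / \<eta>\<rceil>"

lemma rounds_power:
  assumes "0 < \<eta>" "\<eta> \<le> 1" "0 < y"
  shows "(1 - \<eta>) ^ rounds \<eta> y \<le> 1 / y"
proof -
  have "ln y / \<eta> \<le> rounds \<eta> y" unfolding rounds_def by (rule real_nat_ceiling_ge)
  then have "ln y \<le> rounds \<eta> y * \<eta>" using assms by (simp add: field_simps)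
  have "(1 - \<eta>) ^ rounds \<eta> y \<le> exp (- \<eta>) ^ rounds \<eta> y"
    using assms exp_ge_add_one_self[of "- \<eta>"] by (intro power_mono) auto
  also have "\<dots> = exp (- (rounds \<eta> y * \<eta>))"
    by (simp add: exp_of_nat_mult[symmetric])
  also have "\<dots> \<le> exp (- ln y)" using \<open>ln y \<le> rounds \<eta> y * \<eta>\<close> by simp
  also have "\<dots> = 1 / y" using assms by (simp add: exp_minus inverse_eq_divide)
  finally show ?thesis .
qed

lemma rounds_le:
  assumes "0 < \<eta>" "1 \<le> y"
  shows "rounds \<eta> y \<le> ln y / \<eta> + 1"
  using assms of_nat_nat[of "\<lceil>ln y / \<eta>\<rceil>"] unfolding rounds_def
  by (smt (verit) ceiling_correct divide_nonneg_pos ln_ge_zero of_nat_nat zero_le_ceiling)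

definition find_rounds :: "nat \<Rightarrow> real \<Rightarrow> nat" where
  "find_rounds s \<epsilon> = rounds (\<epsilon> / 3) (6 * (s + 1))"

definition depth :: "nat \<Rightarrow> nat" where
  "depth s = rounds (1 / 2) (3 * s ^ 2)"

text \<open>A self-corrected value is wrong with probability at most
  \<open>1 / 3 = 1 - 2 / 3\<close>. \<open>Suc\<close> makes positivity immediate:
  \<open>val\<close> must have an answer to return.\<close>

definition reps :: "nat \<Rightarrow> real \<Rightarrow> nat" where
  "reps s \<epsilon> = Suc (rounds (2 / 3) (6 * s / \<epsilon>))"

definition agree_rounds :: "real \<Rightarrow> nat" where
  "agree_rounds \<epsilon> = rounds (\<epsilon> / 6) 6"

definition fit_rounds :: "nat \<Rightarrow> real \<Rightarrow> nat" where
  "fit_rounds s \<epsilon> = rounds (\<epsilon> / 6) (6 * (s + 2) ^ (6 * s))"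

text \<open>1000 exceeds the totals \<open>622 + 43\<close> and \<open>622 + 344\<close> of the two
  cost estimates, and 3 bounds \<open>ln 12\<close>. The summand 1 makes the budget at least 1 for
  all \<open>T \<ge> 0\<close>, which settles the degenerate cases.\<close>

definition budget :: "real \<Rightarrow> real" where
  "budget T = 1000 * T * (ln T + 3) ^ 2 + 1"

lemma budget_soft_O: "budget \<in> soft_O"
proof -
  have "budget \<in> O(\<lambda>T. T * ln T ^ 2)"
  \<comment> \<open>\<open>4001 = 1000 * 2 ^ 2 + 1\<close>: once \<open>ln T \<ge> 3\<close>, the
    sum \<open>ln T + 3\<close> is at most \<open>2 * ln T\<close>.\<close>
  proof (rule bigoI[where c = 4001])
    show "\<forall>\<^sub>F T in at_top. norm (budget T) \<le> 4001 * norm (T * (ln T)\<^sup>2)"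
      using eventually_ge_at_top[of "exp (3 :: real)"]
    proof eventually_elim
      case (elim T)
      have "1 \<le> exp (3 :: real)" by simp
      then have T: "1 \<le> T" using elim by linarith
      have l: "3 \<le> ln T" using elim T by (simp add: ln_ge_iff)
      have "(ln T + 3) ^ 2 \<le> (2 * ln T) ^ 2" using l by (intro power_mono) auto
      then have "1000 * T * (ln T + 3) ^ 2 \<le> 1000 * T * (4 * (ln T) ^ 2)"
        using T by (intro mult_left_mono) (auto simp: power_mult_distrib)
      moreover have "1 * 1 \<le> T * (ln T) ^ 2"
        using T l by (intro mult_mono one_le_power) auto
      ultimately have "budget T \<le> 4001 * (T * (ln T) ^ 2)" by (simp add: budget_def)
      moreover have "0 \<le> budget T" using T by (simp add: budget_def)
      ultimately show ?case using T by simp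
    qed
  qed
  then show ?thesis unfolding soft_O_def by blast
qed

section \<open>Query bounds in terms of the budget\<close>

context
  fixes s :: nat and \<epsilon> \<Lambda> T :: real
  assumes s: "1 \<le> s" and \<epsilon>: "0 < \<epsilon>" "\<epsilon> \<le> 1" and T: "s / \<epsilon> \<le> T"
    and \<Lambda>: "\<Lambda> = ln T + 3"
begin

text \<open>After products and powers are split, every logarithm in the parameters has an argument
  of at most \<open>12 * T\<close>; the extreme case is \<open>6 * (s + 1)\<close>. As only
  \<open>s / \<epsilon> \<le> T\<close> is assumed, the estimates serve
  \<open>T = s / \<epsilon>\<close> and \<open>T = s ^ 2 / \<epsilon>\<close> alike.\<close>

lemma ln_le_\<Lambda>:
  assumes "0 < y" "y \<le> 12 * T"
  shows "ln y \<le> \<Lambda>"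
proof -
  have "0 < T" using assms by linarith
  have "(12 :: real) \<le> (5 / 2) ^ 3" by (simp add: power3_eq_cube)
  also have "(5 / 2) ^ 3 \<le> exp (1 :: real) ^ 3"
    by (rule power_mono) (use e_approx_32 in \<open>auto simp: abs_if split: if_splits\<close>)
  also have "\<dots> = exp 3" by (simp add: exp_of_nat_mult[symmetric])
  finally have "ln 12 \<le> ln (exp (3 :: real))" by (subst ln_le_cancel_iff) auto
  then have "ln 12 \<le> (3 :: real)" by simp
  have "ln y \<le> ln (12 * T)" using assms by simp
  also have "\<dots> = ln 12 + ln T" using \<open>0 < T\<close> by (simp add: ln_mult)
  finally show ?thesis using \<open>ln 12 \<le> 3\<close> \<Lambda> by simp
qed

lemma s_le_T: "real s \<le> T"
proof -
  have "real s * \<epsilon> \<le> real s * 1" using \<epsilon> by (intro mult_left_mono) auto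
  then have "real s \<le> s / \<epsilon>" using \<epsilon> by (simp add: field_simps)
  then show ?thesis using T by linarith
qed

lemma \<Lambda>_ge: "3 \<le> \<Lambda>"
  using s_le_T s \<Lambda> by simp

lemma \<Lambda>_le: "\<Lambda> \<le> \<Lambda> / \<epsilon>" "1 \<le> \<Lambda> / \<epsilon>"
proof -
  have "\<Lambda> * \<epsilon> \<le> \<Lambda> * 1" using \<epsilon> \<Lambda>_ge by (intro mult_left_mono) auto
  then show "\<Lambda> \<le> \<Lambda> / \<epsilon>" using \<epsilon> by (simp add: field_simps)
  then show "1 \<le> \<Lambda> / \<epsilon>" using \<Lambda>_ge by linarith
qed

lemma find_rounds_le: "find_rounds s \<epsilon> \<le> 4 * (\<Lambda> / \<epsilon>)"
proof -
  have "find_rounds s \<epsilon> \<le> ln (6 * (s + 1)) / (\<epsilon> / 3) + 1"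
    unfolding find_rounds_def using \<epsilon> by (intro rounds_le) auto
  also have "\<dots> \<le> \<Lambda> / (\<epsilon> / 3) + 1"
    using \<epsilon> s s_le_T by (intro add_right_mono divide_right_mono ln_le_\<Lambda>) auto
  also have "\<dots> = 3 * (\<Lambda> / \<epsilon>) + 1" by simp
  also have "\<dots> \<le> 4 * (\<Lambda> / \<epsilon>)" using \<Lambda>_le by linarith
  finally show ?thesis .
qed

lemma depth_le: "depth s \<le> 5 * \<Lambda>"
proof -
  have "1 \<le> real s ^ 2" using s by simp
  then have "depth s \<le> ln (3 * s ^ 2) / (1 / 2) + 1"
    unfolding depth_def by (intro rounds_le) auto
  moreover have "ln (3 * real s ^ 2) = ln (3 * s) + ln s"
    using s by (simp add: ln_mult power2_eq_square)
  moreover have "ln (3 * real s) + ln s \<le> \<Lambda> + \<Lambda>"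
    using s s_le_T by (intro add_mono ln_le_\<Lambda>) auto
  ultimately show ?thesis using \<Lambda>_ge by simp
qed

lemma reps_le: "reps s \<epsilon> \<le> 3 * \<Lambda>"
proof -
  have "1 \<le> s / \<epsilon>" using \<epsilon> s by (simp add: field_simps)
  then have "rounds (2 / 3) (6 * s / \<epsilon>) \<le> ln (6 * s / \<epsilon>) / (2 / 3) + 1"
    by (intro rounds_le) auto
  also have "\<dots> \<le> \<Lambda> / (2 / 3) + 1"
    using T \<open>1 \<le> s / \<epsilon>\<close> by (intro add_right_mono divide_right_mono ln_le_\<Lambda>) auto
  finally show ?thesis using \<Lambda>_ge by (simp add: reps_def)
qed

lemma agree_rounds_le: "agree_rounds \<epsilon> \<le> 7 * (\<Lambda> / \<epsilon>)"
proof -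
  have "agree_rounds \<epsilon> \<le> ln 6 / (\<epsilon> / 6) + 1"
    unfolding agree_rounds_def using \<epsilon> by (intro rounds_le) auto
  also have "\<dots> \<le> \<Lambda> / (\<epsilon> / 6) + 1"
    using \<epsilon> s s_le_T by (intro add_right_mono divide_right_mono ln_le_\<Lambda>) auto
  also have "\<dots> = 6 * (\<Lambda> / \<epsilon>) + 1" by simp
  also have "\<dots> \<le> 7 * (\<Lambda> / \<epsilon>)" using \<Lambda>_le by linarith
  finally show ?thesis .
qed

text \<open>The logarithm of the class size contributes \<open>6 * s * ln (s + 2)\<close>; this is
  the factor \<open>s\<close> in the number of fitted points.\<close>

lemma fit_rounds_le: "fit_rounds s \<epsilon> \<le> 43 * (s * (\<Lambda> / \<epsilon>))"
proof -
  let ?l = "ln (6 * (real s + 2) ^ (6 * s))"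
  have "1 * 1 \<le> 6 * (real s + 2) ^ (6 * s)" by (intro mult_mono one_le_power) auto
  then have le: "fit_rounds s \<epsilon> \<le> ?l / (\<epsilon> / 6) + 1"
    unfolding fit_rounds_def using \<epsilon> rounds_le[of "\<epsilon> / 6" "6 * (real s + 2) ^ (6 * s)"]
    by (simp add: add.commute)
  have "?l = ln 6 + 6 * s * ln (real s + 2)"
    by (simp add: ln_mult ln_realpow)
  also have "\<dots> \<le> \<Lambda> + 6 * s * \<Lambda>"
    using s s_le_T by (intro add_mono mult_left_mono ln_le_\<Lambda>) auto
  also have "\<dots> \<le> 7 * s * \<Lambda>"
    using s \<Lambda>_ge by (simp add: algebra_simps)
  finally have "?l / (\<epsilon> / 6) \<le> 7 * s * \<Lambda> / (\<epsilon> / 6)"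
    using \<epsilon> by (intro divide_right_mono) auto
  also have "\<dots> = 42 * (s * (\<Lambda> / \<epsilon>))" by simp
  finally have "?l / (\<epsilon> / 6) \<le> 42 * (s * (\<Lambda> / \<epsilon>))" .
  moreover have "1 * 1 \<le> s * (\<Lambda> / \<epsilon>)" using s \<Lambda>_le by (intro mult_mono) auto
  ultimately show ?thesis using le by linarith
qed

text \<open>\<open>622 = 34 + 525 + 63\<close>: the block search, \<open>75 * 7\<close> dictator
  queries per block, and the agreement rounds.\<close>

lemma base_cost_le:
  "real (Suc s * (find_rounds s \<epsilon> * 3 + depth s) + (s * (75 * 7) + agree_rounds \<epsilon> * (3 + s * (reps s \<epsilon> * 2))))
    \<le> 622 * (s * (\<Lambda> / \<epsilon>) * \<Lambda>)"
proof -
  let ?Q = "\<Lambda> / \<epsilon>"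
  have Q: "0 \<le> ?Q" using \<Lambda>_le by linarith
  have sQ: "0 \<le> s * ?Q" using Q by (intro mult_nonneg_nonneg) auto
  \<comment> \<open>\<open>Suc s \<le> 2 * s\<close>, and \<open>17 = 4 * 3 + 5\<close> from the
    bounds on \<open>find_rounds\<close> and \<open>depth\<close>.\<close>
  have "real (Suc s) * (find_rounds s \<epsilon> * 3 + depth s) \<le> (2 * s) * (17 * ?Q)"
    using s find_rounds_le depth_le \<Lambda>_le Q by (intro mult_mono) auto
  also have "\<dots> = 34 * (s * ?Q)" by simp
  also have "\<dots> \<le> 34 * (s * ?Q * \<Lambda>)"
    using mult_left_mono[OF _ sQ, of 1 \<Lambda>] \<Lambda>_ge by simp
  finally have 1: "real (Suc s) * (find_rounds s \<epsilon> * 3 + depth s) \<le> 34 * (s * ?Q * \<Lambda>)" .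
  have "real s * 1 * 1 \<le> s * ?Q * \<Lambda>"
    using \<Lambda>_le \<Lambda>_ge Q by (intro mult_mono mult_nonneg_nonneg) auto
  then have 2: "real s * 525 \<le> 525 * (s * ?Q * \<Lambda>)" by simp
  have "real s * (reps s \<epsilon> * 2) \<le> s * (6 * \<Lambda>)"
    using reps_le by (intro mult_left_mono) auto
  also have "\<dots> = 6 * (s * \<Lambda>)" by simp
  finally have "real s * (reps s \<epsilon> * 2) \<le> 6 * (s * \<Lambda>)" .
  moreover have "1 * 1 \<le> s * \<Lambda>" using s \<Lambda>_ge by (intro mult_mono) auto
  ultimately have "3 + real s * (reps s \<epsilon> * 2) \<le> 9 * (s * \<Lambda>)" by linarith
  then have "agree_rounds \<epsilon> * (3 + real s * (reps s \<epsilon> * 2)) \<le> (7 * ?Q) * (9 * (s * \<Lambda>))"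
    using agree_rounds_le Q by (intro mult_mono) auto
  also have "\<dots> = 63 * (s * ?Q * \<Lambda>)" by simp
  finally have 3: "agree_rounds \<epsilon> * (3 + real s * (reps s \<epsilon> * 2)) \<le> 63 * (s * ?Q * \<Lambda>)" .
  have eqs: "real (Suc s * (find_rounds s \<epsilon> * 3 + depth s)) = real (Suc s) * (find_rounds s \<epsilon> * 3 + depth s)"
    "real (s * (75 * 7)) = real s * 525"
    "real (agree_rounds \<epsilon> * (3 + s * (reps s \<epsilon> * 2))) = agree_rounds \<epsilon> * (3 + real s * (reps s \<epsilon> * 2))"
    by (simp_all add: algebra_simps)
  have sum: "a + (b + c) \<le> 622 * y" if "a = a'" "b = b'" "c = c'" "a' \<le> 34 * y" "b' \<le> 525 * y" "c' \<le> 63 * y"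
    for a a' b b' c c' y :: real using that by linarith
  show ?thesis unfolding of_nat_add by (rule sum[OF eqs 1 2 3])
qed

lemma uniform_cost_le:
  assumes "T = s / \<epsilon>"
  shows "real (Suc s * (find_rounds s \<epsilon> * 3 + depth s) + (s * (75 * 7) +
      (agree_rounds \<epsilon> * (3 + s * (reps s \<epsilon> * 2)) + fit_rounds s \<epsilon> * (0 + 1)))) \<le> budget T"
proof -
  have "0 \<le> \<Lambda> / \<epsilon>" using \<Lambda>_le by linarith
  then have "0 \<le> s * (\<Lambda> / \<epsilon>)" by (intro mult_nonneg_nonneg) auto
  then have 1: "43 * (s * (\<Lambda> / \<epsilon>)) \<le> 43 * (s * (\<Lambda> / \<epsilon>) * \<Lambda>)" "0 \<le> s * (\<Lambda> / \<epsilon>) * \<Lambda>"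
    using mult_left_mono[of 1 \<Lambda> "s * (\<Lambda> / \<epsilon>)"] \<Lambda>_ge by auto
  have 2: "real (fit_rounds s \<epsilon> * (0 + 1)) \<le> 43 * (s * (\<Lambda> / \<epsilon>))"
    using fit_rounds_le by simp
  have sum: "a + b \<le> 1000 * x" if "43 * y \<le> 43 * x" "0 \<le> x" "b \<le> 43 * y" "a \<le> 622 * x"
    for a b x y :: real using that by linarith
  have "real (Suc s * (find_rounds s \<epsilon> * 3 + depth s) + (s * (75 * 7) +
      agree_rounds \<epsilon> * (3 + s * (reps s \<epsilon> * 2)))) + real (fit_rounds s \<epsilon> * (0 + 1))
      \<le> 1000 * (s * (\<Lambda> / \<epsilon>) * \<Lambda>)"
    by (rule sum[OF 1 2 base_cost_le])
  then have "real (Suc s * (find_rounds s \<epsilon> * 3 + depth s) + (s * (75 * 7) +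
      (agree_rounds \<epsilon> * (3 + s * (reps s \<epsilon> * 2)) + fit_rounds s \<epsilon> * (0 + 1)))) \<le>
      1000 * (s * (\<Lambda> / \<epsilon>) * \<Lambda>)"
    by (simp only: of_nat_add add.assoc)
  also have "\<dots> = 1000 * T * \<Lambda> ^ 2"
    by (simp add: assms power2_eq_square algebra_simps)
  also have "\<dots> \<le> budget T"
    unfolding budget_def \<Lambda>[symmetric] by simp
  finally show ?thesis .
qed

text \<open>Each fitted point now costs a sample and the decoding of up to \<open>s\<close> bits, so
  the fit dominates with an extra factor \<open>s\<close>.\<close>

lemma distribution_free_cost_le:
  assumes "T = real s ^ 2 / \<epsilon>"
  shows "real (Suc s * (find_rounds s \<epsilon> * 3 + depth s) + (s * (75 * 7) +
      (agree_rounds \<epsilon> * (3 + s * (reps s \<epsilon> * 2)) + fit_rounds s \<epsilon> * (Suc (s * (reps s \<epsilon> * 2)) + 1))))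
    \<le> budget T"
proof -
  let ?Q = "\<Lambda> / \<epsilon>"
  have Q: "0 \<le> ?Q" using \<Lambda>_le by linarith
  have "real s * (reps s \<epsilon> * 2) \<le> s * (6 * \<Lambda>)"
    using reps_le by (intro mult_left_mono) auto
  also have "\<dots> = 6 * (s * \<Lambda>)" by simp
  finally have "real s * (reps s \<epsilon> * 2) \<le> 6 * (s * \<Lambda>)" .
  moreover have "1 * 1 \<le> s * \<Lambda>" using s \<Lambda>_ge by (intro mult_mono) auto
  ultimately have "2 + real s * (reps s \<epsilon> * 2) \<le> 8 * (s * \<Lambda>)" by linarith
  then have "fit_rounds s \<epsilon> * (2 + real s * (reps s \<epsilon> * 2)) \<le> (43 * (s * ?Q)) * (8 * (s * \<Lambda>))"
    using fit_rounds_le Q by (intro mult_mono) auto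
  also have "\<dots> = 344 * (s * (s * ?Q * \<Lambda>))" by simp
  finally have 1: "fit_rounds s \<epsilon> * (2 + real s * (reps s \<epsilon> * 2)) \<le> 344 * (s * (s * ?Q * \<Lambda>))" .
  have "0 \<le> s * ?Q * \<Lambda>" using Q \<Lambda>_ge by (intro mult_nonneg_nonneg) auto
  then have 2: "s * ?Q * \<Lambda> \<le> s * (s * ?Q * \<Lambda>)"
    using mult_right_mono[of 1 "real s" "s * ?Q * \<Lambda>"] s by simp
  then have 3: "0 \<le> s * (s * ?Q * \<Lambda>)" using \<open>0 \<le> s * ?Q * \<Lambda>\<close> by linarith
  have 4: "real (fit_rounds s \<epsilon> * (Suc (s * (reps s \<epsilon> * 2)) + 1)) \<le> 344 * (s * (s * ?Q * \<Lambda>))"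
    using 1 by (simp only: of_nat_add of_nat_mult of_nat_Suc of_nat_1 of_nat_numeral) (simp add: add.commute)
  have sum: "a + b \<le> 1000 * x" if "0 \<le> x" "b \<le> 344 * x" "a \<le> 622 * y" "y \<le> x"
    for a b x y :: real using that by linarith
  have "real (Suc s * (find_rounds s \<epsilon> * 3 + depth s) + (s * (75 * 7) +
      agree_rounds \<epsilon> * (3 + s * (reps s \<epsilon> * 2)))) + real (fit_rounds s \<epsilon> * (Suc (s * (reps s \<epsilon> * 2)) + 1))
      \<le> 1000 * (s * (s * ?Q * \<Lambda>))"
    by (rule sum[OF 3 4 base_cost_le 2])
  then have "real (Suc s * (find_rounds s \<epsilon> * 3 + depth s) + (s * (75 * 7) +
      (agree_rounds \<epsilon> * (3 + s * (reps s \<epsilon> * 2)) + fit_rounds s \<epsilon> * (Suc (s * (reps s \<epsilon> * 2)) + 1))))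
      \<le> 1000 * (s * (s * ?Q * \<Lambda>))"
    by (simp only: of_nat_add add.assoc)
  also have "\<dots> = 1000 * T * \<Lambda> ^ 2"
    by (simp add: assms power2_eq_square algebra_simps)
  also have "\<dots> \<le> budget T"
    unfolding budget_def \<Lambda>[symmetric] by simp
  finally show ?thesis .
qed

end

lemma budget_ge_1: "0 \<le> T \<Longrightarrow> 1 \<le> budget T"
  by (simp add: budget_def)

lemma sound_parameters:
  assumes "1 \<le> s" "0 < \<epsilon>" "\<epsilon> \<le> 1"
  shows "real (Suc s) * (1 - \<epsilon> / 3) ^ find_rounds s \<epsilon> \<le> 1 / 6"
    and "real s * (1 / 3) ^ reps s \<epsilon> \<le> \<epsilon> / 6"
    and "(1 - \<epsilon> / 6) ^ agree_rounds \<epsilon> \<le> 1 / 6"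
    and "real ((s + 2) ^ (6 * s)) * (1 - \<epsilon> / 6) ^ fit_rounds s \<epsilon> \<le> 1 / 6"
    and "3 * s ^ 2 \<le> 2 ^ depth s"
proof -
  have "(1 - \<epsilon> / 3) ^ find_rounds s \<epsilon> \<le> 1 / (6 * (s + 1))"
    unfolding find_rounds_def using assms by (intro rounds_power) auto
  then show "real (Suc s) * (1 - \<epsilon> / 3) ^ find_rounds s \<epsilon> \<le> 1 / 6"
    by (simp add: field_simps)
  have "(1 - 2 / 3) ^ rounds (2 / 3) (6 * s / \<epsilon>) \<le> 1 / (6 * s / \<epsilon>)"
    using assms by (intro rounds_power) auto
  then have "(1 / 3) ^ rounds (2 / 3) (6 * s / \<epsilon>) \<le> 1 / (6 * s / \<epsilon>)" by simp
  moreover have "(1 / 3 :: real) ^ reps s \<epsilon> \<le> (1 / 3) ^ rounds (2 / 3) (6 * s / \<epsilon>)"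
    unfolding reps_def by (rule power_decreasing) auto
  ultimately have "(1 / 3) ^ reps s \<epsilon> \<le> 1 / (6 * s / \<epsilon>)" by linarith
  then have "real s * (1 / 3) ^ reps s \<epsilon> \<le> s * (1 / (6 * s / \<epsilon>))"
    by (rule mult_left_mono) simp
  then show "real s * (1 / 3) ^ reps s \<epsilon> \<le> \<epsilon> / 6" using assms by simp
  show "(1 - \<epsilon> / 6) ^ agree_rounds \<epsilon> \<le> 1 / 6"
    unfolding agree_rounds_def using assms by (intro rounds_power) auto
  have "(1 - \<epsilon> / 6) ^ fit_rounds s \<epsilon> \<le> 1 / (6 * (s + 2) ^ (6 * s))"
    unfolding fit_rounds_def using assms by (intro rounds_power) auto
  then have "real ((s + 2) ^ (6 * s)) * (1 - \<epsilon> / 6) ^ fit_rounds s \<epsilon>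
      \<le> real ((s + 2) ^ (6 * s)) * (1 / (6 * (s + 2) ^ (6 * s)))"
    by (intro mult_left_mono) auto
  then show "real ((s + 2) ^ (6 * s)) * (1 - \<epsilon> / 6) ^ fit_rounds s \<epsilon> \<le> 1 / 6" by simp
  have "(1 - 1 / 2) ^ depth s \<le> 1 / real (3 * s ^ 2)"
    unfolding depth_def using assms by (intro rounds_power) auto
  then have "3 * real s ^ 2 \<le> 2 ^ depth s"
    using assms by (simp add: power_one_over field_simps)
  then have "real (3 * s ^ 2) \<le> real (2 ^ depth s)" by simp
  then show "3 * s ^ 2 \<le> 2 ^ depth s" by (simp only: of_nat_le_iff)
qed

subsection \<open>The testers\<close>

text \<open>For \<open>\<epsilon> > 1\<close> no function is far from a nonempty class, but all are
  far from an empty one, such as branching programs with a single node. For \<open>n = 0\<close> one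
  query determines \<open>f\<close> on the cube.\<close>

definition tester ::
    "(nat \<Rightarrow> nat \<Rightarrow> bool_fun set) \<Rightarrow>
     (nat \<Rightarrow> nat \<Rightarrow> nat \<Rightarrow> nat list \<Rightarrow> (nat \<times> point) list \<Rightarrow> point option algorithm) \<Rightarrow>
     nat \<Rightarrow> nat \<Rightarrow> real \<Rightarrow> bool algorithm" where
  "tester C Z n s \<epsilon> =
    (if \<epsilon> > 1 then Return (C n s \<noteq> {})
     else if n = 0 then Query [] (\<lambda>b. Return ((\<lambda>_. b) \<in> C n s))
     else rand (pmf_of_set (partitions n (2 ^ depth s))) (\<lambda>\<pi>.
       abind (test_core (C s s) n s (Z n s (reps s \<epsilon>)) (find_rounds s \<epsilon>) (depth s) (reps s \<epsilon>)
         (agree_rounds \<epsilon>) (fit_rounds s \<epsilon>) \<pi>) (\<lambda>r. Return (r \<noteq> None))))"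

lemma pmf_accept:
  "pmf (run f D (rand p (\<lambda>\<pi>. abind (A \<pi>) (\<lambda>r. Return (r \<noteq> None))))) True =
    measure_pmf.expectation p (\<lambda>\<pi>. prob_some f D (A \<pi>) (\<lambda>_. True))"
proof -
  have "measure_pmf.prob (run f D (abind (A \<pi>) (\<lambda>r. Return (r \<noteq> None)))) {True} =
      prob_some f D (A \<pi>) (\<lambda>_. True)" for \<pi>
  proof -
    have "run f D (abind (A \<pi>) (\<lambda>r. Return (r \<noteq> None))) = map_pmf (\<lambda>r. r \<noteq> None) (run f D (A \<pi>))"
      by (simp add: run_abind map_pmf_def)
    then show ?thesis by (simp add: prob_some_def vimage_def)
  qed
  then show ?thesis
    by (simp add: run_rand prob_bind_pmf flip: measure_pmf_single)
qed

lemma tester_correct: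
  assumes C: "concise_class C" and D: "set_pmf D \<subseteq> cube n" and s: "1 \<le> s" and \<epsilon>: "0 < \<epsilon>"
    and Z_complete: "\<And>d f \<pi> V t L. separated_junta n d f \<pi> V D \<Longrightarrow> witnessed f n \<pi> L \<Longrightarrow> 0 < t \<Longrightarrow>
      surely f D (Z n s t \<pi> L) (\<lambda>r. \<exists>z. r = Some z \<and> z \<in> cube s)"
    and Z_sound: "\<And>f \<pi> t L \<tau> E. decodable n s f \<pi> L \<tau> D \<Longrightarrow> distinct (map fst L) \<Longrightarrow>
      prob_some f D (Z n s t \<pi> L) E \<le> measure_pmf.prob D {x. E (decode s \<tau> L x)} + s * (1 / 3) ^ t"
    and Z_outputs: "\<And>t \<pi> L. length L \<le> s \<Longrightarrow>
      outputs_le n (Z n s t \<pi> L) (q t) (\<lambda>r. \<forall>z. r = Some z \<longrightarrow> z \<in> cube s)"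
  shows "tests_wrt D (C n s) \<epsilon> (tester C Z n s \<epsilon>)"
proof -
  interpret concise_class C by (rule C)
  consider "1 < \<epsilon>" | "\<epsilon> \<le> 1" "n = 0" | "\<epsilon> \<le> 1" "0 < n" by linarith
  then show ?thesis
  proof cases
    case 1
    have "\<not> far_from \<epsilon> D (C n s) f" if nonempty: "C n s \<noteq> {}" for f
    proof
      assume far: "far_from \<epsilon> D (C n s) f"
      from nonempty obtain g where "g \<in> C n s" by blast
      from bspec[OF far[unfolded far_from_def] this] 1
      have "1 < measure_pmf.prob D {x. f x \<noteq> g x}" by linarith
      with measure_pmf.prob_le_1[of D "{x. f x \<noteq> g x}"] show False by linarith
    qed
    then show ?thesis
      using 1 by (cases "C n s = {}") (simp_all add: tests_wrt_def tester_def)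
  next
    case 2
    have const: "(\<lambda>_. f []) \<in> C n s \<longleftrightarrow> f \<in> C n s" for f
    proof
      have nil: "x = []" if "x \<in> cube n" for x using that 2 by (simp add: cube_def)
      show "f \<in> C n s" if "(\<lambda>_. f []) \<in> C n s" using that by (rule cong) (auto dest!: nil)
      show "(\<lambda>_. f []) \<in> C n s" if "f \<in> C n s" using that by (rule cong) (auto dest!: nil)
    qed
    have "f \<notin> C n s" if "far_from \<epsilon> D (C n s) f" for f
    proof
      assume "f \<in> C n s"
      from bspec[OF that[unfolded far_from_def] this] show False using \<epsilon> by simp
    qed
    then show ?thesis
      using 2 const by (simp add: tests_wrt_def tester_def)
  next
    case 3
    let ?core = "\<lambda>\<pi>. test_core (C s s) n s (Z n s (reps s \<epsilon>)) (find_rounds s \<epsilon>) (depth s) (reps s \<epsilon>)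
         (agree_rounds \<epsilon>) (fit_rounds s \<epsilon>) \<pi>"
    let ?U = "pmf_of_set (partitions n (2 ^ depth s))"
    have ne: "partitions n (2 ^ depth s) \<noteq> {}" by (rule partitions_nonempty) simp
    have accept: "pmf (run f D (tester C Z n s \<epsilon>)) True =
        measure_pmf.expectation ?U (\<lambda>\<pi>. prob_some f D (?core \<pi>) (\<lambda>_. True))" for f
    proof -
      have "\<not> \<epsilon> > 1" "n \<noteq> 0" using 3 by simp_all
      then show ?thesis unfolding tester_def by (simp only: if_False pmf_accept)
    qed
    show ?thesis
      unfolding tests_wrt_def
    proof (intro allI conjI impI)
      fix f assume f: "f \<in> C n s"
      obtain V where V: "V \<subseteq> {..<n}" "card V \<le> s"
          "\<forall>x\<in>cube n. \<forall>y\<in>cube n. (\<forall>j\<in>V. x ! j = y ! j) \<longrightarrow> f x = f y"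
        using junta[OF f] by blast
      note card_V = V(2)
      have core: "prob_some f D (?core \<pi>) (\<lambda>_. True) = 1" if \<pi>: "\<pi> \<in> partitions n (2 ^ depth s)" "inj_on ((!) \<pi>) V" for \<pi>
      proof -
        interpret separated_junta n "depth s" f \<pi> V D
        proof unfold_locales
          show "f x = f y" if "x \<in> cube n" "y \<in> cube n" "\<And>j. j \<in> V \<Longrightarrow> x ! j = y ! j" for x y
            using V(3) that by metis
        qed (fact \<pi> V(1) D)+
        have "surely f D (?core \<pi>) (\<lambda>r. \<exists>a. r = Some a)"
        proof (rule surely_test_core[OF card_V])
          show "0 < reps s \<epsilon>" by (simp add: reps_def)
          show "surely f D (Z n s (reps s \<epsilon>) \<pi> L) (\<lambda>r. \<exists>z. r = Some z \<and> z \<in> cube s)"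
            if "witnessed f n \<pi> L" for L
            by (rule Z_complete[OF separated_junta_axioms that]) (simp add: reps_def)
          show "(\<lambda>z. f (subst n (block_of \<pi> L) z)) \<in> C s s" if "length L \<le> s" for L
          proof (rule subst_closed[OF f])
            fix j l assume "block_of \<pi> L j = Some l"
            then have "(\<pi> ! j, l) \<in> set (zip (map fst L) [0..<length L])"
              unfolding block_of_def by (rule map_of_SomeD)
            then show "l < s" using that by (auto dest: set_zip_rightD)
          qed (use s in simp)
        qed
        then show ?thesis
          unfolding prob_some_def surely_def by (subst measure_pmf.prob_eq_1) (auto simp: AE_measure_pmf_iff)
      qed
      \<comment> \<open>The core accepts surely on separating partitions, so acceptance is at least
        as likely as separation.\<close>
      have "1 - measure_pmf.prob ?U {\<pi>. \<not> inj_on ((!) \<pi>) V} = measure_pmf.prob ?U {\<pi>. inj_on ((!) \<pi>) V}"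
        by (simp add: prob_not)
      also have "\<dots> = measure_pmf.expectation ?U (\<lambda>\<pi>. of_bool (inj_on ((!) \<pi>) V))"
        by (rule expectation_of_bool[symmetric])
      also have "\<dots> \<le> measure_pmf.expectation ?U (\<lambda>\<pi>. prob_some f D (?core \<pi>) (\<lambda>_. True))"
        using core ne by (intro integral_mono_AE) (auto simp: AE_measure_pmf_iff)
      also have "\<dots> = pmf (run f D (tester C Z n s \<epsilon>)) True"
        by (rule accept[symmetric])
      finally show "2 / 3 \<le> pmf (run f D (tester C Z n s \<epsilon>)) True"
        using separation[OF V(1,2) sound_parameters(5)[OF s \<epsilon> 3(1)]] by simp
    next
      fix f assume far: "far_from \<epsilon> D (C n s) f"
      \<comment> \<open>The bound holds for each partition, so the exceptional set in the averaging
        step is empty.\<close>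
      have "prob_some f D (?core \<pi>) (\<lambda>_. True) \<le> 1 / 3" if \<pi>: "\<pi> \<in> partitions n (2 ^ depth s)" for \<pi>
        by (rule test_core_sound[OF C D \<pi> 3(2) s \<epsilon> 3(1) far Z_sound Z_outputs sound_parameters(1,2,3,4)[OF s \<epsilon> 3(1)]])
      then have "measure_pmf.expectation ?U (\<lambda>\<pi>. prob_some f D (?core \<pi>) (\<lambda>_. True))
          \<le> measure_pmf.prob ?U {} + 1 / 3"
        using ne by (intro expectation_le_prob_add) auto
      then have "pmf (run f D (tester C Z n s \<epsilon>)) True \<le> 1 / 3"
        unfolding accept by simp
      then show "2 / 3 \<le> pmf (run f D (tester C Z n s \<epsilon>)) False"
        by (simp add: pmf_False_conv_True)
    qed
  qed
qed

lemma tester_queries: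
  assumes s: "1 \<le> s" and \<epsilon>: "0 < \<epsilon>" and T: "0 \<le> T"
    and Z_outputs: "\<And>t \<pi> L. length L \<le> s \<Longrightarrow>
      outputs_le n (Z n s t \<pi> L) (q t) (\<lambda>r. \<forall>z. r = Some z \<longrightarrow> z \<in> cube s)"
    and cost: "\<epsilon> \<le> 1 \<Longrightarrow> real (Suc s * (find_rounds s \<epsilon> * 3 + depth s) + (s * (75 * 7) +
      (agree_rounds \<epsilon> * (3 + s * (reps s \<epsilon> * 2)) + fit_rounds s \<epsilon> * (q (reps s \<epsilon>) + 1)))) \<le> budget T"
  shows "makes_at_most n (tester C Z n s \<epsilon>) (budget T)"
proof -
  consider "1 < \<epsilon>" | "\<epsilon> \<le> 1" "n = 0" | "\<epsilon> \<le> 1" "0 < n" by linarith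
  then show ?thesis
  proof cases
    case 1
    then have "queries_le n (tester C Z n s \<epsilon>) 0" by (simp add: tester_def)
    then show ?thesis
      unfolding makes_at_most_def using budget_ge_1[OF T] by (intro exI[of _ 0]) simp
  next
    case 2
    then have "queries_le n (tester C Z n s \<epsilon>) 1" by (simp add: tester_def cube_def)
    then show ?thesis
      unfolding makes_at_most_def using budget_ge_1[OF T] by (intro exI[of _ 1]) simp
  next
    case 3
    let ?q = "Suc s * (find_rounds s \<epsilon> * 3 + depth s) + (s * (75 * 7) +
      (agree_rounds \<epsilon> * (3 + s * (reps s \<epsilon> * 2)) + fit_rounds s \<epsilon> * (q (reps s \<epsilon>) + 1)))"
    have "outputs_le n (abind (test_core (C s s) n s (Z n s (reps s \<epsilon>)) (find_rounds s \<epsilon>) (depth s) (reps s \<epsilon>)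
         (agree_rounds \<epsilon>) (fit_rounds s \<epsilon>) \<pi>) (\<lambda>r. Return (r \<noteq> None))) (?q + 0) (\<lambda>_. True)" for \<pi>
      by (rule outputs_le_abind[OF outputs_test_core[OF Z_outputs]]) simp_all
    then have "outputs_le n (tester C Z n s \<epsilon>) ?q (\<lambda>_. True)"
      using 3 by (simp add: tester_def outputs_le_rand)
    then show ?thesis
      unfolding makes_at_most_def using cost[OF 3(1)] outputs_le_queries_le by blast
  qed
qed

lemma concise_uniform_tester:
  assumes C: "concise_class C" and s: "1 \<le> s" and \<epsilon>: "0 < \<epsilon>"
  shows "uniform_tester n (C n s) \<epsilon> (tester C (\<lambda>n s t. uniform_points s) n s \<epsilon>)"
    and "makes_at_most n (tester C (\<lambda>n s t. uniform_points s) n s \<epsilon>) (budget (s / \<epsilon>))"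
proof -
  have outputs: "outputs_le n (uniform_points s \<pi> L) 0 (\<lambda>r. \<forall>z. r = Some z \<longrightarrow> z \<in> cube s)" for \<pi> L
    unfolding uniform_points_def by (rule outputs_le_rand) simp
  show "uniform_tester n (C n s) \<epsilon> (tester C (\<lambda>n s t. uniform_points s) n s \<epsilon>)"
    unfolding uniform_tester_def
  proof (rule tester_correct[OF C _ s \<epsilon>, where q = "\<lambda>_. 0"])
    fix f \<pi> L \<tau> E and t :: nat
    assume dec: "decodable n s f \<pi> L \<tau> (pmf_of_set (cube n))" "distinct (map fst L)"
    \<comment> \<open>The points drawn have exactly the law of decoded uniform samples; the error
      term is mere slack here.\<close>
    from decodable.uniform_points_sound[OF this]
    show "prob_some f (pmf_of_set (cube n)) (uniform_points s \<pi> L) E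
        \<le> measure_pmf.prob (pmf_of_set (cube n)) {x. E (decode s \<tau> L x)} + s * (1 / 3) ^ t"
      by simp
  qed (simp_all add: outputs separated_junta.surely_uniform_points)
  show "makes_at_most n (tester C (\<lambda>n s t. uniform_points s) n s \<epsilon>) (budget (s / \<epsilon>))"
  proof (rule tester_queries[OF s \<epsilon>, where q = "\<lambda>_. 0"])
    show "real (Suc s * (find_rounds s \<epsilon> * 3 + depth s) + (s * (75 * 7) +
      (agree_rounds \<epsilon> * (3 + s * (reps s \<epsilon> * 2)) + fit_rounds s \<epsilon> * (0 + 1)))) \<le> budget (s / \<epsilon>)"
      if "\<epsilon> \<le> 1"
      by (rule uniform_cost_le[OF s \<epsilon> that order_refl refl refl])
  qed (use \<epsilon> outputs in simp_all)
qed

lemma concise_distribution_free_tester: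
  assumes C: "concise_class C" and s: "1 \<le> s" and \<epsilon>: "0 < \<epsilon>"
  shows "distribution_free_tester n (C n s) \<epsilon> (tester C sampled_points n s \<epsilon>)"
    and "makes_at_most n (tester C sampled_points n s \<epsilon>) (budget (real s ^ 2 / \<epsilon>))"
proof -
  \<comment> \<open>\<open>Suc\<close> charges the sample itself.\<close>
  have outputs: "outputs_le n (sampled_points n s t \<pi> L) (Suc (s * (t * 2)))
      (\<lambda>r. \<forall>z. r = Some z \<longrightarrow> z \<in> cube s)" if L: "length L \<le> s" for t \<pi> L
  proof -
    have "length L * (t * 2) \<le> s * (t * 2)" by (rule mult_le_mono1[OF L])
    then have "outputs_le n (vals n s t \<pi> L x) (s * (t * 2)) (\<lambda>r. \<forall>z. r = Some z \<longrightarrow> z \<in> cube s)" for x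
      by (rule outputs_le_mono[OF outputs_vals])
    then show ?thesis by (simp add: sampled_points_def)
  qed
  show "distribution_free_tester n (C n s) \<epsilon> (tester C sampled_points n s \<epsilon>)"
    unfolding distribution_free_tester_def
  proof (intro allI impI)
    fix D :: "point pmf" assume D: "set_pmf D \<subseteq> cube n"
    show "tests_wrt D (C n s) \<epsilon> (tester C sampled_points n s \<epsilon>)"
    proof (rule tester_correct[OF C D s \<epsilon>, where q = "\<lambda>t. Suc (s * (t * 2))"])
      fix d f \<pi> V L and t :: nat
      assume "separated_junta n d f \<pi> V D" "witnessed f n \<pi> L" "0 < t"
      then show "surely f D (sampled_points n s t \<pi> L) (\<lambda>r. \<exists>z. r = Some z \<and> z \<in> cube s)"
        by (rule separated_junta.surely_sampled_points)
    next
      fix f \<pi> L \<tau> E and t :: nat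
      assume "decodable n s f \<pi> L \<tau> D"
      then show "prob_some f D (sampled_points n s t \<pi> L) E
          \<le> measure_pmf.prob D {x. E (decode s \<tau> L x)} + s * (1 / 3) ^ t"
        by (rule decodable.sampled_points_sound)
    qed (rule outputs)
  qed
  have le: "real s / \<epsilon> \<le> real s ^ 2 / \<epsilon>"
    using s \<epsilon> by (intro divide_right_mono) (simp_all add: power2_eq_square)
  show "makes_at_most n (tester C sampled_points n s \<epsilon>) (budget (real s ^ 2 / \<epsilon>))"
  proof (rule tester_queries[OF s \<epsilon>, where q = "\<lambda>t. Suc (s * (t * 2))"])
    show "real (Suc s * (find_rounds s \<epsilon> * 3 + depth s) + (s * (75 * 7) +
      (agree_rounds \<epsilon> * (3 + s * (reps s \<epsilon> * 2)) + fit_rounds s \<epsilon> * (Suc (s * (reps s \<epsilon> * 2)) + 1))))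
      \<le> budget (real s ^ 2 / \<epsilon>)" if "\<epsilon> \<le> 1"
      by (rule distribution_free_cost_le[OF s \<epsilon> that le refl]) simp
    show "0 \<le> real s ^ 2 / \<epsilon>" using \<epsilon> by simp
  qed (rule outputs)
qed

theorem theorem11:
  "(\<forall>C \<in> {decision_tree_class, branching_program_class}.
      \<exists>A :: nat \<Rightarrow> nat \<Rightarrow> real \<Rightarrow> bool algorithm. \<exists>B \<in> soft_O.
        \<forall>n s. \<forall>\<epsilon> > 0. s \<ge> 1 \<longrightarrow>
          uniform_tester n (C n s) \<epsilon> (A n s \<epsilon>) \<and>
          makes_at_most n (A n s \<epsilon>) (B (real s / \<epsilon>))) \<and>
   (\<forall>C \<in> {decision_tree_class, branching_program_class}.
      \<exists>A :: nat \<Rightarrow> nat \<Rightarrow> real \<Rightarrow> bool algorithm. \<exists>B \<in> soft_O.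
        \<forall>n s. \<forall>\<epsilon> > 0. s \<ge> 1 \<longrightarrow>
          distribution_free_tester n (C n s) \<epsilon> (A n s \<epsilon>) \<and>
          makes_at_most n (A n s \<epsilon>) (B (real s ^ 2 / \<epsilon>)))"
proof -
  have concise: "concise_class C" if "C \<in> {decision_tree_class, branching_program_class}" for C
    using that concise_decision_tree concise_branching_program by blast
  show ?thesis
  proof (intro conjI ballI)
    fix C :: "nat \<Rightarrow> nat \<Rightarrow> bool_fun set"
    assume "C \<in> {decision_tree_class, branching_program_class}"
    note C = concise[OF this]
    show "\<exists>A :: nat \<Rightarrow> nat \<Rightarrow> real \<Rightarrow> bool algorithm. \<exists>B \<in> soft_O. \<forall>n s. \<forall>\<epsilon> > 0. s \<ge> 1 \<longrightarrow>
          uniform_tester n (C n s) \<epsilon> (A n s \<epsilon>) \<and> makes_at_most n (A n s \<epsilon>) (B (real s / \<epsilon>))"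
      by (rule exI, rule bexI[OF _ budget_soft_O], intro allI impI conjI)
        (rule concise_uniform_tester[OF C]; assumption)+
    show "\<exists>A :: nat \<Rightarrow> nat \<Rightarrow> real \<Rightarrow> bool algorithm. \<exists>B \<in> soft_O. \<forall>n s. \<forall>\<epsilon> > 0. s \<ge> 1 \<longrightarrow>
          distribution_free_tester n (C n s) \<epsilon> (A n s \<epsilon>) \<and> makes_at_most n (A n s \<epsilon>) (B (real s ^ 2 / \<epsilon>))"
      by (rule exI, rule bexI[OF _ budget_soft_O], intro allI impI conjI)
        (rule concise_distribution_free_tester[OF C]; assumption)+
  qed
qed

end
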